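(* Let $h:[0,\infty)\to[0,\infty)$ be continuous, nondecreasing, with $h(s)=0$ only for $s=0$. Assume that $r\mapsto rh(r)$ is convex, that $$\int_c^\infty\frac{ds}{s\,h(s)}<\infty \text{ for some } c>0,$$ and that $$\int_a^\infty\frac{ds}{\sqrt{H(s)}}=\infty\ \text{ for all } a>0,\qquad H(s)=\int_0^s t\,h(t)\,dt .$$ Let $g\in C(\mathbb{R}^N)$, $g\ge0$, satisfy $$\lim_{|x|\to\infty}\frac{g(x)}{V_a(|x|)}=\infty\qquad\text{for every } a>0,$$ where $V_a$ is defined in the context. For $a>0$ and $n\in\mathbb{N}$ let $u_{a,n}$ be the solution of $$\partial_t u-\Delta u+uh(u)=0 \text{ in } (0,\infty)\times B_n,\quad u=V_a(n) \text{ on } (0,\infty)\times\partial B_n,\quad u(0,\cdot)=\min\{V_a(|\cdot|),g\} \text{ in } B_n .$$ Then for every $m\in\mathbb{N}$ the sequence $(u_{a,n})_{n>m}$ is decreasing in $(0,\infty)\times B_m$ and converges there to a function $u_a$ which is a solution of $\partial_t u-\Delta u+uh(u)=0$ in $(0,\infty)\times\mathbb{R}^N$ with initial datum $\min\{V_a(|\cdot|),g\}$. Furthermore, $u_a(t,x)\to\infty$ as $a\to\infty$ for every $(t,x)\in(0,\infty)\times\mathbb{R}^N$.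
   Context: $B_n$ denotes the open ball of radius $n$ centered at $0$ in $\mathbb{R}^N$. For $a>0$, $V_a$ denotes the maximal solution of the radial problem $V''+\frac{N-1}{r}V'-Vh(V)=0$ on $(0,R_a)$, $V(0)=a$, $V'(0)=0$; under the assumption $\int_a^\infty ds/\sqrt{H(s)}=\infty$ for all $a>0$ it is defined on all of $(0,\infty)$ (i.e. $R_a=\infty$), and it is increasing in $r$. A solution with initial datum $\psi$ means a nonnegative continuous weak solution of the equation with $u(t,\cdot)\to\psi$ locally uniformly as $t\to0$. *)

theory Defs
  imports "HOL-Analysis.Analysis"
begin

definition dirderiv :: "(real \<times> 'a::euclidean_space \<Rightarrow> real) \<Rightarrow> real \<times> 'a \<Rightarrow> real \<times> 'a \<Rightarrow> real" where
  "dirderiv f p v = deriv (\<lambda>s. f (p + s *\<^sub>R v)) 0"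

definition dirderiv2 :: "(real \<times> 'a::euclidean_space \<Rightarrow> real) \<Rightarrow> real \<times> 'a \<Rightarrow> real \<times> 'a \<Rightarrow> real" where
  "dirderiv2 f p v = deriv (\<lambda>s. dirderiv f (p + s *\<^sub>R v) v) 0"

definition test_fun :: "'a::euclidean_space set \<Rightarrow> (real \<times> 'a \<Rightarrow> real) \<Rightarrow> bool" where
  "test_fun \<Omega> \<phi> \<longleftrightarrow>
     (\<exists>K. compact K \<and> K \<subseteq> {0<..} \<times> \<Omega> \<and> (\<forall>p. p \<notin> K \<longrightarrow> \<phi> p = 0)) \<and>
     (\<exists>D D2. (\<forall>p. (\<phi> has_derivative blinfun_apply (D p)) (at p)) \<and>
             (\<forall>p. (D has_derivative blinfun_apply (D2 p)) (at p)) \<and>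
             continuous_on UNIV D2)"

text \<open>Continuous weak (distributional) solution of  u_t - Lap u + u h(u) = 0  in (0,oo) x Omega.\<close>
definition weak_sol :: "(real \<Rightarrow> real) \<Rightarrow> 'a::euclidean_space set \<Rightarrow> (real \<Rightarrow> 'a \<Rightarrow> real) \<Rightarrow> bool" where
  "weak_sol h \<Omega> u \<longleftrightarrow>
     continuous_on ({0<..} \<times> \<Omega>) (\<lambda>(t,x). u t x) \<and>
     (\<forall>\<phi>. test_fun \<Omega> \<phi> \<longrightarrow>
        integral UNIV (\<lambda>p. if p \<in> {0<..} \<times> \<Omega> then
            - u (fst p) (snd p) * (dirderiv \<phi> p (1, 0) + (\<Sum>b\<in>Basis. dirderiv2 \<phi> p (0, b)))
            + u (fst p) (snd p) * h (u (fst p) (snd p)) * \<phi> p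
          else 0) = 0)"

definition sol_init :: "(real \<Rightarrow> real) \<Rightarrow> 'a::euclidean_space set \<Rightarrow> ('a \<Rightarrow> real) \<Rightarrow> (real \<Rightarrow> 'a \<Rightarrow> real) \<Rightarrow> bool" where
  "sol_init h \<Omega> \<psi> u \<longleftrightarrow>
     weak_sol h \<Omega> u \<and> (\<forall>t>0. \<forall>x\<in>\<Omega>. 0 \<le> u t x) \<and>
     (\<forall>K. compact K \<and> K \<subseteq> \<Omega> \<longrightarrow>
        (\<forall>e>0. \<forall>\<^sub>F t in at_right 0. \<forall>x\<in>K. \<bar>u t x - \<psi> x\<bar> < e))"

definition dirichlet_sol :: "(real \<Rightarrow> real) \<Rightarrow> real \<Rightarrow> real \<Rightarrow> ('a::euclidean_space \<Rightarrow> real) \<Rightarrow> (real \<Rightarrow> 'a \<Rightarrow> real) \<Rightarrow> bool" where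
  "dirichlet_sol h n \<beta> \<psi> u \<longleftrightarrow>
     sol_init h (ball 0 n) \<psi> u \<and>
     continuous_on ({0<..} \<times> cball 0 n) (\<lambda>(t,x). u t x) \<and>
     (\<forall>t>0. \<forall>x. norm x = n \<longrightarrow> u t x = \<beta>) \<and>
     bounded ((\<lambda>(t,x). u t x) ` ({0<..} \<times> ball 0 n))"

definition radial_sol :: "(real \<Rightarrow> real) \<Rightarrow> nat \<Rightarrow> real \<Rightarrow> (real \<Rightarrow> real) \<Rightarrow> bool" where
  "radial_sol h N a V \<longleftrightarrow>
     V 0 = a \<and> (V has_real_derivative 0) (at 0 within {0..}) \<and>
     (\<forall>r>0. V differentiable (at r) \<and>
        (deriv V has_real_derivative (V r * h (V r) - (real N - 1) / r * deriv V r)) (at r))"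

end

theory Submission
  imports Defs
begin

text \<open>Write \<open>f(s) = s h(s)\<close>. Monotonicity of \<open>f\<close> gives a comparison principle for continuous weak solutions:
  after mollification the difference of two solutions is a smooth near-subsolution of the heat equation
  wherever it is positive. Hence \<open>u\<^sub>a\<^sub>,\<^sub>n \<le> V\<^sub>a\<close>, so the larger ball carries the smaller boundary values and
  \<open>u\<^sub>a\<^sub>,\<^sub>n\<close> decreases in \<open>n\<close>. Interior Lipschitz bounds depending only on bounds for \<open>u\<close> and \<open>f(u)\<close> make the limit
  continuous, and explicit paraboloids below the initial datum control it as \<open>t \<rightarrow> 0\<close>.
  For the blow-up, convexity and \<open>f(0) = 0\<close> make \<open>f\<close> superadditive, so \<open>w = V\<^sub>a - u\<^sub>a\<^sub>,\<^sub>n\<close> satisfies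
  \<open>w\<^sub>t - \<Delta>w + f(w) \<le> 0\<close> with zero boundary values. It stays below the flat solution \<open>\<phi>' = -f(\<phi>)\<close> with
  \<open>\<phi>(0+) = \<infinity>\<close>, which is finite for \<open>t > 0\<close> and independent of \<open>a\<close>; thus \<open>u\<^sub>a \<ge> V\<^sub>a - \<phi>(t) \<ge> a - \<phi>(t)\<close>.\<close>

section \<open>The maximum principle for approximable subsolutions\<close>

text \<open>The obstacle is regularity: solutions are only continuous and solve the equation as
  distributions, while comparison wants second derivatives at a maximum. A nonlinear equation is not
  preserved by mollification, so the right-hand side is carried along as a separate function:
  \<open>f(u)\<close> is continuous, its mollification is uniformly close to it on compact sets, and
  this survives subtracting two solutions. A second obstacle is the corner where time 0 meets the
  sphere of radius \<open>n\<close>: the datum \<open>min {V_a, g}\<close> may lie below the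
  boundary value \<open>V_a(n)\<close>, and the initial trace is attained only on compact subsets of
  the open ball. Comparing two solutions therefore takes a barrier that is of size one in a thin
  shell for a short time and negligible at every fixed later time. For the lower bound
  \<open>V_a - \<phi>\<close> the infinite initial value of \<open>\<phi>\<close> covers the corner
  by itself. Finally every estimate used in the limit must be uniform in \<open>n\<close>: the
  modulus of continuity comes from the local bound \<open>V_a\<close>, the initial trace from below
  from a barrier on a fixed small ball, and from above from monotonicity.\<close>

lemma left_max_imp_deriv_nonneg:
  fixes g :: "real \<Rightarrow> real"
  assumes "(g has_real_derivative D) (at t)" "d > 0"
    and "\<And>s. t - d < s \<Longrightarrow> s < t \<Longrightarrow> g s \<le> g t"
  shows "D \<ge> 0"
proof (rule ccontr)
  assume "\<not> D \<ge> 0"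
  then obtain d' where d': "d' > 0" "\<And>h. 0 < h \<Longrightarrow> h < d' \<Longrightarrow> g t < g (t - h)"
    using DERIV_neg_dec_left[OF assms(1)] by auto
  define h where "h = min d d' / 2"
  have "0 < h" "h < d'" "h < d" using assms(2) d'(1) by (auto simp: h_def)
  then show False using d'(2)[of h] assms(3)[of "t - h"] by auto
qed

lemma local_max_imp_second_deriv_le_0:
  fixes g :: "real \<Rightarrow> real"
  assumes g: "\<And>s. \<bar>s\<bar> < d \<Longrightarrow> (g has_real_derivative g' s) (at s)"
    and g': "(g' has_real_derivative D) (at 0)" and d: "d > 0"
    and max: "\<And>s. \<bar>s\<bar> < d \<Longrightarrow> g s \<le> g 0"
  shows "D \<le> 0"
proof (rule ccontr)
  assume "\<not> D \<le> 0"
  moreover have g'0: "g' 0 = 0"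
    using DERIV_local_max[OF g[of 0] d] max d by auto
  ultimately obtain d' where d': "d' > 0" "\<And>h. 0 < h \<Longrightarrow> h < d' \<Longrightarrow> 0 < g' h"
    using DERIV_pos_inc_right[OF g'] by auto
  define s where "s = min d d' / 2"
  have s: "0 < s" "s < d'" "s < d" using d d'(1) by (auto simp: s_def)
  obtain z where z: "0 < z" "z < s" "g s - g 0 = (s - 0) * g' z"
    using MVT2[OF s(1), of g g'] g s by auto
  have "0 < s * g' z" using z d'(2)[of z] s by (intro mult_pos_pos) auto
  then have "g s > g 0" using z by simp
  then show False using max[of s] s by auto
qed

text \<open>Existence of the derivatives along coordinate lines is all that the maximum principle needs,
  so no joint differentiability is required.\<close>

definition heat_derivs where
  "heat_derivs \<Omega> v \<kappa> vt vb vbb \<longleftrightarrow> (\<forall>t>0::real. \<forall>x\<in>(\<Omega> :: 'a::euclidean_space set).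
       ((\<lambda>s. v s x) has_real_derivative vt t x) (at t) \<and>
       (\<forall>b\<in>Basis. ((\<lambda>s. v t (x + s *\<^sub>R b)) has_real_derivative vb b t x) (at 0) \<and>
                  ((\<lambda>s. vb b t (x + s *\<^sub>R b)) has_real_derivative vbb b t x) (at 0)) \<and>
       \<kappa> t x = vt t x - (\<Sum>b\<in>Basis. vbb b t x))"

definition heat_smooth :: "'a::euclidean_space set \<Rightarrow> (real \<Rightarrow> 'a \<Rightarrow> real) \<Rightarrow> (real \<Rightarrow> 'a \<Rightarrow> real) \<Rightarrow> bool" where
  "heat_smooth \<Omega> v \<kappa> \<longleftrightarrow> continuous_on ({0<..} \<times> \<Omega>) (\<lambda>(t,x). v t x) \<and> (\<exists>vt vb vbb. heat_derivs \<Omega> v \<kappa> vt vb vbb)"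

text \<open>The intermediate notion between classical and distributional solutions of \<open>w\<^sub>t - \<Delta>w = k\<close>: weak
  solutions satisfy it by mollification, it is stable under linear combinations, and classical arguments
  at a maximum point still apply to the approximants.\<close>

definition heat_approx :: "'a::euclidean_space set \<Rightarrow> (real \<Rightarrow> 'a \<Rightarrow> real) \<Rightarrow> (real \<Rightarrow> 'a \<Rightarrow> real) \<Rightarrow> bool" where
  "heat_approx \<Omega> w k \<longleftrightarrow> continuous_on ({0<..} \<times> \<Omega>) (\<lambda>(t,x). w t x) \<and>
    (\<forall>C e. compact C \<and> C \<subseteq> {0<..} \<times> \<Omega> \<and> e > 0 \<longrightarrow>
      (\<exists>v \<kappa>. heat_smooth \<Omega> v \<kappa> \<and>
         (\<forall>t x. (t,x) \<in> C \<longrightarrow> \<bar>v t x - w t x\<bar> \<le> e \<and> \<bar>\<kappa> t x - k t x\<bar> \<le> e)))"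

lemma heat_smoothI:
  assumes "continuous_on ({0<..} \<times> \<Omega>) (\<lambda>(t,x). v t x)"
    and "\<And>t x. t > 0 \<Longrightarrow> x \<in> \<Omega> \<Longrightarrow> ((\<lambda>s. v s x) has_real_derivative vt t x) (at t)"
    and "\<And>t x b. t > 0 \<Longrightarrow> x \<in> \<Omega> \<Longrightarrow> b \<in> Basis \<Longrightarrow>
      ((\<lambda>s. v t (x + s *\<^sub>R b)) has_real_derivative vb b t x) (at 0)"
    and "\<And>t x b. t > 0 \<Longrightarrow> x \<in> \<Omega> \<Longrightarrow> b \<in> Basis \<Longrightarrow>
      ((\<lambda>s. vb b t (x + s *\<^sub>R b)) has_real_derivative vbb b t x) (at 0)"
    and "\<And>t x. t > 0 \<Longrightarrow> x \<in> \<Omega> \<Longrightarrow> \<kappa> t x = vt t x - (\<Sum>b\<in>Basis. vbb b t x)"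
  shows "heat_smooth \<Omega> v \<kappa>"
  unfolding heat_smooth_def heat_derivs_def using assms(1)
  by (intro conjI exI[of _ vt] exI[of _ vb] exI[of _ vbb]) (use assms in auto)

text \<open>The definition differentiates along a coordinate line only at parameter 0. Openness of
  the domain lets the base point slide along the line, which yields the derivative on a whole
  interval; the second-derivative test needs it there.\<close>

lemma heat_derivsD:
  assumes *: "heat_derivs \<Omega> v \<kappa> vt vb vbb" and \<Omega>: "open \<Omega>" and t: "t > 0" and x: "x \<in> \<Omega>"
  shows "((\<lambda>s. v s x) has_real_derivative vt t x) (at t)"
    and "b \<in> Basis \<Longrightarrow> \<exists>d>0. \<forall>s. \<bar>s\<bar> < d \<longrightarrow>
        ((\<lambda>s. v t (x + s *\<^sub>R b)) has_real_derivative vb b t (x + s *\<^sub>R b)) (at s)"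
    and "b \<in> Basis \<Longrightarrow> ((\<lambda>s. vb b t (x + s *\<^sub>R b)) has_real_derivative vbb b t x) (at 0)"
    and "\<kappa> t x = vt t x - (\<Sum>b\<in>Basis. vbb b t x)"
proof -
  assume b: "b \<in> Basis"
  obtain d where d: "d > 0" "ball x d \<subseteq> \<Omega>" using \<Omega> x open_contains_ball by blast
  have "((\<lambda>s. v t (x + s *\<^sub>R b)) has_real_derivative vb b t (x + s *\<^sub>R b)) (at s)" if "\<bar>s\<bar> < d" for s
  proof -
    have "x + s *\<^sub>R b \<in> \<Omega>" using that b d(2) by (auto simp: subset_iff dist_norm)
    then have "((\<lambda>r. v t (x + s *\<^sub>R b + r *\<^sub>R b)) has_real_derivative vb b t (x + s *\<^sub>R b)) (at 0)"
      using * t b unfolding heat_derivs_def by blast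
    then have "((\<lambda>r. v t (x + (r + s) *\<^sub>R b)) has_real_derivative vb b t (x + s *\<^sub>R b)) (at 0)"
      by (simp add: scaleR_add_left add_ac)
    then show ?thesis
      using DERIV_shift[of "\<lambda>r. v t (x + r *\<^sub>R b)" _ 0 s] by simp
  qed
  then show "\<exists>d>0. \<forall>s. \<bar>s\<bar> < d \<longrightarrow>
        ((\<lambda>s. v t (x + s *\<^sub>R b)) has_real_derivative vb b t (x + s *\<^sub>R b)) (at s)" using d(1) by blast
qed (use * t x in \<open>auto simp: heat_derivs_def\<close>)

lemma heat_smooth_add:
  assumes "heat_smooth \<Omega> v \<kappa>" "heat_smooth \<Omega> v' \<kappa>'"
  shows "heat_smooth \<Omega> (\<lambda>t x. v t x + v' t x) (\<lambda>t x. \<kappa> t x + \<kappa>' t x)"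
proof -
  obtain vt vb vbb where 1: "heat_derivs \<Omega> v \<kappa> vt vb vbb"
    using assms(1) unfolding heat_smooth_def by blast
  obtain vt' vb' vbb' where 2: "heat_derivs \<Omega> v' \<kappa>' vt' vb' vbb'"
    using assms(2) unfolding heat_smooth_def by blast
  have "continuous_on ({0<..} \<times> \<Omega>) (\<lambda>(t,x). v t x + v' t x)"
    using assms unfolding heat_smooth_def case_prod_beta by (intro continuous_intros) auto
  then show ?thesis
    by (rule heat_smoothI[where vt="\<lambda>t x. vt t x + vt' t x" and vb="\<lambda>b t x. vb b t x + vb' b t x"
          and vbb="\<lambda>b t x. vbb b t x + vbb' b t x"])
       (use 1 2 in \<open>auto simp: heat_derivs_def sum.distrib intro!: DERIV_add\<close>)
qed

lemma heat_smooth_cmult: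
  assumes "heat_smooth \<Omega> v \<kappa>"
  shows "heat_smooth \<Omega> (\<lambda>t x. c * v t x) (\<lambda>t x. c * \<kappa> t x)"
proof -
  obtain vt vb vbb where 1: "heat_derivs \<Omega> v \<kappa> vt vb vbb"
    using assms(1) unfolding heat_smooth_def by blast
  have "continuous_on ({0<..} \<times> \<Omega>) (\<lambda>(t,x). c * v t x)"
    using assms unfolding heat_smooth_def case_prod_beta by (intro continuous_intros) auto
  then show ?thesis
    by (rule heat_smoothI[where vt="\<lambda>t x. c * vt t x" and vb="\<lambda>b t x. c * vb b t x"
          and vbb="\<lambda>b t x. c * vbb b t x"])
       (use 1 in \<open>auto simp: heat_derivs_def right_diff_distrib sum_distrib_left intro!: DERIV_cmult\<close>)
qed

lemma heat_smooth_uminus: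
  "heat_smooth \<Omega> v \<kappa> \<Longrightarrow> heat_smooth \<Omega> (\<lambda>t x. - v t x) (\<lambda>t x. - \<kappa> t x)"
  using heat_smooth_cmult[of \<Omega> v \<kappa> "-1"] by simp

lemma heat_smooth_imp_approx: "heat_smooth \<Omega> v \<kappa> \<Longrightarrow> heat_approx \<Omega> v \<kappa>"
  unfolding heat_approx_def by (fastforce simp: heat_smooth_def[of \<Omega> v \<kappa>])

lemma heat_approx_add:
  assumes "heat_approx \<Omega> w k" "heat_approx \<Omega> w' k'"
  shows "heat_approx \<Omega> (\<lambda>t x. w t x + w' t x) (\<lambda>t x. k t x + k' t x)"
  unfolding heat_approx_def
proof (intro conjI allI impI)
  show "continuous_on ({0<..} \<times> \<Omega>) (\<lambda>(t,x). w t x + w' t x)"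
    using assms unfolding heat_approx_def case_prod_beta by (intro continuous_intros) auto
next
  fix C :: "(real \<times> 'a) set" and e :: real
  assume C: "compact C \<and> C \<subseteq> {0<..} \<times> \<Omega> \<and> e > 0"
  then have C2: "compact C \<and> C \<subseteq> {0<..} \<times> \<Omega> \<and> e / 2 > 0" by auto
  obtain v \<kappa> where 1: "heat_smooth \<Omega> v \<kappa>"
    "\<forall>t x. (t,x) \<in> C \<longrightarrow> \<bar>v t x - w t x\<bar> \<le> e/2 \<and> \<bar>\<kappa> t x - k t x\<bar> \<le> e/2"
    using assms(1) C2 unfolding heat_approx_def by meson
  obtain v' \<kappa>' where 2: "heat_smooth \<Omega> v' \<kappa>'"
    "\<forall>t x. (t,x) \<in> C \<longrightarrow> \<bar>v' t x - w' t x\<bar> \<le> e/2 \<and> \<bar>\<kappa>' t x - k' t x\<bar> \<le> e/2"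
    using assms(2) C2 unfolding heat_approx_def by meson
  show "\<exists>v \<kappa>. heat_smooth \<Omega> v \<kappa> \<and> (\<forall>t x. (t,x) \<in> C \<longrightarrow>
      \<bar>v t x - (w t x + w' t x)\<bar> \<le> e \<and> \<bar>\<kappa> t x - (k t x + k' t x)\<bar> \<le> e)"
  proof (intro exI conjI allI impI)
    show "heat_smooth \<Omega> (\<lambda>t x. v t x + v' t x) (\<lambda>t x. \<kappa> t x + \<kappa>' t x)"
      by (rule heat_smooth_add[OF 1(1) 2(1)])
    fix t x assume "(t,x) \<in> C"
    then have "\<bar>v t x - w t x\<bar> \<le> e/2" "\<bar>\<kappa> t x - k t x\<bar> \<le> e/2"
      "\<bar>v' t x - w' t x\<bar> \<le> e/2" "\<bar>\<kappa>' t x - k' t x\<bar> \<le> e/2" using 1 2 by auto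
    then show "\<bar>v t x + v' t x - (w t x + w' t x)\<bar> \<le> e"
      "\<bar>\<kappa> t x + \<kappa>' t x - (k t x + k' t x)\<bar> \<le> e" by linarith+
  qed
qed

lemma heat_approx_uminus:
  assumes "heat_approx \<Omega> w k"
  shows "heat_approx \<Omega> (\<lambda>t x. - w t x) (\<lambda>t x. - k t x)"
  unfolding heat_approx_def
proof (intro conjI allI impI)
  show "continuous_on ({0<..} \<times> \<Omega>) (\<lambda>(t,x). - w t x)"
    using assms unfolding heat_approx_def case_prod_beta by (intro continuous_intros) auto
next
  fix C :: "(real \<times> 'a) set" and e :: real
  assume C: "compact C \<and> C \<subseteq> {0<..} \<times> \<Omega> \<and> e > 0"
  obtain v \<kappa> where 1: "heat_smooth \<Omega> v \<kappa>"
    "\<forall>t x. (t,x) \<in> C \<longrightarrow> \<bar>v t x - w t x\<bar> \<le> e \<and> \<bar>\<kappa> t x - k t x\<bar> \<le> e"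
    using assms(1) C unfolding heat_approx_def by meson
  then show "\<exists>v \<kappa>. heat_smooth \<Omega> v \<kappa> \<and> (\<forall>t x. (t,x) \<in> C \<longrightarrow>
      \<bar>v t x - - w t x\<bar> \<le> e \<and> \<bar>\<kappa> t x - - k t x\<bar> \<le> e)"
    by (intro exI[of _ "\<lambda>t x. - v t x"] exI[of _ "\<lambda>t x. - \<kappa> t x"])
       (auto simp: heat_smooth_uminus abs_minus_commute)
qed

lemma heat_approx_diff:
  assumes "heat_approx \<Omega> w k" "heat_approx \<Omega> w' k'"
  shows "heat_approx \<Omega> (\<lambda>t x. w t x - w' t x) (\<lambda>t x. k t x - k' t x)"
  using heat_approx_add[OF assms(1) heat_approx_uminus[OF assms(2)]] by simp

lemma heat_approx_mono:
  assumes "heat_approx \<Omega> w k" "\<Omega>' \<subseteq> \<Omega>"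
  shows "heat_approx \<Omega>' w k"
proof -
  have sub: "{0<..} \<times> \<Omega>' \<subseteq> {0::real<..} \<times> \<Omega>" using assms(2) by auto
  have hs: "heat_smooth \<Omega>' v \<kappa>" if v: "heat_smooth \<Omega> v \<kappa>" for v \<kappa>
  proof -
    have cont: "continuous_on ({0<..} \<times> \<Omega>') (\<lambda>(t,x). v t x)"
      by (rule continuous_on_subset[OF _ sub]) (use v in \<open>simp add: heat_smooth_def\<close>)
    from v obtain vt vb vbb where *: "heat_derivs \<Omega> v \<kappa> vt vb vbb"
      unfolding heat_smooth_def by blast
    show ?thesis
      by (rule heat_smoothI[where vt=vt and vb=vb and vbb=vbb]) (use cont * assms(2) in \<open>auto simp: heat_derivs_def\<close>)
  qed
  have "continuous_on ({0<..} \<times> \<Omega>') (\<lambda>(t,x). w t x)"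
    by (rule continuous_on_subset[OF _ sub]) (use assms(1) in \<open>simp add: heat_approx_def\<close>)
  moreover have "\<exists>v \<kappa>. heat_smooth \<Omega>' v \<kappa> \<and>
         (\<forall>t x. (t,x) \<in> C \<longrightarrow> \<bar>v t x - w t x\<bar> \<le> e \<and> \<bar>\<kappa> t x - k t x\<bar> \<le> e)"
    if C: "compact C" "C \<subseteq> {0<..} \<times> \<Omega>'" "e > 0" for C e
  proof -
    have "C \<subseteq> {0<..} \<times> \<Omega>" using C(2) sub by blast
    then obtain v \<kappa> where "heat_smooth \<Omega> v \<kappa>"
       "\<forall>t x. (t,x) \<in> C \<longrightarrow> \<bar>v t x - w t x\<bar> \<le> e \<and> \<bar>\<kappa> t x - k t x\<bar> \<le> e"
      using assms(1) C(1,3) unfolding heat_approx_def by blast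
    then show ?thesis using hs by blast
  qed
  ultimately show ?thesis unfolding heat_approx_def by blast
qed

lemma continuous_on_open_gt_nbhd:
  fixes f :: "'b::metric_space \<Rightarrow> real"
  assumes "continuous_on S f" "open S" "p \<in> S" "f p > c"
  obtains d where "d > 0" "\<And>q. dist q p < d \<Longrightarrow> q \<in> S \<and> f q > c"
proof -
  have "open (S \<inter> f -` {c<..})"
    using continuous_open_preimage[OF assms(1,2)] by auto
  moreover have "p \<in> S \<inter> f -` {c<..}" using assms by auto
  ultimately obtain d where "d > 0" "ball p d \<subseteq> S \<inter> f -` {c<..}"
    by (meson open_contains_ball)
  then show thesis by (intro that[of d]) (auto simp: dist_commute subset_iff)
qed

text \<open>Only earlier times enter, so the maximum may lie on the top of a cylinder.\<close>
lemma heat_smooth_max_nonneg: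
  assumes "heat_smooth \<Omega> v \<kappa>" and \<Omega>: "open \<Omega>" and t: "t > 0" and x: "x \<in> \<Omega>" and d: "d > 0"
    and maxt: "\<And>s. t - d < s \<Longrightarrow> s < t \<Longrightarrow> v s x \<le> v t x + c * (s - t)"
    and maxx: "\<And>y. dist y x < d \<Longrightarrow> v t y \<le> v t x"
  shows "\<kappa> t x \<ge> c"
proof -
  obtain vt vb vbb where D: "heat_derivs \<Omega> v \<kappa> vt vb vbb" using assms(1) unfolding heat_smooth_def by blast
  note vt = heat_derivsD(1)[OF D \<Omega>] and vb = heat_derivsD(2)[OF D \<Omega>] and vbb = heat_derivsD(3)[OF D \<Omega>]
    and \<kappa> = heat_derivsD(4)[OF D \<Omega>]
  have "((\<lambda>s. v s x - c * (s - t)) has_real_derivative vt t x - c) (at t)"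
    by (rule derivative_eq_intros vt t x refl | simp)+
  then have "vt t x - c \<ge> 0"
    by (rule left_max_imp_deriv_nonneg[OF _ d]) (use maxt in fastforce)
  moreover have "vbb b t x \<le> 0" if b: "b \<in> Basis" for b
  proof -
    obtain d' where d': "d' > 0" "\<forall>s. \<bar>s\<bar> < d' \<longrightarrow>
        ((\<lambda>s. v t (x + s *\<^sub>R b)) has_real_derivative vb b t (x + s *\<^sub>R b)) (at s)"
      using vb[OF t x b] by blast
    show ?thesis
      by (rule local_max_imp_second_deriv_le_0[where g="\<lambda>s. v t (x + s *\<^sub>R b)"
            and g'="\<lambda>s. vb b t (x + s *\<^sub>R b)" and d="min d d'"])
         (use d' d vbb[OF t x b] maxx b in \<open>auto simp: dist_norm\<close>)
  qed
  ultimately show ?thesis using \<kappa>[OF t x] sum_nonpos[of Basis "\<lambda>b. vbb b t x"] by simp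
qed

text \<open>Compactness of the superlevel sets stands for \<open>w \<le> 0\<close> on the initial
  and lateral boundary, without mentioning boundary values. If \<open>w\<close> were positive
  somewhere, an approximant tilted by \<open>- \<eta> t\<close> would attain a maximum in such a
  set; there the heat operator is at least \<open>\<eta>\<close>, but also at most
  \<open>e < \<eta>\<close>.\<close>

lemma heat_approx_maximum_principle:
  fixes w k :: "real \<Rightarrow> 'a::euclidean_space \<Rightarrow> real"
  assumes w: "heat_approx \<Omega> w k" and \<Omega>: "open \<Omega>"
    and comp: "\<And>\<theta>. \<theta> > 0 \<Longrightarrow> compact {(t,x). 0 < t \<and> t \<le> T \<and> x \<in> \<Omega> \<and> w t x \<ge> \<theta>}"
    and k: "\<And>t x. 0 < t \<Longrightarrow> t \<le> T \<Longrightarrow> x \<in> \<Omega> \<Longrightarrow> w t x > 0 \<Longrightarrow> k t x \<le> 0"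
    and t: "0 < t" "t \<le> T" and x: "x \<in> \<Omega>"
  shows "w t x \<le> 0"
proof (rule ccontr)
  assume "\<not> w t x \<le> 0"
  define \<theta> where "\<theta> = w t x / 2"
  have \<theta>: "\<theta> > 0" using \<open>\<not> w t x \<le> 0\<close> by (simp add: \<theta>_def)
  \<comment> \<open>A level below the one reached by the maximum point, which has
    \<open>w > \<theta>\<close>: a neighbourhood of it, at times up to its own, then stays in
    \<open>C\<close>.\<close>
  define C where "C = {(t,x). 0 < t \<and> t \<le> T \<and> x \<in> \<Omega> \<and> w t x \<ge> \<theta> / 2}"
  have C: "compact C" "C \<subseteq> {0<..} \<times> \<Omega>" using comp[of "\<theta>/2"] \<theta> by (auto simp: C_def)
  \<comment> \<open>The tilt costs at most \<open>\<eta> T = \<theta>/4\<close> and each of two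
    approximation errors at most \<open>\<theta>/8\<close>. Starting from
    \<open>w t x = 2 \<theta>\<close>, the maximum point keeps
    \<open>w \<ge> 3 \<theta>/2\<close>.\<close>
  define \<eta> where "\<eta> = \<theta> / (4 * T)"
  have T: "T > 0" using t by simp
  have \<eta>: "\<eta> > 0" using \<theta> T by (simp add: \<eta>_def)
  define e where "e = min (\<theta> / 8) (\<eta> / 2)"
  have e: "e > 0" "e \<le> \<theta> / 8" "e < \<eta>" using \<theta> \<eta> by (auto simp: e_def)
  obtain v \<kappa> where v: "heat_smooth \<Omega> v \<kappa>"
    and ap: "\<And>t x. (t,x) \<in> C \<Longrightarrow> \<bar>v t x - w t x\<bar> \<le> e \<and> \<bar>\<kappa> t x - k t x\<bar> \<le> e"
    using w C e(1) unfolding heat_approx_def by meson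
  have cw: "continuous_on ({0<..} \<times> \<Omega>) (\<lambda>(t,x). w t x)" using w by (simp add: heat_approx_def)
  have p1: "(t,x) \<in> C" using t x \<theta> by (auto simp: C_def \<theta>_def)
  have "continuous_on C (\<lambda>(t,x). v t x)"
    using v C(2) continuous_on_subset unfolding heat_smooth_def by blast
  then have "continuous_on C (\<lambda>p. (case p of (t,x) \<Rightarrow> v t x) - \<eta> * fst p)"
    by (intro continuous_intros)
  then obtain p where p: "p \<in> C"
    "\<And>q. q \<in> C \<Longrightarrow> (case q of (t,x) \<Rightarrow> v t x) - \<eta> * fst q \<le> (case p of (t,x) \<Rightarrow> v t x) - \<eta> * fst p"
    using continuous_attains_sup[OF C(1)] p1 by blast
  obtain t0 x0 where p0: "p = (t0,x0)" by (cases p)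
  have t0: "0 < t0" "t0 \<le> T" and x0: "x0 \<in> \<Omega>" using p(1) by (auto simp: p0 C_def)
  have max: "v s y - \<eta> * s \<le> v t0 x0 - \<eta> * t0" if "(s,y) \<in> C" for s y
    using p(2)[OF that] by (simp add: p0)
  have "\<eta> * t \<le> \<eta> * T" using t \<eta> by simp
  also have "\<eta> * T = \<theta> / 4" using T by (simp add: \<eta>_def)
  finally have "\<eta> * t \<le> \<theta> / 4" .
  moreover have "\<eta> * t0 \<ge> 0" using \<eta> t0 by simp
  ultimately have "w t0 x0 > \<theta>"
    using max[OF p1] ap[OF p1] ap[of t0 x0] p(1) e(2) \<theta> unfolding p0 \<theta>_def[symmetric]
    by (auto simp: abs_le_iff) (use \<theta>_def in linarith)
  then have w0: "w t0 x0 > \<theta> / 2" using \<theta> by simp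
  have "open ({0::real<..} \<times> \<Omega>)" using \<Omega> by (intro open_Times) auto
  then obtain d where d: "d > 0"
    "\<And>q. dist q (t0,x0) < d \<Longrightarrow> q \<in> {0<..} \<times> \<Omega> \<and> (case q of (t,x) \<Rightarrow> w t x) > \<theta> / 2"
    using continuous_on_open_gt_nbhd[OF cw, of "(t0,x0)" "\<theta>/2"] w0 t0 x0 by auto
  have inC: "(s,y) \<in> C" if "dist (s,y) (t0,x0) < d" "s \<le> t0" for s y
    using d(2)[OF that(1)] that(2) t0(2) by (auto simp: C_def)
  have "\<kappa> t0 x0 \<ge> \<eta>"
  proof (rule heat_smooth_max_nonneg[OF v \<Omega> t0(1) x0 d(1)])
    fix s assume "t0 - d < s" "s < t0"
    then have "(s,x0) \<in> C" by (intro inC) (auto simp: dist_Pair_Pair dist_real_def)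
    from max[OF this] show "v s x0 \<le> v t0 x0 + \<eta> * (s - t0)" by (simp add: algebra_simps)
  next
    fix y assume "dist y x0 < d"
    then have "(t0,y) \<in> C" by (intro inC) (auto simp: dist_Pair_Pair dist_real_def)
    from max[OF this] show "v t0 y \<le> v t0 x0" by simp
  qed
  moreover have "\<kappa> t0 x0 \<le> e" using ap[of t0 x0] p(1) k[OF t0 x0] w0 \<theta> unfolding p0 by auto
  ultimately show False using e by simp
qed

text \<open>Link to the maximum principle: \<open>eq\<close> records that the superlevel set avoids
  times before \<open>lo\<close> and stays in a compact set on which \<open>w\<close> is
  continuous.\<close>

lemma compact_superlevel:
  fixes w :: "real \<Rightarrow> 'a::euclidean_space \<Rightarrow> real"
  assumes cont: "continuous_on ({lo..T} \<times> B) (\<lambda>(t,x). w t x)" and B: "compact B"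
    and eq: "\<And>s y. (0 < s \<and> s \<le> T \<and> y \<in> \<Omega> \<and> w s y \<ge> \<theta>) = (lo \<le> s \<and> s \<le> T \<and> y \<in> B \<and> w s y \<ge> \<theta>)"
  shows "compact {(s,y). 0 < s \<and> s \<le> T \<and> y \<in> \<Omega> \<and> w s y \<ge> \<theta>}"
proof -
  have c: "compact ({lo..T} \<times> B)" by (intro compact_Times compact_Icc B)
  have "closed ({lo..T} \<times> B \<inter> (\<lambda>(s,y). w s y) -` {\<theta>..})"
    by (intro continuous_closed_preimage cont compact_imp_closed[OF c]) auto
  then have "compact ({lo..T} \<times> B \<inter> ({lo..T} \<times> B \<inter> (\<lambda>(s,y). w s y) -` {\<theta>..}))"
    by (rule compact_Int_closed[OF c])
  also have "{lo..T} \<times> B \<inter> ({lo..T} \<times> B \<inter> (\<lambda>(s,y). w s y) -` {\<theta>..})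
      = {(s,y). 0 < s \<and> s \<le> T \<and> y \<in> \<Omega> \<and> w s y \<ge> \<theta>}" using eq by auto
  finally show ?thesis .
qed

section \<open>Weak solutions are approximable by mollification\<close>

lemma DERIV_pos_part_power:
  "((\<lambda>s::real. max 0 s ^ Suc (Suc n)) has_real_derivative real (Suc (Suc n)) * max 0 s ^ Suc n) (at s)"
proof (cases s "0::real" rule: linorder_cases)
  case less
  have "((\<lambda>s::real. 0) has_real_derivative real (Suc (Suc n)) * max 0 s ^ Suc n) (at s)"
    using less by simp
  then show ?thesis
    by (rule has_field_derivative_transform_within_open[where S="{..<0}"]) (use less in auto)
next
  case greater
  have "((\<lambda>s::real. s ^ Suc (Suc n)) has_real_derivative real (Suc (Suc n)) * max 0 s ^ Suc n) (at s)"
    using greater by (auto intro!: derivative_eq_intros simp del: power_Suc)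
  then show ?thesis
    by (rule has_field_derivative_transform_within_open[where S="{0<..}"]) (use greater in auto)
next
  case equal
  have "((\<lambda>h::real. max 0 h ^ Suc n) \<longlongrightarrow> max 0 0 ^ Suc n) (at 0)"
    by (intro tendsto_intros)
  then have "((\<lambda>h::real. max 0 h ^ Suc n) \<longlongrightarrow> 0) (at 0)" by simp
  then have "((\<lambda>h::real. max 0 h ^ Suc (Suc n) / h) \<longlongrightarrow> 0) (at 0)"
    by (rule Lim_transform_eventually) (auto simp: eventually_at_filter max_def intro!: always_eventually)
  then show ?thesis using equal by (simp add: DERIV_def)
qed

text \<open>The cubic power makes the mollifier twice continuously differentiable.\<close>

definition bump :: "real \<Rightarrow> 'b::euclidean_space \<Rightarrow> real" where
  "bump \<epsilon> z = max 0 (\<epsilon>\<^sup>2 - z \<bullet> z) ^ 3"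

definition bump1 :: "real \<Rightarrow> 'b::euclidean_space \<Rightarrow> 'b \<Rightarrow> real" where
  "bump1 \<epsilon> e z = - 6 * max 0 (\<epsilon>\<^sup>2 - z \<bullet> z) ^ 2 * (z \<bullet> e)"

definition bump2 :: "real \<Rightarrow> 'b::euclidean_space \<Rightarrow> 'b \<Rightarrow> real" where
  "bump2 \<epsilon> e z = 24 * max 0 (\<epsilon>\<^sup>2 - z \<bullet> z) * (z \<bullet> e)\<^sup>2 - 6 * max 0 (\<epsilon>\<^sup>2 - z \<bullet> z) ^ 2 * (e \<bullet> e)"

lemma bump_nonneg: "bump \<epsilon> z \<ge> 0"
  by (simp add: bump_def)

lemma bump_eq_0:
  assumes "\<epsilon> \<ge> 0" "norm z \<ge> \<epsilon>"
  shows "bump \<epsilon> z = 0" "bump1 \<epsilon> e z = 0" "bump2 \<epsilon> e z = 0"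
proof -
  have "\<epsilon>\<^sup>2 - z \<bullet> z \<le> 0" using assms by (simp add: dot_square_norm power_mono)
  then show "bump \<epsilon> z = 0" "bump1 \<epsilon> e z = 0" "bump2 \<epsilon> e z = 0"
    by (simp_all add: bump_def bump1_def bump2_def)
qed

lemma continuous_on_bump: "continuous_on A (bump \<epsilon>)" "continuous_on A (bump1 \<epsilon> e)" "continuous_on A (bump2 \<epsilon> e)"
  unfolding bump_def[abs_def] bump1_def[abs_def] bump2_def[abs_def] by (intro continuous_intros)+

lemma pos_part_derivs:
  fixes z e :: "'b::euclidean_space"
  shows "((\<lambda>s. max 0 (c - (z + s *\<^sub>R e) \<bullet> (z + s *\<^sub>R e)) ^ 3) has_real_derivative
            - 6 * max 0 (c - (z + s *\<^sub>R e) \<bullet> (z + s *\<^sub>R e)) ^ 2 * ((z + s *\<^sub>R e) \<bullet> e)) (at s)"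
    and "((\<lambda>s. max 0 (c - (z + s *\<^sub>R e) \<bullet> (z + s *\<^sub>R e)) ^ 2) has_real_derivative
            - 4 * max 0 (c - (z + s *\<^sub>R e) \<bullet> (z + s *\<^sub>R e)) * ((z + s *\<^sub>R e) \<bullet> e)) (at s)"
proof -
  have Q: "((\<lambda>s. c - (z + s *\<^sub>R e) \<bullet> (z + s *\<^sub>R e)) has_real_derivative - 2 * ((z + s *\<^sub>R e) \<bullet> e)) (at s)"
    unfolding has_field_derivative_def
    by (auto intro!: derivative_eq_intros simp: inner_commute algebra_simps)
  show "((\<lambda>s. max 0 (c - (z + s *\<^sub>R e) \<bullet> (z + s *\<^sub>R e)) ^ 3) has_real_derivative
            - 6 * max 0 (c - (z + s *\<^sub>R e) \<bullet> (z + s *\<^sub>R e)) ^ 2 * ((z + s *\<^sub>R e) \<bullet> e)) (at s)"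
    using DERIV_chain2[OF DERIV_pos_part_power[of 1] Q]
    by (simp add: numeral_3_eq_3 numeral_2_eq_2 mult.assoc del: power_Suc)
  show "((\<lambda>s. max 0 (c - (z + s *\<^sub>R e) \<bullet> (z + s *\<^sub>R e)) ^ 2) has_real_derivative
            - 4 * max 0 (c - (z + s *\<^sub>R e) \<bullet> (z + s *\<^sub>R e)) * ((z + s *\<^sub>R e) \<bullet> e)) (at s)"
    using DERIV_chain2[OF DERIV_pos_part_power[of 0] Q]
    by (simp add: numeral_2_eq_2 mult.assoc del: power_Suc)
qed

lemma bump_line_derivs:
  shows "((\<lambda>s. bump \<epsilon> (z + s *\<^sub>R e)) has_real_derivative bump1 \<epsilon> e (z + s *\<^sub>R e)) (at s)"
    and "((\<lambda>s. bump1 \<epsilon> e (z + s *\<^sub>R e)) has_real_derivative bump2 \<epsilon> e (z + s *\<^sub>R e)) (at s)"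
proof -
  show "((\<lambda>s. bump \<epsilon> (z + s *\<^sub>R e)) has_real_derivative bump1 \<epsilon> e (z + s *\<^sub>R e)) (at s)"
    unfolding bump_def bump1_def by (rule pos_part_derivs)
  have "((\<lambda>s. (z + s *\<^sub>R e) \<bullet> e) has_real_derivative e \<bullet> e) (at s)"
    unfolding has_field_derivative_def by (auto intro!: derivative_eq_intros)
  from DERIV_mult[OF DERIV_cmult[OF pos_part_derivs(2)] this]
  show "((\<lambda>s. bump1 \<epsilon> e (z + s *\<^sub>R e)) has_real_derivative bump2 \<epsilon> e (z + s *\<^sub>R e)) (at s)"
    unfolding bump1_def bump2_def
    by (rule DERIV_cong) (simp add: power2_eq_square algebra_simps)
qed

text \<open>\<open>test_fun\<close> asks for Frechet derivatives as bounded operators, the second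
  one continuous. These are the gradient and the Hessian of \<open>bump\<close> in that
  form.\<close>

definition bump_D :: "real \<Rightarrow> 'b::euclidean_space \<Rightarrow> 'b \<Rightarrow>\<^sub>L real" where
  "bump_D \<epsilon> z = (- 6 * max 0 (\<epsilon>\<^sup>2 - z \<bullet> z) ^ 2) *\<^sub>R blinfun_inner_left z"

definition bump_D2 :: "real \<Rightarrow> 'b::euclidean_space \<Rightarrow> 'b \<Rightarrow>\<^sub>L 'b \<Rightarrow>\<^sub>L real" where
  "bump_D2 \<epsilon> z = (24 * max 0 (\<epsilon>\<^sup>2 - z \<bullet> z)) *\<^sub>R (blinfun_scaleR_left (blinfun_inner_left z) o\<^sub>L blinfun_inner_left z)
     + (- 6 * max 0 (\<epsilon>\<^sup>2 - z \<bullet> z) ^ 2) *\<^sub>R Blinfun blinfun_inner_left"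

lemma has_derivative_bump: "(bump \<epsilon> has_derivative blinfun_apply (bump_D \<epsilon> z)) (at z)"
proof -
  have Q: "((\<lambda>z. \<epsilon>\<^sup>2 - z \<bullet> z) has_derivative (\<lambda>v. - 2 * (z \<bullet> v))) (at z)"
    by (auto intro!: derivative_eq_intros simp: inner_commute)
  show ?thesis
    unfolding bump_def[abs_def] bump_D_def
    by (rule has_derivative_eq_rhs[OF DERIV_pos_part_power[of 1, THEN DERIV_compose_FDERIV, OF Q,
          unfolded One_nat_def numeral_3_eq_3[symmetric]]])
       (simp add: numeral_2_eq_2 blinfun.scaleR_left blinfun.minus_left inner_commute fun_eq_iff)
qed

lemma has_derivative_bump_D: "(bump_D \<epsilon> has_derivative blinfun_apply (bump_D2 \<epsilon> z)) (at z)"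
proof -
  have Q: "((\<lambda>z. \<epsilon>\<^sup>2 - z \<bullet> z) has_derivative (\<lambda>v. - 2 * (z \<bullet> v))) (at z)"
    by (auto intro!: derivative_eq_intros simp: inner_commute)
  have P: "((\<lambda>z. - 6 * max 0 (\<epsilon>\<^sup>2 - z \<bullet> z) ^ 2) has_derivative (\<lambda>v. 24 * max 0 (\<epsilon>\<^sup>2 - z \<bullet> z) * (z \<bullet> v))) (at z)"
    using has_derivative_mult_right[OF DERIV_pos_part_power[of 0, THEN DERIV_compose_FDERIV, OF Q], of "-6"]
    by (simp add: numeral_2_eq_2 mult_ac del: power_Suc)
  have I: "(blinfun_inner_left has_derivative blinfun_inner_left) (at z)"
    by (rule bounded_linear_imp_has_derivative[OF bounded_linear_blinfun_inner_left])
  have "(bump_D \<epsilon> has_derivative (\<lambda>v. (- 6 * max 0 (\<epsilon>\<^sup>2 - z \<bullet> z) ^ 2) *\<^sub>R blinfun_inner_left v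
      + (24 * max 0 (\<epsilon>\<^sup>2 - z \<bullet> z) * (z \<bullet> v)) *\<^sub>R blinfun_inner_left z)) (at z)"
    unfolding bump_D_def[abs_def] by (rule has_derivative_scaleR[OF P I])
  moreover have "(\<lambda>v. (- 6 * max 0 (\<epsilon>\<^sup>2 - z \<bullet> z) ^ 2) *\<^sub>R blinfun_inner_left v
      + (24 * max 0 (\<epsilon>\<^sup>2 - z \<bullet> z) * (z \<bullet> v)) *\<^sub>R blinfun_inner_left z) = blinfun_apply (bump_D2 \<epsilon> z)"
    by (simp add: bump_D2_def fun_eq_iff blinfun.add_left blinfun.diff_left blinfun.scaleR_left inner_commute
        bounded_linear_Blinfun_apply[OF bounded_linear_blinfun_inner_left])
  ultimately show ?thesis by simp
qed

lemma continuous_on_bump_D2: "continuous_on A (bump_D2 \<epsilon>)"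
  unfolding bump_D2_def[abs_def]
  by (intro continuous_intros bounded_bilinear.continuous_on[OF bounded_bilinear_blinfun_compose]
      bounded_linear.continuous_on[OF bounded_linear_blinfun_scaleR_left]
      bounded_linear.continuous_on[OF bounded_linear_blinfun_inner_left])

text \<open>Testing with the reflected kernel turns the weak equation into the pointwise equation of
  the convolution at \<open>p\<close>. The reflection flips the sign of first derivatives and
  preserves second ones.\<close>

lemma test_fun_bump:
  fixes p :: "real \<times> 'a::euclidean_space"
  assumes "\<epsilon> > 0" "cball p \<epsilon> \<subseteq> {0<..} \<times> \<Omega>"
  shows "test_fun \<Omega> (\<lambda>q. bump \<epsilon> (p - q))"
  unfolding test_fun_def
proof (intro conjI)
  show "\<exists>K. compact K \<and> K \<subseteq> {0<..} \<times> \<Omega> \<and> (\<forall>q. q \<notin> K \<longrightarrow> bump \<epsilon> (p - q) = 0)"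
    using assms by (intro exI[of _ "cball p \<epsilon>"]) (auto simp: dist_norm intro!: bump_eq_0)
  have M: "((\<lambda>q. p - q) has_derivative (\<lambda>v. - v)) (at q)" for q
    by (auto intro!: derivative_eq_intros)
  have 1: "((\<lambda>q. bump \<epsilon> (p - q)) has_derivative blinfun_apply (- bump_D \<epsilon> (p - q))) (at q)" for q
    by (rule has_derivative_eq_rhs[OF has_derivative_compose[OF M has_derivative_bump]])
       (simp add: blinfun.minus_left blinfun.minus_right fun_eq_iff)
  have 2: "((\<lambda>q. - bump_D \<epsilon> (p - q)) has_derivative blinfun_apply (bump_D2 \<epsilon> (p - q))) (at q)" for q
    by (rule has_derivative_eq_rhs[OF has_derivative_minus[OF has_derivative_compose[OF M has_derivative_bump_D]]])
       (simp add: blinfun.minus_left blinfun.minus_right fun_eq_iff)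
  have 3: "continuous_on UNIV (\<lambda>q. bump_D2 \<epsilon> (p - q))"
    by (rule continuous_on_compose2[OF continuous_on_bump_D2[of UNIV]]) (auto intro!: continuous_intros)
  show "\<exists>D D2. (\<forall>q. ((\<lambda>q. bump \<epsilon> (p - q)) has_derivative blinfun_apply (D q)) (at q)) \<and>
             (\<forall>q. (D has_derivative blinfun_apply (D2 q)) (at q)) \<and> continuous_on UNIV D2"
    by (intro exI[of _ "\<lambda>q. - bump_D \<epsilon> (p - q)"] exI[of _ "\<lambda>q. bump_D2 \<epsilon> (p - q)"]) (use 1 2 3 in auto)
qed

lemma dirderiv_bump: "dirderiv (\<lambda>q. bump \<epsilon> (p - q)) q v = - bump1 \<epsilon> v (p - q)"
proof -
  have "((\<lambda>s. bump \<epsilon> ((p - q) + s *\<^sub>R (- v))) has_real_derivative bump1 \<epsilon> (- v) ((p - q) + 0 *\<^sub>R (- v))) (at 0)"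
    by (rule bump_line_derivs)
  then have "((\<lambda>s. bump \<epsilon> (p - (q + s *\<^sub>R v))) has_real_derivative - bump1 \<epsilon> v (p - q)) (at 0)"
    by (simp add: bump1_def diff_diff_eq)
  then show ?thesis unfolding dirderiv_def by (rule DERIV_imp_deriv)
qed

lemma dirderiv2_bump: "dirderiv2 (\<lambda>q. bump \<epsilon> (p - q)) q v = bump2 \<epsilon> v (p - q)"
proof -
  have "((\<lambda>s. bump1 \<epsilon> (- v) ((p - q) + s *\<^sub>R (- v))) has_real_derivative bump2 \<epsilon> (- v) ((p - q) + 0 *\<^sub>R (- v))) (at 0)"
    by (rule bump_line_derivs)
  then have "((\<lambda>s. - bump1 \<epsilon> v (p - (q + s *\<^sub>R v))) has_real_derivative bump2 \<epsilon> v (p - q)) (at 0)"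
    by (simp add: bump1_def bump2_def diff_diff_eq)
  then show ?thesis unfolding dirderiv2_def dirderiv_bump by (rule DERIV_imp_deriv)
qed

text \<open>All derivatives fall on the kernel and the box is fixed and compact, so continuity of
  \<open>K'\<close> suffices to differentiate under the integral; \<open>U\<close> is merely
  continuous.\<close>

lemma convolution_line_deriv:
  fixes U K K' :: "'b::euclidean_space \<Rightarrow> real"
  assumes "continuous_on UNIV U" "continuous_on UNIV K" "continuous_on UNIV K'"
    and K: "\<And>z s. ((\<lambda>s. K (z + s *\<^sub>R e)) has_real_derivative K' (z + s *\<^sub>R e)) (at s)"
  shows "((\<lambda>s. integral (cbox a b) (\<lambda>q. U q * K (p + s *\<^sub>R e - q))) has_real_derivative
            integral (cbox a b) (\<lambda>q. U q * K' (p + s *\<^sub>R e - q))) (at s)"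
proof (rule leibniz_rule_field_derivative[where U=UNIV])
  fix s q
  have "((\<lambda>s. U q * K ((p - q) + s *\<^sub>R e)) has_real_derivative U q * K' ((p - q) + s *\<^sub>R e)) (at s)"
    by (intro DERIV_cmult K)
  then show "((\<lambda>s. U q * K (p + s *\<^sub>R e - q)) has_real_derivative U q * K' (p + s *\<^sub>R e - q)) (at s)"
    by (simp add: algebra_simps)
next
  fix s show "(\<lambda>q. U q * K (p + s *\<^sub>R e - q)) integrable_on cbox a b"
    by (intro integrable_continuous continuous_intros continuous_on_compose2[OF assms(1)]
        continuous_on_compose2[OF assms(2)]) auto
next
  show "continuous_on (UNIV \<times> cbox a b) (\<lambda>(s, q). U q * K' (p + s *\<^sub>R e - q))"
    unfolding case_prod_beta
    by (intro continuous_intros continuous_on_compose2[OF assms(1)]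
        continuous_on_compose2[OF assms(3)]) auto
qed auto

text \<open>One normalising constant for every centre and every box containing the ball, so that
  division by it commutes with differentiation in \<open>p\<close>.\<close>

lemma integral_bump_pos:
  assumes "\<epsilon> > 0"
  obtains c where "c > 0"
    and "\<And>(p :: 'b::euclidean_space) a b. cball p \<epsilon> \<subseteq> cbox a b \<Longrightarrow> integral (cbox a b) (\<lambda>q. bump \<epsilon> (p - q)) = c"
proof -
  obtain R :: 'b where R: "cball 0 \<epsilon> \<subseteq> cbox (- R) R"
    using bounded_subset_cbox_symmetric[OF bounded_cball] by blast
  define c where "c = integral (cbox (- R) R) (bump \<epsilon>)"
  have hi: "(bump \<epsilon> has_integral c) (cbox (- R) R)"
    unfolding c_def by (intro integrable_integral integrable_continuous continuous_on_bump)
  \<comment> \<open>A continuous nonnegative function with zero integral vanishes on a nondegenerate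
    box, but \<open>bump\<close> takes the value \<open>\<epsilon>^6\<close> at 0.\<close>
  have "c \<noteq> 0"
  proof
    assume "c = 0"
    have "ball 0 \<epsilon> \<subseteq> interior (cbox (- R) R)"
      using R by (intro interior_maximal) auto
    moreover have "0 \<in> ball (0::'b) \<epsilon>" using assms by simp
    ultimately have "box (- R) R \<noteq> {}" unfolding interior_cbox by blast
    moreover have "0 \<in> cbox (- R) R" using R assms by (auto simp: subset_iff)
    ultimately have "bump \<epsilon> (0::'b) = 0"
      using has_integral_0_cbox_imp_0[of "- R" R "bump \<epsilon>" 0] hi \<open>c = 0\<close>
      by (simp add: continuous_on_bump bump_nonneg)
    then show False using assms by (simp add: bump_def)
  qed
  moreover have "c \<ge> 0" by (rule has_integral_nonneg[OF hi]) (simp add: bump_nonneg)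
  ultimately have "c > 0" by simp
  have restrict: "integral (cbox a b) (\<lambda>q. bump \<epsilon> (p - q)) = integral UNIV (\<lambda>q. bump \<epsilon> (p - q))"
    if "cball p \<epsilon> \<subseteq> cbox a b" for p a b :: 'b
  proof -
    have "(\<lambda>q. bump \<epsilon> (p - q)) = (\<lambda>q. if q \<in> cbox a b then bump \<epsilon> (p - q) else 0)"
    proof
      fix q show "bump \<epsilon> (p - q) = (if q \<in> cbox a b then bump \<epsilon> (p - q) else 0)"
        using that assms bump_eq_0(1)[of \<epsilon> "p - q"] by (cases "norm (p - q) \<le> \<epsilon>") (auto simp: subset_iff dist_norm)
    qed
    then show ?thesis by (metis integral_restrict_UNIV)
  qed
  have "integral UNIV (\<lambda>q. bump \<epsilon> (p - q)) = c" for p :: 'b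
  proof -
    have img: "(-) p ` cbox (- R) R = cbox (p - R) (p + R)"
      using image_affinity_cbox[of "-1" p "- R" R] R assms by (force simp: algebra_simps)
    have "((\<lambda>x. bump \<epsilon> (p - x)) has_integral c) (cbox (p - R) (p + R))"
      using has_integral_affinity[OF hi, of "-1" p] by (simp add: img)
    moreover have "cball p \<epsilon> \<subseteq> cbox (p - R) (p + R)"
    proof
      fix y assume "y \<in> cball p \<epsilon>"
      then have "p - y \<in> cbox (- R) R" using R by (auto simp: dist_norm subset_iff)
      then have "p - (p - y) \<in> cbox (p - R) (p + R)" unfolding img[symmetric] by (rule imageI)
      then show "y \<in> cbox (p - R) (p + R)" by simp
    qed
    ultimately show ?thesis using restrict by (metis integral_unique)
  qed
  then show thesis using that[OF \<open>c > 0\<close>] restrict by metis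
qed

lemma mollify_error:
  fixes U :: "'b::euclidean_space \<Rightarrow> real"
  assumes U: "continuous_on UNIV U" and \<epsilon>: "\<epsilon> > 0" "cball p \<epsilon> \<subseteq> cbox a b"
    and c: "c > 0" "integral (cbox a b) (\<lambda>q. bump \<epsilon> (p - q)) = c"
    and e: "\<And>q. q \<in> cball p \<epsilon> \<Longrightarrow> \<bar>U q - y\<bar> \<le> e"
  shows "\<bar>integral (cbox a b) (\<lambda>q. U q * bump \<epsilon> (p - q)) / c - y\<bar> \<le> e"
proof -
  have cb: "continuous_on A (\<lambda>q. bump \<epsilon> (p - q))" for A
    by (rule continuous_on_compose2[OF continuous_on_bump(1)[of UNIV]]) (auto intro!: continuous_intros)
  have cU: "continuous_on A U" for A using U continuous_on_subset by blast
  have "integral (cbox a b) (\<lambda>q. U q * bump \<epsilon> (p - q)) - c * y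
      = integral (cbox a b) (\<lambda>q. U q * bump \<epsilon> (p - q)) - integral (cbox a b) (\<lambda>q. bump \<epsilon> (p - q) * y)"
    using c by simp
  also have "\<dots> = integral (cbox a b) (\<lambda>q. U q * bump \<epsilon> (p - q) - bump \<epsilon> (p - q) * y)"
    by (rule integral_diff[symmetric]) (intro integrable_continuous continuous_intros cU cb)+
  finally have "\<bar>integral (cbox a b) (\<lambda>q. U q * bump \<epsilon> (p - q)) - c * y\<bar>
      = norm (integral (cbox a b) (\<lambda>q. U q * bump \<epsilon> (p - q) - bump \<epsilon> (p - q) * y))" by simp
  also have "\<dots> \<le> integral (cbox a b) (\<lambda>q. e * bump \<epsilon> (p - q))"
  proof (rule integral_norm_bound_integral)
    fix q assume "q \<in> cbox a b"
    show "norm (U q * bump \<epsilon> (p - q) - bump \<epsilon> (p - q) * y) \<le> e * bump \<epsilon> (p - q)"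
    proof (cases "q \<in> cball p \<epsilon>")
      case True
      have "norm (U q * bump \<epsilon> (p - q) - bump \<epsilon> (p - q) * y) = \<bar>U q - y\<bar> * bump \<epsilon> (p - q)"
        using bump_nonneg[of \<epsilon> "p - q"] by (simp add: mult.commute[of _ y] abs_mult flip: left_diff_distrib)
      also have "\<dots> \<le> e * bump \<epsilon> (p - q)"
        by (intro mult_right_mono e True bump_nonneg)
      finally show ?thesis .
    next
      case False
      then have "bump \<epsilon> (p - q) = 0" using \<epsilon>(1) by (intro bump_eq_0) (auto simp: dist_norm)
      then show ?thesis by simp
    qed
  qed (intro integrable_continuous continuous_intros cU cb)+
  also have "\<dots> = e * c" using c by simp
  finally show ?thesis using c(1) by (simp add: field_simps abs_le_iff)
qed

lemma compact_cball_nbhd: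
  fixes C S :: "'b::euclidean_space set"
  assumes "compact C" "open S" "C \<subseteq> S"
  obtains \<epsilon> C' where "\<epsilon> > 0" "compact C'" "C' \<subseteq> S" "\<And>p. p \<in> C \<Longrightarrow> cball p \<epsilon> \<subseteq> C'"
proof -
  obtain \<epsilon> where \<epsilon>: "\<epsilon> > 0" "(\<Union>x\<in>C. cball x \<epsilon>) \<subseteq> S"
    using compact_subset_open_imp_cball_epsilon_subset[OF assms] by blast
  define C' where "C' = {x + y | x y. x \<in> C \<and> y \<in> cball 0 \<epsilon>}"
  have "cball p \<epsilon> \<subseteq> C'" if "p \<in> C" for p
  proof
    fix q assume "q \<in> cball p \<epsilon>"
    then have "q = p + (q - p)" "q - p \<in> cball 0 \<epsilon>" by (auto simp: dist_norm norm_minus_commute)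
    then show "q \<in> C'" unfolding C'_def using that by blast
  qed
  moreover have "compact C'" unfolding C'_def by (rule compact_sums[OF assms(1) compact_cball])
  moreover have "C' \<subseteq> S"
  proof
    fix q assume "q \<in> C'"
    then obtain x y where "q = x + y" "x \<in> C" "y \<in> cball 0 \<epsilon>" unfolding C'_def by blast
    then have "q \<in> cball x \<epsilon>" by (simp add: dist_norm)
    then show "q \<in> S" using \<epsilon>(2) \<open>x \<in> C\<close> by blast
  qed
  ultimately show thesis using that \<epsilon>(1) by blast
qed

text \<open>Testing with the kernel centred at \<open>p\<close> shows that the heat operator of the
  mollified \<open>u\<close> is exactly minus the mollified \<open>f(u)\<close>. Since
  \<open>f(u)\<close> is continuous, that is uniformly close to \<open>- f(u)\<close> on a compact
  set; nonnegativity keeps \<open>u\<close> where \<open>h\<close> is continuous.\<close>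

lemma weak_sol_heat_approx:
  fixes u :: "real \<Rightarrow> 'a::euclidean_space \<Rightarrow> real"
  assumes u: "weak_sol h \<Omega> u" and \<Omega>: "open \<Omega>"
    and nonneg: "\<And>t x. t > 0 \<Longrightarrow> x \<in> \<Omega> \<Longrightarrow> 0 \<le> u t x"
    and h: "continuous_on {0..} h"
  shows "heat_approx \<Omega> u (\<lambda>t x. - (u t x * h (u t x)))"
  unfolding heat_approx_def
proof (intro conjI allI impI)
  show cu: "continuous_on ({0<..} \<times> \<Omega>) (\<lambda>(t,x). u t x)" using u by (simp add: weak_sol_def)
  fix C :: "(real \<times> 'a) set" and e :: real
  assume *: "compact C \<and> C \<subseteq> {0<..} \<times> \<Omega> \<and> e > 0"
  define S where "S = {0::real<..} \<times> \<Omega>"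
  have S: "open S" unfolding S_def using \<Omega> by (intro open_Times) auto
  define u1 where "u1 = (\<lambda>p::real \<times> 'a. u (fst p) (snd p))"
  define f1 where "f1 = (\<lambda>p::real \<times> 'a. u1 p * h (u1 p))"
  have cu1: "continuous_on S u1" using cu by (simp add: S_def u1_def case_prod_beta)
  have cf1: "continuous_on S f1" unfolding f1_def
    by (intro continuous_intros cu1 continuous_on_compose2[OF h]) (auto simp: S_def u1_def nonneg)
  obtain \<epsilon>0 C' where \<epsilon>0: "\<epsilon>0 > 0" and C': "compact C'" "C' \<subseteq> S"
    and sub: "\<And>p. p \<in> C \<Longrightarrow> cball p \<epsilon>0 \<subseteq> C'"
    using compact_cball_nbhd[OF _ S, of C] * unfolding S_def by blast
  have cC': "continuous_on C' u1" "continuous_on C' f1"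
    using cu1 cf1 C'(2) continuous_on_subset by blast+
  have cl: "closedin (top_of_set UNIV) C'" using C'(1) compact_imp_closed by auto
  \<comment> \<open>The convolutions must be smooth on all of \<open>\<Omega>\<close>, near whose
    boundary \<open>u\<close> is not controlled. A continuous extension from the compact
    \<open>C'\<close> makes them smooth everywhere, and balls around points of \<open>C\<close> see
    only \<open>C'\<close>.\<close>
  obtain U where U: "continuous_on UNIV U" "\<And>p. p \<in> C' \<Longrightarrow> U p = u1 p"
    using Tietze_unbounded[OF cC'(1) cl] by blast
  obtain F where F: "continuous_on UNIV F" "\<And>p. p \<in> C' \<Longrightarrow> F p = f1 p"
    using Tietze_unbounded[OF cC'(2) cl] by blast
  have e: "e > 0" using * by simp
  obtain d1 where d1: "d1 > 0" "\<And>p q. p \<in> C' \<Longrightarrow> q \<in> C' \<Longrightarrow> dist q p < d1 \<Longrightarrow> dist (u1 q) (u1 p) < e"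
    using compact_uniformly_continuous[OF cC'(1) C'(1)] e unfolding uniformly_continuous_on_def by metis
  obtain d2 where d2: "d2 > 0" "\<And>p q. p \<in> C' \<Longrightarrow> q \<in> C' \<Longrightarrow> dist q p < d2 \<Longrightarrow> dist (f1 q) (f1 p) < e"
    using compact_uniformly_continuous[OF cC'(2) C'(1)] e unfolding uniformly_continuous_on_def by metis
  define \<epsilon> where "\<epsilon> = min \<epsilon>0 (min d1 d2 / 2)"
  have \<epsilon>: "\<epsilon> > 0" "\<epsilon> \<le> \<epsilon>0" "\<epsilon> < d1" "\<epsilon> < d2" using \<epsilon>0 d1(1) d2(1) by (auto simp: \<epsilon>_def)
  obtain A where A: "C' \<subseteq> cbox (- A) A"
    using bounded_subset_cbox_symmetric[OF compact_imp_bounded[OF C'(1)]] by blast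
  let ?Q = "cbox (- A) A"
  obtain c where c: "c > 0"
    "\<And>p a b. cball (p::real \<times> 'a) \<epsilon> \<subseteq> cbox a b \<Longrightarrow> integral (cbox a b) (\<lambda>q. bump \<epsilon> (p - q)) = c"
    using integral_bump_pos[OF \<epsilon>(1)] by blast
  have cb: "cball p \<epsilon> \<subseteq> C'" if "p \<in> C" for p using sub[OF that] \<epsilon>(2) by (force simp: subset_iff)
  have cb': "cball p \<epsilon> \<subseteq> ?Q" if "p \<in> C" for p using cb[OF that] A by blast
  define et where "et = (1::real, 0::'a)"
  define ex where "ex = (\<lambda>b::'a. (0::real, b))"
  define v where "v = (\<lambda>t x. integral ?Q (\<lambda>q. U q * bump \<epsilon> ((t,x) - q)) / c)"
  define vt where "vt = (\<lambda>t x. integral ?Q (\<lambda>q. U q * bump1 \<epsilon> et ((t,x) - q)) / c)"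
  define vb where "vb = (\<lambda>b t x. integral ?Q (\<lambda>q. U q * bump1 \<epsilon> (ex b) ((t,x) - q)) / c)"
  define vbb where "vbb = (\<lambda>b t x. integral ?Q (\<lambda>q. U q * bump2 \<epsilon> (ex b) ((t,x) - q)) / c)"
  define \<kappa> where "\<kappa> = (\<lambda>t x. vt t x - (\<Sum>b\<in>Basis. vbb b t x))"
  have cc: "continuous_on UNIV (\<lambda>q. U q * K (p - q))" if "continuous_on UNIV K" for K p
    by (intro continuous_intros U(1) continuous_on_compose2[OF that]) auto
  have int: "(\<lambda>q. U q * K (p - q)) integrable_on ?Q" if "continuous_on UNIV K" for K p
    using cc[OF that] by (intro integrable_continuous) (use continuous_on_subset in blast)
  have sm: "heat_smooth \<Omega> v \<kappa>"
  proof (rule heat_smoothI[where vt=vt and vb=vb and vbb=vbb])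
    have "continuous_on UNIV (\<lambda>p. integral ?Q (\<lambda>q. U q * bump \<epsilon> (p - q)))"
      by (rule integral_continuous_on_param)
         (auto simp: case_prod_beta intro!: continuous_intros continuous_on_compose2[OF U(1)]
           continuous_on_compose2[OF continuous_on_bump(1)[of UNIV]])
    then have "continuous_on UNIV (\<lambda>p. integral ?Q (\<lambda>q. U q * bump \<epsilon> (p - q)) / c)"
      by (intro continuous_intros) (use c(1) in auto)
    then show "continuous_on ({0<..} \<times> \<Omega>) (\<lambda>(t,x). v t x)"
      unfolding v_def case_prod_beta prod.collapse by (rule continuous_on_subset) auto
  next
    fix t :: real and x :: 'a
    have "((\<lambda>s. integral ?Q (\<lambda>q. U q * bump \<epsilon> ((0,x) + s *\<^sub>R et - q)) / c) has_real_derivative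
       integral ?Q (\<lambda>q. U q * bump1 \<epsilon> et ((0,x) + t *\<^sub>R et - q)) / c) (at t)"
      by (intro DERIV_cdivide convolution_line_deriv U(1) continuous_on_bump bump_line_derivs)
    then show "((\<lambda>s. v s x) has_real_derivative vt t x) (at t)"
      by (simp add: v_def vt_def et_def)
  next
    fix t :: real and x b :: 'a
    have "((\<lambda>s. integral ?Q (\<lambda>q. U q * bump \<epsilon> ((t,x) + s *\<^sub>R ex b - q)) / c) has_real_derivative
       integral ?Q (\<lambda>q. U q * bump1 \<epsilon> (ex b) ((t,x) + 0 *\<^sub>R ex b - q)) / c) (at 0)"
      by (intro DERIV_cdivide convolution_line_deriv U(1) continuous_on_bump bump_line_derivs)
    then show "((\<lambda>s. v t (x + s *\<^sub>R b)) has_real_derivative vb b t x) (at 0)"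
      by (simp add: v_def vb_def ex_def)
    have "((\<lambda>s. integral ?Q (\<lambda>q. U q * bump1 \<epsilon> (ex b) ((t,x) + s *\<^sub>R ex b - q)) / c) has_real_derivative
       integral ?Q (\<lambda>q. U q * bump2 \<epsilon> (ex b) ((t,x) + 0 *\<^sub>R ex b - q)) / c) (at 0)"
      by (intro DERIV_cdivide convolution_line_deriv U(1) continuous_on_bump bump_line_derivs)
    then show "((\<lambda>s. vb b t (x + s *\<^sub>R b)) has_real_derivative vbb b t x) (at 0)"
      by (simp add: vbb_def vb_def ex_def)
  qed (simp add: \<kappa>_def)
  \<comment> \<open>On the support of the kernel \<open>U\<close> and \<open>F\<close> coincide with
    \<open>u\<close> and \<open>f(u)\<close>, and outside it both integrands vanish. The weak
    equation thus becomes an identity between integrals over one box.\<close>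
  have eq: "\<kappa> t x = - (integral ?Q (\<lambda>q. F q * bump \<epsilon> ((t,x) - q)) / c)" if "(t,x) \<in> C" for t x
  proof -
    define p where "p = (t,x)"
    have p: "p \<in> C" using that by (simp add: p_def)
    let ?\<phi> = "\<lambda>q. bump \<epsilon> (p - q)"
    define G where "G = (\<lambda>q. U q * bump1 \<epsilon> et (p - q) - (\<Sum>b\<in>Basis. U q * bump2 \<epsilon> (ex b) (p - q))
        + F q * bump \<epsilon> (p - q))"
    have "test_fun \<Omega> ?\<phi>"
      by (rule test_fun_bump[OF \<epsilon>(1)]) (use cb[OF p] C'(2) in \<open>auto simp: S_def\<close>)
    then have "integral UNIV (\<lambda>q. if q \<in> {0<..} \<times> \<Omega> then
            - u (fst q) (snd q) * (dirderiv ?\<phi> q (1, 0) + (\<Sum>b\<in>Basis. dirderiv2 ?\<phi> q (0, b)))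
            + u (fst q) (snd q) * h (u (fst q) (snd q)) * ?\<phi> q
          else 0) = 0" using u unfolding weak_sol_def by blast
    moreover have "(\<lambda>q. if q \<in> {0<..} \<times> \<Omega> then
            - u (fst q) (snd q) * (dirderiv ?\<phi> q (1, 0) + (\<Sum>b\<in>Basis. dirderiv2 ?\<phi> q (0, b)))
            + u (fst q) (snd q) * h (u (fst q) (snd q)) * ?\<phi> q
          else 0) = (\<lambda>q. if q \<in> ?Q then G q else 0)" (is "?L = ?R")
    proof
      fix q
      show "?L q = ?R q"
      proof (cases "q \<in> cball p \<epsilon>")
        case True
        then have "q \<in> C'" "q \<in> S" "q \<in> ?Q" using cb[OF p] C'(2) A by auto
        then show ?thesis using U(2)[of q] F(2)[of q]
          by (simp add: G_def dirderiv_bump dirderiv2_bump S_def u1_def f1_def et_def ex_def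
              sum_distrib_left sum_negf algebra_simps)
      next
        case False
        then have "norm (p - q) \<ge> \<epsilon>" by (simp add: dist_norm)
        note z = bump_eq_0[OF less_imp_le[OF \<epsilon>(1)] this]
        show ?thesis unfolding dirderiv_bump dirderiv2_bump G_def z by simp
      qed
    qed
    ultimately have "integral ?Q G = 0" by (simp add: integral_restrict_UNIV)
    moreover have "integral ?Q G = integral ?Q (\<lambda>q. U q * bump1 \<epsilon> et (p - q))
        - (\<Sum>b\<in>Basis. integral ?Q (\<lambda>q. U q * bump2 \<epsilon> (ex b) (p - q)))
        + integral ?Q (\<lambda>q. F q * bump \<epsilon> (p - q))"
    proof -
      have iF: "(\<lambda>q. F q * bump \<epsilon> (p - q)) integrable_on ?Q"
        by (intro integrable_continuous continuous_intros continuous_on_compose2[OF F(1)]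
            continuous_on_compose2[OF continuous_on_bump(1)[of UNIV]]) auto
      have i2: "(\<lambda>q. \<Sum>b\<in>Basis. U q * bump2 \<epsilon> (ex b) (p - q)) integrable_on ?Q"
        by (intro integrable_sum int continuous_on_bump) auto
      show ?thesis unfolding G_def
        by (simp add: integral_add integral_diff integral_sum int continuous_on_bump iF i2 integrable_diff)
    qed
    ultimately show ?thesis unfolding \<kappa>_def vt_def vbb_def p_def[symmetric]
      by (simp add: sum_divide_distrib[symmetric] diff_divide_distrib[symmetric])
         (simp add: eq_neg_iff_add_eq_0 add_divide_distrib[symmetric])
  qed
  show "\<exists>v \<kappa>. heat_smooth \<Omega> v \<kappa> \<and> (\<forall>t x. (t,x) \<in> C \<longrightarrow>
      \<bar>v t x - u t x\<bar> \<le> e \<and> \<bar>\<kappa> t x - - (u t x * h (u t x))\<bar> \<le> e)"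
  proof (intro exI conjI allI impI, rule sm)
    fix t x assume tx: "(t,x) \<in> C"
    have q: "q \<in> C'" "dist q (t,x) < d1" "dist q (t,x) < d2" if "q \<in> cball (t,x) \<epsilon>" for q
      using that cb[OF tx] \<epsilon> by (auto simp: dist_commute)
    have p: "(t,x) \<in> C'" using cb[OF tx] \<epsilon>(1) by auto
    show "\<bar>v t x - u t x\<bar> \<le> e" unfolding v_def
    proof (rule mollify_error[OF U(1) \<epsilon>(1) cb'[OF tx] c(1) c(2)[OF cb'[OF tx]]])
      fix q assume "q \<in> cball (t,x) \<epsilon>"
      from d1(2)[OF p q(1,2)[OF this]] U(2)[OF q(1)[OF this]]
      show "\<bar>U q - u t x\<bar> \<le> e" by (simp add: u1_def dist_real_def)
    qed
    have "\<bar>integral ?Q (\<lambda>q. F q * bump \<epsilon> ((t,x) - q)) / c - u t x * h (u t x)\<bar> \<le> e"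
    proof (rule mollify_error[OF F(1) \<epsilon>(1) cb'[OF tx] c(1) c(2)[OF cb'[OF tx]]])
      fix q assume "q \<in> cball (t,x) \<epsilon>"
      from d2(2)[OF p q(1,3)[OF this]] F(2)[OF q(1)[OF this]]
      show "\<bar>F q - u t x * h (u t x)\<bar> \<le> e" by (simp add: u1_def f1_def dist_real_def)
    qed
    then show "\<bar>\<kappa> t x - - (u t x * h (u t x))\<bar> \<le> e" unfolding eq[OF tx] by linarith
  qed
qed

section \<open>Comparison on balls with incompatible initial and boundary values\<close>

text \<open>A supersolution of the heat equation concentrated, at time 0, near the sphere of radius \<open>n\<close>:
  a Gaussian of width \<open>\<delta>\<close> in the variable \<open>q = n\<^sup>2 - |x|\<^sup>2\<close>.\<close>

definition shell_exponent :: "real \<Rightarrow> real \<Rightarrow> real \<Rightarrow> real \<Rightarrow> 'a::euclidean_space \<Rightarrow> real" where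
  "shell_exponent n \<mu> \<delta> t x = \<mu> * t - ln ((t + \<delta>\<^sup>2) / \<delta>\<^sup>2) / 4 - (n\<^sup>2 - x \<bullet> x)\<^sup>2 / (16 * n\<^sup>2 * (t + \<delta>\<^sup>2))"

definition shell_barrier :: "real \<Rightarrow> real \<Rightarrow> real \<Rightarrow> real \<Rightarrow> 'a::euclidean_space \<Rightarrow> real" where
  "shell_barrier n \<mu> \<delta> t x = exp (shell_exponent n \<mu> \<delta> t x)"

text \<open>Only the third term is negative. If \<open>P q \<le> n^2\<close>, then
  \<open>1/(4 \<tau>)\<close> absorbs it. Otherwise it is the cross term of a square, and
  \<open>n^2/P < q\<close> raises the remaining \<open>q^2\<close> to the \<open>q^3\<close> of the
  last term.\<close>

lemma shell_exponent_ineq: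
  fixes n \<tau> q P :: real
  assumes "n > 0" "\<tau> > 0" "P > 0" "0 \<le> q"
  shows "0 \<le> P ^ 3 / (4 * n\<^sup>2) + 1 / (4 * \<tau>) - P * q / (4 * n\<^sup>2 * \<tau>) + q ^ 3 / (16 * n ^ 4 * \<tau>\<^sup>2)"
proof (cases "P * q \<le> n\<^sup>2")
  case True
  then have "P * q / (4 * n\<^sup>2 * \<tau>) \<le> n\<^sup>2 / (4 * n\<^sup>2 * \<tau>)"
    using assms by (intro divide_right_mono) auto
  also have "\<dots> = 1 / (4 * \<tau>)" using assms by simp
  finally have "P * q / (4 * n\<^sup>2 * \<tau>) \<le> 1 / (4 * \<tau>)" .
  moreover have "0 \<le> P ^ 3 / (4 * n\<^sup>2)" "0 \<le> q ^ 3 / (16 * n ^ 4 * \<tau>\<^sup>2)" using assms by auto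
  ultimately show ?thesis by linarith
next
  case False
  have "0 \<le> (1 / P) * (q / (4 * n * \<tau>) - P\<^sup>2 / (2 * n))\<^sup>2" using assms by simp
  also have "\<dots> = P ^ 3 / (4 * n\<^sup>2) - P * q / (4 * n\<^sup>2 * \<tau>) + q\<^sup>2 / (16 * P * n\<^sup>2 * \<tau>\<^sup>2)"
    using assms by (simp add: power2_eq_square power3_eq_cube field_simps)
  also have "q\<^sup>2 / (16 * P * n\<^sup>2 * \<tau>\<^sup>2) = q\<^sup>2 * (n\<^sup>2 / P) / (16 * n ^ 4 * \<tau>\<^sup>2)"
    using assms by (simp add: power2_eq_square power4_eq_xxxx field_simps)
  also have "\<dots> \<le> q\<^sup>2 * q / (16 * n ^ 4 * \<tau>\<^sup>2)"
    using assms False by (intro divide_right_mono mult_left_mono) (auto simp: field_simps)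
  finally show ?thesis using assms by (simp add: power2_eq_square power3_eq_cube)
      (smt (verit) divide_nonneg_pos zero_le_divide_1_iff)
qed

text \<open>For an exponential of \<open>E\<close> the heat operator is the exponential times
  \<open>E_t - |grad E|^2 - Lap E\<close>. Near the sphere \<open>q\<close> is about
  \<open>2 n\<close> times the distance, so \<open>q^2/(16 n^2 \<tau>)\<close> is the exponent of
  the one-dimensional heat kernel. The prefactor decays like \<open>\<tau>^(-1/4)\<close> instead of
  \<open>\<tau>^(-1/2)\<close>, which leaves a surplus \<open>1/(4 \<tau>)\<close>; together with
  \<open>\<mu>\<close> it pays for the curvature of the sphere through
  \<open>shell_exponent_ineq\<close> with \<open>P = N + 2\<close>.\<close>

lemma shell_barrier_supersolution:
  fixes n \<delta> :: real
  defines "\<mu> \<equiv> (real DIM('a::euclidean_space) + 2) ^ 3 / (4 * n\<^sup>2)"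
  assumes n: "n > 0" and \<delta>: "\<delta> > 0"
  obtains \<kappa> where "heat_smooth (ball 0 n :: 'a set) (shell_barrier n \<mu> \<delta>) \<kappa>"
    and "\<And>t x. t > 0 \<Longrightarrow> x \<in> ball 0 n \<Longrightarrow> \<kappa> t x \<ge> 0"
proof -
  define Et where "Et = (\<lambda>t (x::'a). \<mu> - 1 / (4 * (t + \<delta>\<^sup>2)) + (n\<^sup>2 - x \<bullet> x)\<^sup>2 / (16 * n\<^sup>2 * (t + \<delta>\<^sup>2)\<^sup>2))"
  define Eb where "Eb = (\<lambda>b t (x::'a). (n\<^sup>2 - x \<bullet> x) * (x \<bullet> b) / (4 * n\<^sup>2 * (t + \<delta>\<^sup>2)))"
  define Ebb where "Ebb = (\<lambda>b t (x::'a). ((n\<^sup>2 - x \<bullet> x) - 2 * (x \<bullet> b)\<^sup>2) / (4 * n\<^sup>2 * (t + \<delta>\<^sup>2)))"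
  let ?E = "shell_exponent n \<mu> \<delta> :: real \<Rightarrow> 'a \<Rightarrow> real" and ?Z = "shell_barrier n \<mu> \<delta> :: real \<Rightarrow> 'a \<Rightarrow> real"
  define \<kappa> where "\<kappa> = (\<lambda>t x. Et t x * ?Z t x - (\<Sum>b\<in>Basis. ((Eb b t x)\<^sup>2 + Ebb b t x) * ?Z t x))"
  have \<tau>: "t + \<delta>\<^sup>2 > 0" if "t > 0" for t using that \<delta> by (simp add: add_pos_pos)
  have dEt: "((\<lambda>s. ?E s x) has_real_derivative Et t x) (at t)" if t: "t > 0" for t x
  proof -
    define D where "D = \<delta>\<^sup>2"
    define A where "A = (n\<^sup>2 - x \<bullet> x)\<^sup>2"
    define B where "B = 16 * n\<^sup>2"
    have D: "D > 0" "t + D > 0" and B: "B > 0" using \<delta> n \<tau>[OF t] by (auto simp: D_def B_def)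
    have "((\<lambda>s. (s + D) / D) has_real_derivative 1 / D) (at t)"
      by (intro DERIV_cdivide) (auto intro!: derivative_eq_intros)
    from DERIV_chain2[OF DERIV_ln_divide this] have 1: "((\<lambda>s. ln ((s + D) / D)) has_real_derivative 1 / (t + D)) (at t)"
      using D by simp
    have "((\<lambda>s. s + D) has_real_derivative 1) (at t)" by (auto intro!: derivative_eq_intros)
    from DERIV_inverse_fun[OF this] have "((\<lambda>s. inverse (s + D)) has_real_derivative - (1 / (t + D)\<^sup>2)) (at t)"
      using D by (simp add: power2_eq_square inverse_eq_divide)
    from DERIV_cmult[OF this, of "A / B"] have 2: "((\<lambda>s. A / (B * (s + D))) has_real_derivative - (A / (B * (t + D)\<^sup>2))) (at t)"
      by (simp add: divide_inverse mult_ac)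
    have "((\<lambda>s. \<mu> * s) has_real_derivative \<mu>) (at t)" by (auto intro!: derivative_eq_intros)
    from DERIV_diff[OF DERIV_diff[OF this DERIV_cdivide[OF 1]] 2, of 4]
    show ?thesis unfolding shell_exponent_def Et_def D_def A_def B_def by (simp add: mult.commute[of 4])
  qed
  have dQ: "((\<lambda>s. n\<^sup>2 - (x + s *\<^sub>R b) \<bullet> (x + s *\<^sub>R b)) has_real_derivative - 2 * (x \<bullet> b)) (at 0)" for x b :: 'a
    unfolding has_field_derivative_def
    by (auto intro!: derivative_eq_intros simp: inner_commute algebra_simps)
  have dE: "((\<lambda>s. ?E t (x + s *\<^sub>R b)) has_real_derivative Eb b t x) (at 0)" if t: "t > 0" for t x b
  proof -
    have alg: "0 - 2 * q * (- 2 * c) / (16 * A * B) = q * c / (4 * A * B)" for q c A B :: real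
      by (cases "A = 0 \<or> B = 0") (auto simp: field_simps)
    have "((\<lambda>s. (n\<^sup>2 - (x + s *\<^sub>R b) \<bullet> (x + s *\<^sub>R b))\<^sup>2) has_real_derivative
        2 * (n\<^sup>2 - x \<bullet> x) * (- 2 * (x \<bullet> b))) (at 0)"
      using DERIV_power[OF dQ, of x b 2] by (simp add: mult_ac)
    from DERIV_diff[OF DERIV_const[of "\<mu> * t - ln ((t + \<delta>\<^sup>2) / \<delta>\<^sup>2) / 4"]
        DERIV_cdivide[OF this, of "16 * n\<^sup>2 * (t + \<delta>\<^sup>2)"], unfolded alg]
    show ?thesis unfolding shell_exponent_def Eb_def .
  qed
  have dxb: "((\<lambda>s. (x + s *\<^sub>R b) \<bullet> b) has_real_derivative 1) (at 0)" if "b \<in> Basis" for x b :: 'a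
    unfolding has_field_derivative_def using that by (auto intro!: derivative_eq_intros)
  have dEb: "((\<lambda>s. Eb b t (x + s *\<^sub>R b)) has_real_derivative Ebb b t x) (at 0)" if t: "t > 0" and b: "b \<in> Basis" for t x b
    unfolding Eb_def Ebb_def
    by (rule DERIV_cong[OF DERIV_cdivide[OF DERIV_mult[OF dQ dxb[OF b]]]]) (simp add: power2_eq_square)
  have dZ: "((\<lambda>s. ?Z t (x + s *\<^sub>R b)) has_real_derivative Eb b t x * ?Z t x) (at 0)" if t: "t > 0" for t x b
    unfolding shell_barrier_def using DERIV_fun_exp[OF dE[OF t], of x b] by (simp add: mult.commute)
  have sm: "heat_smooth (ball 0 n) ?Z \<kappa>"
  proof (rule heat_smoothI[where vt="\<lambda>t x. Et t x * ?Z t x" and vb="\<lambda>b t x. Eb b t x * ?Z t x"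
        and vbb="\<lambda>b t x. ((Eb b t x)\<^sup>2 + Ebb b t x) * ?Z t x"])
    show "continuous_on ({0<..} \<times> ball 0 n) (\<lambda>(t, x). ?Z t x)"
      unfolding shell_barrier_def shell_exponent_def case_prod_beta using n \<delta> \<tau>
      by (intro continuous_intros) (auto simp: less_imp_neq[symmetric] zero_less_divide_iff)
  next
    fix t :: real and x :: 'a assume t: "t > 0"
    show "((\<lambda>s. ?Z s x) has_real_derivative Et t x * ?Z t x) (at t)"
      unfolding shell_barrier_def using DERIV_fun_exp[OF dEt[OF t], of x] by (simp add: mult.commute)
    fix b :: 'a assume b: "b \<in> Basis"
    show "((\<lambda>s. ?Z t (x + s *\<^sub>R b)) has_real_derivative Eb b t x * ?Z t x) (at 0)" by (rule dZ[OF t])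
    show "((\<lambda>s. Eb b t (x + s *\<^sub>R b) * ?Z t (x + s *\<^sub>R b)) has_real_derivative ((Eb b t x)\<^sup>2 + Ebb b t x) * ?Z t x) (at 0)"
      by (rule DERIV_cong[OF DERIV_mult[OF dEb[OF t b] dZ[OF t]]]) (simp add: power2_eq_square algebra_simps)
  qed (simp add: \<kappa>_def)
  have "\<kappa> t x \<ge> 0" if t: "t > 0" and x: "x \<in> ball 0 n" for t x
  proof -
    define N where "N = real DIM('a)"
    define \<tau> where "\<tau> = t + \<delta>\<^sup>2"
    define q where "q = n\<^sup>2 - x \<bullet> x"
    have xx: "x \<bullet> x = n\<^sup>2 - q" by (simp add: q_def)
    have \<tau>0: "\<tau> > 0" using \<tau>[OF t] by (simp add: \<tau>_def)
    have "x \<bullet> x < n\<^sup>2" using x n by (simp add: dot_square_norm power_strict_mono)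
    then have q0: "q \<ge> 0" by (simp add: q_def)
    have s: "(\<Sum>b\<in>Basis. (x \<bullet> b)\<^sup>2) = x \<bullet> x"
      unfolding euclidean_inner[of x x] by (simp add: power2_eq_square)
    have "(\<Sum>b\<in>Basis. (Eb b t x)\<^sup>2) = (\<Sum>b\<in>Basis. q\<^sup>2 / (16 * n ^ 4 * \<tau>\<^sup>2) * (x \<bullet> b)\<^sup>2)"
      by (rule sum.cong) (simp_all add: Eb_def q_def \<tau>_def power_mult_distrib power_divide flip: power_mult)
    also have "\<dots> = q\<^sup>2 * (n\<^sup>2 - q) / (16 * n ^ 4 * \<tau>\<^sup>2)"
      unfolding sum_distrib_left[symmetric] s xx by simp
    finally have s1: "(\<Sum>b\<in>Basis. (Eb b t x)\<^sup>2) = q\<^sup>2 * (n\<^sup>2 - q) / (16 * n ^ 4 * \<tau>\<^sup>2)" .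
    have "(\<Sum>b\<in>Basis. Ebb b t x) = (\<Sum>b\<in>(Basis::'a set). q - 2 * (x \<bullet> b)\<^sup>2) / (4 * n\<^sup>2 * \<tau>)"
      by (simp add: Ebb_def q_def \<tau>_def sum_divide_distrib)
    also have "(\<Sum>b\<in>(Basis::'a set). q - 2 * (x \<bullet> b)\<^sup>2) = N * q - 2 * (n\<^sup>2 - q)"
      by (simp add: sum_subtractf N_def s xx flip: sum_distrib_left)
    finally have s2: "(\<Sum>b\<in>Basis. Ebb b t x) = (N * q - 2 * (n\<^sup>2 - q)) / (4 * n\<^sup>2 * \<tau>)" .
    have "Et t x - (\<Sum>b\<in>Basis. (Eb b t x)\<^sup>2 + Ebb b t x)
        = \<mu> - 1 / (4 * \<tau>) + q\<^sup>2 / (16 * n\<^sup>2 * \<tau>\<^sup>2) - q\<^sup>2 * (n\<^sup>2 - q) / (16 * n ^ 4 * \<tau>\<^sup>2)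
           - (N * q - 2 * (n\<^sup>2 - q)) / (4 * n\<^sup>2 * \<tau>)"
      unfolding sum.distrib s1 s2 by (simp add: Et_def q_def \<tau>_def)
    also have "\<dots> = (N + 2) ^ 3 / (4 * n\<^sup>2) + 1 / (4 * \<tau>) - (N + 2) * q / (4 * n\<^sup>2 * \<tau>) + q ^ 3 / (16 * n ^ 4 * \<tau>\<^sup>2)"
    proof -
      have a: "q\<^sup>2 * (n\<^sup>2 - q) / (16 * n ^ 4 * \<tau>\<^sup>2) = q\<^sup>2 / (16 * n\<^sup>2 * \<tau>\<^sup>2) - q ^ 3 / (16 * n ^ 4 * \<tau>\<^sup>2)"
        using n \<tau>0 by (simp add: field_simps power2_eq_square power3_eq_cube power4_eq_xxxx)
      have b: "(N * q - 2 * (n\<^sup>2 - q)) / (4 * n\<^sup>2 * \<tau>) = (N + 2) * q / (4 * n\<^sup>2 * \<tau>) - 2 / (4 * \<tau>)"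
        using n \<tau>0 by (simp add: field_simps power2_eq_square)
      show ?thesis unfolding a b unfolding \<mu>_def N_def by simp
    qed
    also have "\<dots> \<ge> 0" by (rule shell_exponent_ineq) (use n \<tau>0 q0 in \<open>auto simp: N_def\<close>)
    finally have "(Et t x - (\<Sum>b\<in>Basis. (Eb b t x)\<^sup>2 + Ebb b t x)) * ?Z t x \<ge> 0"
      by (intro mult_nonneg_nonneg) (auto simp: shell_barrier_def)
    then show ?thesis by (simp add: \<kappa>_def left_diff_distrib sum_distrib_right)
  qed
  then show thesis using that sm by blast
qed

text \<open>In the shell of thickness \<open>\<delta>/2\<close> and up to time
  \<open>\<delta>^2\<close>, the logarithm costs at most \<open>1/4\<close> and the quadratic term
  at most \<open>1/16\<close>; the bound \<open>-1\<close> on the exponent is generous.\<close>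

lemma shell_barrier_lower:
  assumes "\<mu> \<ge> 0" "\<delta> > 0" "n > 0" "0 \<le> t" "t \<le> \<delta>\<^sup>2" and x: "norm x \<le> n" "n - \<delta> / 2 \<le> norm x"
  shows "shell_barrier n \<mu> \<delta> t x \<ge> exp (- 1)"
proof -
  have \<tau>: "\<delta>\<^sup>2 \<le> t + \<delta>\<^sup>2" "t + \<delta>\<^sup>2 > 0" using assms by (auto simp: add_nonneg_pos)
  have "ln ((t + \<delta>\<^sup>2) / \<delta>\<^sup>2) \<le> (t + \<delta>\<^sup>2) / \<delta>\<^sup>2 - 1"
    using \<tau> assms(2) by (intro ln_le_minus_one) auto
  also have "\<dots> \<le> 1" using assms by (simp add: field_simps)
  finally have 1: "ln ((t + \<delta>\<^sup>2) / \<delta>\<^sup>2) / 4 \<le> 1 / 4" by simp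
  have "n\<^sup>2 - x \<bullet> x = (n - norm x) * (n + norm x)"
    by (simp add: dot_square_norm power2_eq_square algebra_simps)
  moreover have "(n - norm x) * (n + norm x) \<le> (\<delta> / 2) * (2 * n)" using assms by (intro mult_mono) auto
  ultimately have "n\<^sup>2 - x \<bullet> x \<le> \<delta> * n" "0 \<le> n\<^sup>2 - x \<bullet> x" using assms by auto
  then have "(n\<^sup>2 - x \<bullet> x)\<^sup>2 \<le> (\<delta> * n)\<^sup>2" by (rule power_mono)
  also have "\<dots> \<le> 1 / 16 * (16 * n\<^sup>2 * (t + \<delta>\<^sup>2))"
    using assms by (simp add: power_mult_distrib algebra_simps)
  finally have "(n\<^sup>2 - x \<bullet> x)\<^sup>2 / (16 * n\<^sup>2 * (t + \<delta>\<^sup>2)) \<le> 1 / 16"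
    using \<tau> assms(3) by (subst pos_divide_le_eq) auto
  moreover have "\<mu> * t \<ge> 0" using assms by simp
  ultimately have "- 1 \<le> shell_exponent n \<mu> \<delta> t x" using 1 unfolding shell_exponent_def by linarith
  then show ?thesis by (simp add: shell_barrier_def)
qed

text \<open>The barrier disappears in the end: at a fixed positive time the prefactor is at most
  \<open>(\<delta>^2/t)^(1/4)\<close>, and the spatial factor at most 1.\<close>

lemma shell_barrier_tendsto_0:
  assumes "t > 0"
  shows "((\<lambda>\<delta>. shell_barrier n \<mu> \<delta> t x) \<longlongrightarrow> 0) (at_right 0)"
proof (rule tendsto_sandwich[where f="\<lambda>_. 0" and h="\<lambda>\<delta>. exp (\<mu> * t) * (\<delta>\<^sup>2 / t) powr (1/4)"])
  have "((\<lambda>\<delta>::real. exp (\<mu> * t) * (\<delta>\<^sup>2 / t) powr (1/4)) \<longlongrightarrow> exp (\<mu> * t) * (0\<^sup>2 / t) powr (1/4)) (at_right 0)"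
    by (intro tendsto_intros tendsto_powr') (use assms in \<open>auto intro!: always_eventually\<close>)
  then show "((\<lambda>\<delta>::real. exp (\<mu> * t) * (\<delta>\<^sup>2 / t) powr (1/4)) \<longlongrightarrow> 0) (at_right 0)" by simp
  show "\<forall>\<^sub>F \<delta> in at_right 0. shell_barrier n \<mu> \<delta> t x \<le> exp (\<mu> * t) * (\<delta>\<^sup>2 / t) powr (1/4)"
  proof (rule eventually_mono[OF eventually_at_right_less[of 0]])
    fix \<delta> :: real assume \<delta>: "0 < \<delta>"
    have "ln (t / \<delta>\<^sup>2) \<le> ln ((t + \<delta>\<^sup>2) / \<delta>\<^sup>2)"
      using \<delta> assms by (subst ln_le_cancel_iff) (auto simp: divide_right_mono add_pos_pos)
    moreover have "ln (t / \<delta>\<^sup>2) = - ln (\<delta>\<^sup>2 / t)" using \<delta> assms by (simp add: ln_div)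
    moreover have "0 \<le> (n\<^sup>2 - x \<bullet> x)\<^sup>2 / (16 * n\<^sup>2 * (t + \<delta>\<^sup>2))" using assms by simp
    ultimately have "shell_exponent n \<mu> \<delta> t x \<le> \<mu> * t + 1/4 * ln (\<delta>\<^sup>2 / t)"
      unfolding shell_exponent_def by linarith
    then have "shell_barrier n \<mu> \<delta> t x \<le> exp (\<mu> * t + 1/4 * ln (\<delta>\<^sup>2 / t))" by (simp add: shell_barrier_def)
    also have "\<dots> = exp (\<mu> * t) * (\<delta>\<^sup>2 / t) powr (1/4)" using \<delta> assms by (simp add: exp_add powr_def)
    finally show "shell_barrier n \<mu> \<delta> t x \<le> exp (\<mu> * t) * (\<delta>\<^sup>2 / t) powr (1/4)" .
  qed
qed (auto simp: shell_barrier_def)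

text \<open>Nothing but boundedness is known near the corner \<open>{0} \<times> \<partial>B\<^sub>n\<close>; the shell barrier absorbs it.\<close>

lemma ball_comparison:
  fixes w k :: "real \<Rightarrow> 'a::euclidean_space \<Rightarrow> real"
  assumes w: "heat_approx (ball 0 n) w k" and n: "n > 0"
    and cont: "continuous_on ({0<..} \<times> cball 0 n) (\<lambda>(t,x). w t x)"
    and bd: "\<And>t x. t > 0 \<Longrightarrow> norm x = n \<Longrightarrow> w t x \<le> 0"
    and le: "\<And>t x. t > 0 \<Longrightarrow> x \<in> ball 0 n \<Longrightarrow> w t x \<le> M"
    and init: "\<And>K e. compact K \<Longrightarrow> K \<subseteq> ball 0 n \<Longrightarrow> e > 0 \<Longrightarrow> \<forall>\<^sub>F t in at_right 0. \<forall>x\<in>K. w t x < e"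
    and k: "\<And>t x. t > 0 \<Longrightarrow> x \<in> ball 0 n \<Longrightarrow> w t x > 0 \<Longrightarrow> k t x \<le> 0"
    and t: "t > 0" and x: "x \<in> ball 0 n"
  shows "w t x \<le> 0"
proof -
  define \<mu> where "\<mu> = (real DIM('a) + 2) ^ 3 / (4 * n\<^sup>2)"
  have \<mu>: "\<mu> \<ge> 0" by (simp add: \<mu>_def)
  \<comment> \<open>The factor \<open>exp 1\<close> undoes the lower bound \<open>exp (- 1)\<close>
    of the barrier, so that \<open>L\<close> times the barrier dominates \<open>M\<close> in the
    shell.\<close>
  define L where "L = \<bar>M\<bar> * exp 1"
  have L0: "L \<ge> 0" by (simp add: L_def)
  have main: "w t x \<le> L * shell_barrier n \<mu> \<delta> t x" if \<delta>: "\<delta> > 0" for \<delta>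
  proof -
    let ?Z = "shell_barrier n \<mu> \<delta> :: real \<Rightarrow> 'a \<Rightarrow> real"
    obtain \<kappa> where sm: "heat_smooth (ball 0 n :: 'a set) ?Z \<kappa>"
      and \<kappa>: "\<And>t x. t > 0 \<Longrightarrow> x \<in> ball 0 n \<Longrightarrow> \<kappa> t x \<ge> 0"
      using shell_barrier_supersolution[OF n \<delta>] unfolding \<mu>_def by blast
    define W where "W = (\<lambda>t x. w t x - L * ?Z t x)"
    define k' where "k' = (\<lambda>t x. k t x - L * \<kappa> t x)"
    have W: "heat_approx (ball 0 n) W k'" unfolding W_def k'_def
      by (intro heat_approx_diff w heat_smooth_imp_approx heat_smooth_cmult sm)
    have Wcont: "continuous_on ({0<..} \<times> cball 0 n) (\<lambda>(t,x). W t x)"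
    proof -
      have "\<And>t. t > 0 \<Longrightarrow> t + \<delta>\<^sup>2 > 0" using \<delta> by (simp add: add_pos_pos)
      then have "continuous_on ({0<..} \<times> cball 0 n) (\<lambda>(t, x). ?Z t x)"
        unfolding shell_barrier_def shell_exponent_def case_prod_beta using n \<delta>
        by (intro continuous_intros) (auto simp: less_imp_neq[symmetric] zero_less_divide_iff)
      then show ?thesis using cont unfolding W_def case_prod_beta by (intro continuous_intros) auto
    qed
    have Z0: "?Z t x \<ge> 0" for t x by (simp add: shell_barrier_def)
    have "W t x \<le> 0"
    proof (rule heat_approx_maximum_principle[OF W open_ball _ _ t order_refl x])
      fix s y assume s: "0 < s" "y \<in> ball 0 n" "0 < W s y"
      then have "w s y > 0" using L0 Z0[of s y] mult_nonneg_nonneg[OF L0 Z0[of s y]] unfolding W_def by linarith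
      then show "k' s y \<le> 0" using k[OF s(1,2)] mult_nonneg_nonneg[OF L0 \<kappa>[OF s(1,2)]] unfolding k'_def by linarith
    next
      fix \<theta> :: real assume \<theta>: "\<theta> > 0"
      have "\<forall>\<^sub>F s in at_right 0. \<forall>y\<in>cball 0 (n - \<delta> / 2). w s y < \<theta>"
        by (rule init) (use \<delta> \<theta> in auto)
      then obtain d where d: "d > 0" "\<And>s y. 0 < s \<Longrightarrow> s < d \<Longrightarrow> y \<in> cball 0 (n - \<delta> / 2) \<Longrightarrow> w s y < \<theta>"
        unfolding eventually_at_right_field by blast
      \<comment> \<open>Up to \<open>t1\<close> the inner ball is controlled by the initial trace
        (time below \<open>d\<close>) and the remaining shell by the barrier (time at most
        \<open>\<delta>^2\<close>).\<close>
      define t1 where "t1 = min (d / 2) (\<delta>\<^sup>2)"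
      have t1: "t1 > 0" "t1 < d" "t1 \<le> \<delta>\<^sup>2" using d(1) \<delta> by (auto simp: t1_def)
      have late: "s > t1" if "s > 0" "y \<in> ball 0 n" "W s y \<ge> \<theta>" for s y
      proof (rule ccontr)
        assume "\<not> s > t1"
        then have s: "s < d" "s \<le> \<delta>\<^sup>2" using t1 by auto
        show False
        proof (cases "y \<in> cball 0 (n - \<delta> / 2)")
          case True
          then show False using d(2)[OF that(1) s(1) True] that(3) mult_nonneg_nonneg[OF L0 Z0[of s y]]
            unfolding W_def by linarith
        next
          case False
          then have "?Z s y \<ge> exp (- 1)"
            using that s by (intro shell_barrier_lower[OF \<mu> \<delta> n]) auto
          then have "L * exp (- 1) \<le> L * ?Z s y" using L0 by (rule mult_left_mono)
          moreover have "L * exp (- 1) = \<bar>M\<bar>" by (simp add: L_def exp_minus)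
          ultimately show False using le[OF that(1,2)] that(3) \<theta> unfolding W_def by linarith
        qed
      qed
      show "compact {(s,y). 0 < s \<and> s \<le> t \<and> y \<in> ball 0 n \<and> W s y \<ge> \<theta>}"
      proof (rule compact_superlevel[where lo=t1 and B="cball 0 n"])
        have "{t1..t} \<times> cball 0 n \<subseteq> {0<..} \<times> cball (0::'a) n" using t1 by auto
        then show "continuous_on ({t1..t} \<times> cball 0 n) (\<lambda>(s, y). W s y)"
          by (rule continuous_on_subset[OF Wcont])
      next
        fix s y
        show "(0 < s \<and> s \<le> t \<and> y \<in> ball 0 n \<and> W s y \<ge> \<theta>) = (t1 \<le> s \<and> s \<le> t \<and> y \<in> cball 0 n \<and> W s y \<ge> \<theta>)"
        proof (intro iffI conjI; elim conjE)
          assume "0 < s" "y \<in> ball 0 n" "W s y \<ge> \<theta>"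
          then show "t1 \<le> s" using late by (intro less_imp_le) auto
        next
          assume s: "t1 \<le> s" "y \<in> cball 0 n" "W s y \<ge> \<theta>"
          show "0 < s" using s t1 by simp
          have "norm y \<noteq> n"
          proof
            assume "norm y = n"
            from bd[OF \<open>0 < s\<close> this] have "W s y \<le> 0"
              using mult_nonneg_nonneg[OF L0 Z0[of s y]] unfolding W_def by linarith
            then show False using s(3) \<theta> by simp
          qed
          then show "y \<in> ball 0 n" using s(2) by simp
        qed auto
      qed (rule compact_cball)
    qed
    then show ?thesis by (simp add: W_def)
  qed
  have "((\<lambda>\<delta>. L * shell_barrier n \<mu> \<delta> t x) \<longlongrightarrow> L * 0) (at_right 0)"
    by (intro tendsto_intros shell_barrier_tendsto_0 t)
  moreover have "\<forall>\<^sub>F \<delta> in at_right 0. w t x \<le> L * shell_barrier n \<mu> \<delta> t x"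
    using eventually_at_right_less[of "0::real"] by (rule eventually_mono) (rule main)
  ultimately show ?thesis using tendsto_lowerbound[of _ "L * 0" "at_right 0"] by force
qed

section \<open>The radial stationary solutions\<close>

lemma continuous_on_of_derivs:
  fixes V :: "real \<Rightarrow> real"
  assumes "(V has_real_derivative D) (at 0 within {0..})"
    and "\<And>r. r > 0 \<Longrightarrow> V differentiable (at r)"
  shows "continuous_on {0..} V"
proof (rule continuous_on_eq_continuous_within[THEN iffD2], intro ballI)
  fix y :: real assume y: "y \<in> {0..}"
  show "continuous (at y within {0..}) V"
  proof (cases "y = 0")
    case True
    then show ?thesis using DERIV_continuous[OF assms(1)] by simp
  next
    case False
    then show ?thesis using assms(2)[of y] y differentiable_imp_continuous_within[of V y UNIV]
      continuous_at_imp_continuous_at_within by auto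
  qed
qed

text \<open>The difference of the flux \<open>r^m V'\<close> and \<open>c r^(m+1)/(m+1)\<close> is
  nondecreasing, but its limit at 0 is not given, only the one-sided derivative of \<open>V\<close>.
  If it were negative at some \<open>r\<close>, it would be at most \<open>-\<kappa>\<close> at all
  smaller radii. Then \<open>V'\<close> would be at most \<open>-\<kappa>/2\<close> near 0, against
  the zero slope of \<open>V\<close> there.\<close>

lemma radial_slope_lower_bound:
  fixes V f :: "real \<Rightarrow> real"
  assumes V0: "V 0 = a" and d0: "(V has_real_derivative 0) (at 0 within {0..})"
    and V1: "\<And>r. r > 0 \<Longrightarrow> (V has_real_derivative V' r) (at r)"
    and G: "\<And>r. 0 < r \<Longrightarrow> r < \<rho> \<Longrightarrow> ((\<lambda>r. r ^ m * V' r - c * r ^ Suc m / Suc m) has_real_derivative D r) (at r)"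
    and D: "\<And>r. 0 < r \<Longrightarrow> r < \<rho> \<Longrightarrow> D r \<ge> 0"
    and r: "0 < r" "r < \<rho>"
  shows "V' r \<ge> c * r / Suc m"
proof (rule ccontr)
  assume neg: "\<not> V' r \<ge> c * r / Suc m"
  define \<kappa> where "\<kappa> = c * r ^ Suc m / Suc m - r ^ m * V' r"
  have "r ^ m * V' r < r ^ m * (c * r / Suc m)" using neg r by (intro mult_strict_left_mono) auto
  then have \<kappa>: "\<kappa> > 0" by (simp add: \<kappa>_def mult_ac)
  have G_le: "s ^ m * V' s \<le> c * s ^ Suc m / Suc m - \<kappa>" if "0 < s" "s \<le> r" for s
  proof -
    have "s ^ m * V' s - c * s ^ Suc m / Suc m \<le> r ^ m * V' r - c * r ^ Suc m / Suc m"
      by (rule DERIV_nonneg_imp_nondecreasing[OF that(2)]) (use G D r that in \<open>meson less_le_trans le_less_trans\<close>)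
    then show ?thesis by (simp add: \<kappa>_def)
  qed
  \<comment> \<open>Up to \<open>s1\<close> the term \<open>c s^(m+1)/(m+1)\<close> is at most
    \<open>\<kappa>/2\<close> and \<open>s^m \<le> 1\<close>; the \<open>+ 1\<close> covers
    \<open>c = 0\<close>.\<close>
  define s1 where "s1 = min r (min 1 (\<kappa> / (2 * (\<bar>c\<bar> + 1))))"
  have s1: "s1 > 0" "s1 \<le> r" "s1 \<le> 1" "s1 \<le> \<kappa> / (2 * (\<bar>c\<bar> + 1))" using r \<kappa> by (auto simp: s1_def)
  have slope: "V' s \<le> - (\<kappa> / 2)" if s: "0 < s" "s \<le> s1" for s
  proof -
    have "c * s ^ Suc m / Suc m \<le> \<bar>c\<bar> * s"
    proof -
      have "c * s ^ Suc m / Suc m \<le> \<bar>c\<bar> * s ^ Suc m / Suc m"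
        using s by (intro divide_right_mono mult_right_mono) auto
      also have "\<dots> \<le> \<bar>c\<bar> * s ^ Suc m / 1"
        using s by (intro divide_left_mono) auto
      also have "s ^ Suc m \<le> s ^ 1" using s s1 by (intro power_decreasing) auto
      finally show ?thesis using s by (simp add: mult_left_mono)
    qed
    also have "\<bar>c\<bar> * s \<le> (\<bar>c\<bar> + 1) * (\<kappa> / (2 * (\<bar>c\<bar> + 1)))"
      using s s1 by (intro mult_mono) auto
    also have "\<dots> = \<kappa> / 2" by (simp add: field_simps)
    finally have "s ^ m * V' s \<le> - (\<kappa> / 2)" using G_le[of s] s s1 by linarith
    moreover have "s ^ m * (\<kappa> / 2) \<le> 1 * (\<kappa> / 2)"
      using s s1 \<kappa> by (intro mult_right_mono power_le_one) auto
    ultimately have "s ^ m * V' s \<le> s ^ m * (- (\<kappa> / 2))" by simp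
    then show ?thesis by (rule mult_left_le_imp_le) (use s in simp)
  qed
  have lin: "V s \<le> V 0 - \<kappa> / 2 * s" if s: "0 < s" "s \<le> s1" for s
  proof -
    have "V differentiable (at r)" if "r > 0" for r using V1[OF that] real_differentiable_def by blast
    then have cont: "continuous_on {0..s} V"
      by (intro continuous_on_subset[OF continuous_on_of_derivs[OF d0]]) auto
    obtain l z where z: "0 < z" "z < s" "DERIV V z :> l" "V s - V 0 = (s - 0) * l"
      using MVT[OF s(1) cont] V1 real_differentiable_def by blast
    have "l = V' z" using DERIV_unique[OF z(3) V1[OF z(1)]] .
    then show ?thesis using z slope[of z] s mult_left_mono[of "V' z" "- (\<kappa> / 2)" s] by (simp add: mult.commute)
  qed
  have "((\<lambda>s. (V s - V 0) / (s - 0)) \<longlongrightarrow> 0) (at 0 within {0..})"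
    using d0 by (simp add: has_field_derivative_iff)
  moreover have sub: "{0<..} \<subseteq> {0::real..}" by auto
  ultimately have "((\<lambda>s. (V s - V 0) / (s - 0)) \<longlongrightarrow> 0) (at_right 0)"
    by (rule tendsto_within_subset)
  then have "((\<lambda>s. (V s - V 0) / s) \<longlongrightarrow> 0) (at_right 0)" by simp
  moreover have "\<forall>\<^sub>F s in at_right 0. (V s - V 0) / s \<le> - (\<kappa> / 2)"
    unfolding eventually_at_right_field
    by (intro exI[of _ s1] conjI s1 allI impI) (use lin in \<open>auto simp: divide_le_eq mult.commute algebra_simps\<close>)
  ultimately have "0 \<le> - (\<kappa> / 2)" by (intro tendsto_upperbound[of _ 0 "at_right (0::real)"]) auto
  then show False using \<kappa> by simp
qed

text \<open>\<open>m\<close> is the dimension minus one, the exponent of the radial weight.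
  \<open>h\<close> is controlled only on nonnegative arguments, so the sign of \<open>V h(V)\<close>
  is known only while \<open>V\<close> is nonnegative.\<close>

locale radial =
  fixes h :: "real \<Rightarrow> real" and m :: nat and a :: real and V :: "real \<Rightarrow> real"
  assumes sol: "radial_sol h (Suc m) a V" and a_pos: "a > 0"
    and h_cont: "continuous_on {0..} h" and h_nonneg: "\<And>s. s \<ge> 0 \<Longrightarrow> h s \<ge> 0"
begin

lemma V0: "V 0 = a" using sol by (simp add: radial_sol_def)

lemma V0': "(V has_real_derivative 0) (at 0 within {0..})" using sol by (simp add: radial_sol_def)

lemma V1: "r > 0 \<Longrightarrow> (V has_real_derivative deriv V r) (at r)"
  using sol by (simp add: radial_sol_def DERIV_deriv_iff_real_differentiable)

lemma V2: "r > 0 \<Longrightarrow> (deriv V has_real_derivative (V r * h (V r) - real m / r * deriv V r)) (at r)"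
  using sol by (auto simp: radial_sol_def)

lemma V_cont: "continuous_on {0..} V"
  by (rule continuous_on_of_derivs[OF V0']) (use sol in \<open>auto simp: radial_sol_def\<close>)

lemma flux_deriv:
  assumes r: "r > 0"
  shows "((\<lambda>r. r ^ m * deriv V r - c * r ^ Suc m / Suc m) has_real_derivative r ^ m * (V r * h (V r) - c)) (at r)"
proof -
  have 1: "((\<lambda>r. r ^ m) has_real_derivative real m * r ^ m / r) (at r)"
    using DERIV_pow[of m r UNIV] r by (cases m) auto
  have 2: "((\<lambda>r. c * r ^ Suc m / Suc m) has_real_derivative c * r ^ m) (at r)"
    by (rule DERIV_cong[OF DERIV_cdivide[OF DERIV_cmult[OF DERIV_pow]]]) simp
  show ?thesis
    by (rule DERIV_cong[OF DERIV_diff[OF DERIV_mult[OF 1 V2[OF r]] 2]]) (use r in \<open>simp add: field_simps\<close>)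
qed

lemma slope_nonneg:
  assumes pos: "\<And>s. 0 < s \<Longrightarrow> s < \<rho> \<Longrightarrow> V s > 0" and r: "0 < r" "r < \<rho>"
  shows "deriv V r \<ge> 0"
  using radial_slope_lower_bound[of V a "deriv V" \<rho> m 0 "\<lambda>r. r ^ m * (V r * h (V r) - 0)" r]
    V0 V0' V1 flux_deriv[of _ 0] pos r h_nonneg by (auto simp: less_imp_le)

lemma nondecreasing_upto:
  assumes pos: "\<And>s. 0 < s \<Longrightarrow> s < \<rho> \<Longrightarrow> V s > 0" and r: "0 \<le> r" "r \<le> s" "s \<le> \<rho>"
  shows "V r \<le> V s"
proof (rule DERIV_nonneg_imp_increasing_open[OF r(2)])
  fix x assume "r < x" "x < s"
  then show "\<exists>y. DERIV V x :> y \<and> 0 \<le> y" using V1[of x] slope_nonneg[of \<rho> x] pos r by auto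
qed (use r in \<open>auto intro: continuous_on_subset[OF V_cont]\<close>)

text \<open>Monotonicity is available only as long as \<open>V\<close> is positive. At the first
  point \<open>\<rho>\<close> with \<open>V \<le> 0\<close>, monotonicity on
  \<open>[0, \<rho>]\<close> would give \<open>V(\<rho>) \<ge> a > 0\<close>.\<close>

lemma V_pos: assumes "r \<ge> 0" shows "V r > 0"
proof (rule ccontr)
  assume "\<not> V r > 0"
  define S where "S = {0..r} \<inter> V -` {..0}"
  have "closed S" unfolding S_def
    by (intro continuous_closed_preimage) (auto intro: continuous_on_subset[OF V_cont])
  then have "compact ({0..r} \<inter> S)" by (intro compact_Int_closed compact_Icc)
  moreover have "{0..r} \<inter> S = S" unfolding S_def by blast
  ultimately have "compact S" by simp
  moreover have "r \<in> S" using \<open>\<not> V r > 0\<close> assms by (simp add: S_def)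
  ultimately have "\<exists>\<rho>\<in>S. \<forall>s\<in>S. \<rho> \<le> s" by (intro compact_attains_inf) auto
  then obtain \<rho> where \<rho>: "\<rho> \<in> S" "\<And>s. s \<in> S \<Longrightarrow> \<rho> \<le> s" by blast
  have "V s > 0" if "0 < s" "s < \<rho>" for s
    using \<rho>(2)[of s] that \<rho>(1) by (force simp: S_def)
  then have "V 0 \<le> V \<rho>" using \<rho>(1) by (intro nondecreasing_upto[of \<rho>]) (auto simp: S_def)
  then show False using \<rho>(1) a_pos V0 by (simp add: S_def)
qed

lemma V_mono: "0 \<le> r \<Longrightarrow> r \<le> s \<Longrightarrow> V r \<le> V s"
  by (rule nondecreasing_upto[of s]) (auto simp: V_pos)

lemma V_ge: "0 \<le> r \<Longrightarrow> a \<le> V r"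
  using V_mono[of 0 r] V0 by simp

lemma f_V_cont: "continuous_on {0..} (\<lambda>r. V r * h (V r))"
  by (intro continuous_intros V_cont continuous_on_compose2[OF h_cont V_cont]) (auto simp: V_pos less_imp_le)

text \<open>This replaces the second derivative at 0, where the equation is singular. For small
  \<open>r\<close> the function \<open>V h(V)\<close> lies within \<open>e/2\<close> of
  \<open>a h(a)\<close>, and the slope bound applied to \<open>V\<close> and to \<open>- V\<close>
  encloses \<open>V'(r)/r\<close>.\<close>

lemma slope_limit: "((\<lambda>r. deriv V r / r) \<longlongrightarrow> a * h a / real (Suc m)) (at_right 0)"
proof (rule tendstoI)
  fix e :: real assume e: "e > 0"
  define c where "c = a * h a"
  have "((\<lambda>r. V r * h (V r)) \<longlongrightarrow> V 0 * h (V 0)) (at 0 within {0..})"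
    using f_V_cont by (simp add: continuous_on_def)
  then have "((\<lambda>r. V r * h (V r)) \<longlongrightarrow> c) (at_right 0)"
    unfolding c_def V0 by (rule tendsto_within_subset) auto
  then have "\<forall>\<^sub>F r in at_right 0. dist (V r * h (V r)) c < e / 2"
    by (rule tendstoD) (use e in simp)
  then obtain \<rho> where \<rho>: "\<rho> > 0" "\<And>r. 0 < r \<Longrightarrow> r < \<rho> \<Longrightarrow> \<bar>V r * h (V r) - c\<bar> < e / 2"
    unfolding eventually_at_right_field dist_real_def by blast
  have "dist (deriv V r / r) (c / real (Suc m)) < e" if r: "0 < r" "r < \<rho>" for r
  proof -
    have lower: "deriv V r \<ge> (c - e / 2) * r / Suc m"
    proof (rule radial_slope_lower_bound[OF V0 V0' V1 flux_deriv _ r])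
      fix s assume "0 < s" "s < \<rho>"
      then show "0 \<le> s ^ m * (V s * h (V s) - (c - e / 2))" using \<rho>(2)[of s] abs_less_iff[of "V s * h (V s) - c" "e / 2"]
        by (intro mult_nonneg_nonneg) simp_all
    qed auto
    have upper: "- deriv V r \<ge> - (c + e / 2) * r / Suc m"
    proof (rule radial_slope_lower_bound[where V="\<lambda>r. - V r" and a="- a" and V'="\<lambda>r. - deriv V r"
          and D="\<lambda>s. - (s ^ m * (V s * h (V s) - (c + e / 2)))", OF _ _ _ _ _ r])
      fix s assume s: "0 < s" "s < \<rho>"
      have "((\<lambda>r. - (r ^ m * deriv V r - (c + e / 2) * r ^ Suc m / Suc m)) has_real_derivative
          - (s ^ m * (V s * h (V s) - (c + e / 2)))) (at s)"
        by (intro DERIV_minus flux_deriv s)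
      then show "((\<lambda>r. r ^ m * - deriv V r - - (c + e / 2) * r ^ Suc m / Suc m) has_real_derivative
          - (s ^ m * (V s * h (V s) - (c + e / 2)))) (at s)"
        by (rule has_field_derivative_transform_within_open[of _ _ _ UNIV])
           (simp_all add: field_simps del: of_nat_Suc power_Suc)
      have "V s * h (V s) - (c + e / 2) \<le> 0" using \<rho>(2)[OF s] by linarith
      then show "0 \<le> - (s ^ m * (V s * h (V s) - (c + e / 2)))"
        using s by (simp add: mult_nonneg_nonpos)
    qed (use V0 DERIV_minus[OF V0'] V1 in \<open>auto intro: DERIV_minus\<close>)
    have "(c - e / 2) / Suc m \<le> deriv V r / r" "deriv V r / r \<le> (c + e / 2) / Suc m"
      using lower upper r
      by (simp_all add: pos_le_divide_eq pos_divide_le_eq left_diff_distrib distrib_right del: of_nat_Suc)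
    then have "\<bar>deriv V r / r - c / Suc m\<bar> \<le> e / 2 / Suc m"
      by (simp add: abs_le_iff diff_divide_distrib add_divide_distrib del: of_nat_Suc)
    also have "\<dots> \<le> e / 2 / 1" using e by (intro divide_left_mono) auto
    finally show ?thesis using e by (simp add: dist_real_def)
  qed
  then show "\<forall>\<^sub>F r in at_right 0. dist (deriv V r / r) (a * h a / real (Suc m)) < e"
    unfolding eventually_at_right_field c_def using \<rho>(1) by blast
qed

text \<open>Away from the origin this is the chain rule. At the origin only line derivatives are
  demanded: the first ones vanish because \<open>V\<close> has slope 0, and the second ones all
  equal the limit of \<open>V'(r)/r\<close>, so that their sum over \<open>N\<close> directions is
  \<open>a h(a)\<close>.\<close>

lemma heat_smooth_radial:
  assumes "DIM('a) = Suc m"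
  shows "heat_smooth (\<Omega> :: 'a::euclidean_space set) (\<lambda>t x. V (norm x)) (\<lambda>t x. - (V (norm x) * h (V (norm x))))"
proof -
  define V'' where "V'' = (\<lambda>r. V r * h (V r) - real m / r * deriv V r)"
  define vb where "vb = (\<lambda>b (t::real) (x::'a). if x = 0 then 0 else deriv V (norm x) * ((x \<bullet> b) / norm x))"
  define vbb where "vbb = (\<lambda>b (t::real) (x::'a). if x = 0 then a * h a / real (Suc m)
      else V'' (norm x) * ((x \<bullet> b) / norm x)\<^sup>2 + deriv V (norm x) * (1 / norm x - (x \<bullet> b)\<^sup>2 / norm x ^ 3))"
  have norm_line: "((\<lambda>s. norm (x + s *\<^sub>R b)) has_real_derivative (x \<bullet> b) / norm x) (at 0)" if "x \<noteq> 0" for x b :: 'a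
  proof -
    have "((\<lambda>s. x + s *\<^sub>R b) has_derivative (\<lambda>h. h *\<^sub>R b)) (at 0)"
      by (auto intro!: derivative_eq_intros)
    from has_derivative_compose[OF this has_derivative_norm] that
    have "((\<lambda>s. norm (x + s *\<^sub>R b)) has_derivative (\<lambda>h. inner (h *\<^sub>R b) (sgn x))) (at 0)" by simp
    then show ?thesis unfolding has_field_derivative_def
      by (rule has_derivative_eq_rhs) (auto simp: sgn_div_norm inner_commute divide_inverse)
  qed
  have abs_at_0: "filterlim abs (at_right 0) (at (0::real))"
    unfolding filterlim_at using tendsto_rabs_zero[OF tendsto_ident_at[of "0::real" UNIV]]
    by (auto simp: eventually_at_filter)
  have abs_lim: "((\<lambda>s. F \<bar>s\<bar>) \<longlongrightarrow> L) (at 0)" if "(F \<longlongrightarrow> L) (at_right 0)" for F :: "real \<Rightarrow> real" and L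
    using filterlim_compose[OF that abs_at_0] .
  show ?thesis
  proof (rule heat_smoothI[where vt="\<lambda>_ _. 0" and vb=vb and vbb=vbb])
    show "continuous_on ({0<..} \<times> \<Omega>) (\<lambda>(t, x). V (norm x))"
      unfolding case_prod_beta by (intro continuous_on_compose2[OF V_cont] continuous_intros) auto
  next
    fix t :: real and x b :: 'a assume b: "b \<in> Basis"
    show "((\<lambda>s. V (norm (x + s *\<^sub>R b))) has_real_derivative vb b t x) (at 0)"
    proof (cases "x = 0")
      case False
      then show ?thesis using DERIV_chain2[of V _ "\<lambda>s. norm (x + s *\<^sub>R b)" 0, OF _ norm_line[OF False]] V1[of "norm x"]
        by (simp add: vb_def)
    next
      case True
      have "((\<lambda>s. (V s - V 0) / (s - 0)) \<longlongrightarrow> 0) (at 0 within {0..})"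
        using V0' by (simp add: has_field_derivative_iff)
      moreover have sub: "{0<..} \<subseteq> {0::real..}" by auto
      ultimately have "((\<lambda>s. (V s - V 0) / (s - 0)) \<longlongrightarrow> 0) (at_right 0)"
        by (rule tendsto_within_subset)
      then have "((\<lambda>s. (V s - V 0) / s) \<longlongrightarrow> 0) (at_right 0)" by simp
      from tendsto_rabs_zero[OF abs_lim[OF this]]
      have "((\<lambda>s. \<bar>(V \<bar>s\<bar> - V 0) / s\<bar>) \<longlongrightarrow> 0) (at 0)" by (simp add: abs_divide)
      from tendsto_rabs_zero_cancel[OF this]
      show ?thesis using True b by (simp add: vb_def DERIV_def)
    qed
    show "((\<lambda>s. vb b t (x + s *\<^sub>R b)) has_real_derivative vbb b t x) (at 0)"
    proof (cases "x = 0")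
      case False
      have 1: "((\<lambda>s. deriv V (norm (x + s *\<^sub>R b))) has_real_derivative V'' (norm x) * ((x \<bullet> b) / norm x)) (at 0)"
        using DERIV_chain2[of "deriv V" _ "\<lambda>s. norm (x + s *\<^sub>R b)" 0, OF _ norm_line[OF False]] V2[of "norm x"] False
        by (simp add: V''_def)
      have 2: "((\<lambda>s. (x + s *\<^sub>R b) \<bullet> b) has_real_derivative 1) (at 0)"
        unfolding has_field_derivative_def using b by (auto intro!: derivative_eq_intros)
      have 3: "((\<lambda>s. ((x + s *\<^sub>R b) \<bullet> b) / norm (x + s *\<^sub>R b)) has_real_derivative
          (1 / norm x - (x \<bullet> b)\<^sup>2 / norm x ^ 3)) (at 0)"
        by (rule DERIV_cong[OF DERIV_divide[OF 2 norm_line[OF False]]])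
           (use False in \<open>simp_all add: power2_eq_square power3_eq_cube diff_divide_distrib\<close>)
      have 4: "((\<lambda>s. deriv V (norm (x + s *\<^sub>R b)) * (((x + s *\<^sub>R b) \<bullet> b) / norm (x + s *\<^sub>R b))) has_real_derivative vbb b t x) (at 0)"
        by (rule DERIV_cong[OF DERIV_mult[OF 1 3]]) (use False in \<open>simp add: vbb_def power2_eq_square\<close>)
      have "open {s. x + s *\<^sub>R b \<noteq> 0}"
        by (intro open_Collect_neq continuous_intros)
      from has_field_derivative_transform_within_open[OF 4 this]
      show ?thesis using False by (simp add: vb_def)
    next
      case True
      \<comment> \<open>Along a basis vector \<open>vb\<close> equals \<open>V'(|s|) s/|s|\<close>,
        so its difference quotient at 0 is the even function \<open>V'(|s|)/|s|\<close>.\<close>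
      have "((\<lambda>s. deriv V \<bar>s\<bar> / \<bar>s\<bar>) \<longlongrightarrow> a * h a / real (Suc m)) (at 0)"
        by (rule abs_lim[OF slope_limit])
      then have "((\<lambda>s. vb b t (0 + s *\<^sub>R b) / s) \<longlongrightarrow> a * h a / real (Suc m)) (at 0)"
        by (rule Lim_transform_eventually) (use b in \<open>auto simp: eventually_at_filter vb_def intro!: always_eventually\<close>)
      moreover have "vb b t 0 = 0" by (simp add: vb_def)
      ultimately show ?thesis using True by (simp add: DERIV_def vbb_def)
    qed
  next
    fix t :: real and x :: 'a
    show "- (V (norm x) * h (V (norm x))) = 0 - (\<Sum>b\<in>Basis. vbb b t x)"
    proof (cases "x = 0")
      case True
      then show ?thesis using assms by (simp add: vbb_def V0)
    next
      case False
      define r where "r = norm x"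
      have r: "r > 0" using False by (simp add: r_def)
      have s: "(\<Sum>b\<in>Basis. (x \<bullet> b)\<^sup>2) = r\<^sup>2"
        unfolding r_def dot_square_norm[symmetric] euclidean_inner[of x x] by (simp add: power2_eq_square)
      have "(\<Sum>b\<in>Basis. vbb b t x) = (\<Sum>b\<in>(Basis::'a set). (V'' r / r\<^sup>2 - deriv V r / r ^ 3) * (x \<bullet> b)\<^sup>2 + deriv V r / r)"
        using False by (intro sum.cong) (auto simp: vbb_def r_def power_divide algebra_simps)
      also have "\<dots> = (V'' r / r\<^sup>2 - deriv V r / r ^ 3) * r\<^sup>2 + real (Suc m) * (deriv V r / r)"
        unfolding sum.distrib sum_distrib_left[symmetric] s using assms by simp
      also have "\<dots> = V'' r + real m * (deriv V r / r)"
        using r by (simp add: field_simps power2_eq_square power3_eq_cube)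
      also have "\<dots> = V r * h (V r)" by (simp add: V''_def)
      finally show ?thesis by (simp add: r_def)
    qed
  qed auto
qed

end

section \<open>The flat solution with infinite initial value\<close>

text \<open>A box \<open>[a, y]\<close> with \<open>a\<close> below both \<open>- B\<close> and
  \<open>c\<close> meets the half-line exactly in \<open>[c, y]\<close>, so the box criterion for
  integrals over unbounded sets becomes an ordinary limit.\<close>

lemma improper_integral_tendsto:
  fixes F :: "real \<Rightarrow> real"
  assumes "(F has_integral I) {c..}"
  shows "((\<lambda>y. integral {c..y} F) \<longlongrightarrow> I) at_top"
proof (rule tendstoI)
  fix e :: real assume e: "e > 0"
  then obtain B where B: "B > 0" "\<And>a b. ball 0 B \<subseteq> cbox a b \<Longrightarrow>
      (\<exists>z. ((\<lambda>x. if x \<in> {c..} then F x else 0) has_integral z) (cbox a b) \<and> norm (z - I) < e)"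
    using assms unfolding has_integral'[of F I "{c..}"] by blast
  have "dist (integral {c..y} F) I < e" if y: "y \<ge> max B c" for y
  proof -
    define a where "a = min (- B) c"
    have "ball 0 B \<subseteq> cbox a y" using y by (auto simp: a_def dist_real_def)
    then obtain z where z: "((\<lambda>x. if x \<in> {c..} then F x else 0) has_integral z) (cbox a y)" "norm (z - I) < e"
      using B(2) by blast
    have "z = integral (cbox a y \<inter> {c..}) F"
      using integral_unique[OF z(1)] by (simp only: integral_restrict_Int Int_commute)
    also have "cbox a y \<inter> {c..} = {c..y}" by (auto simp: a_def)
    finally have "z = integral {c..y} F" .
    then show ?thesis using z(2) by (simp add: dist_norm)
  qed
  then show "\<forall>\<^sub>F y in at_top. dist (integral {c..y} F) I < e"
    using eventually_ge_at_top[of "max B c"] by (auto elim: eventually_mono)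
qed

text \<open>The spatially constant solution with infinite initial value, obtained by inverting
  \<open>y \<mapsto> \<integral>\<^sub>y\<^sup>\<infinity> ds / (s h(s))\<close>.\<close>

lemma flat_solution_infinite_initial_value:
  fixes h :: "real \<Rightarrow> real"
  assumes h_cont: "continuous_on {0..} h" and h_mono: "mono_on {0..} h"
    and h_pos: "\<And>s. s > 0 \<Longrightarrow> h s > 0"
    and h_int: "\<exists>c>0. (\<lambda>s. 1 / (s * h s)) integrable_on {c..}"
  obtains \<phi> where "\<And>t. t > 0 \<Longrightarrow> \<phi> t > 0"
    and "\<And>t. t > 0 \<Longrightarrow> (\<phi> has_real_derivative - (\<phi> t * h (\<phi> t))) (at t)"
    and "\<And>M. \<exists>t0>0. \<forall>t. 0 < t \<and> t < t0 \<longrightarrow> \<phi> t > M"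
proof -
  define F where "F = (\<lambda>s. 1 / (s * h s))"
  obtain c where c: "c > 0" "F integrable_on {c..}" using h_int unfolding F_def by blast
  define I where "I = integral {c..} F"
  have FI: "(F has_integral I) {c..}" unfolding I_def using c(2) by blast
  have F_cont: "continuous_on A F" if A: "A \<subseteq> {0<..}" for A
  proof -
    have "continuous_on A h" by (rule continuous_on_subset[OF h_cont]) (use A in auto)
    then show ?thesis unfolding F_def using A h_pos by (intro continuous_intros) (auto simp: less_imp_neq[symmetric] subset_iff)
  qed
  have F_pos: "F s > 0" if "s > 0" for s using that h_pos[OF that] by (simp add: F_def)
  \<comment> \<open>The integral of \<open>F\<close> from \<open>y\<close> to infinity, for
    \<open>y\<close> on either side of \<open>c\<close>: an integral over a reversed interval is 0,
    so at least one of the last two terms vanishes.\<close>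
  define T where "T = (\<lambda>y. I - (integral {c..y} F - integral {y..c} F))"
  have T': "(T has_real_derivative - F y) (at y)" if y: "y > 0" for y
  proof -
    define y0 where "y0 = min c y / 2"
    have y0: "0 < y0" "y0 < c" "y0 < y" using c(1) y by (auto simp: y0_def)
    have int: "F integrable_on {r..s}" if "y0 \<le> r" for r s
      by (intro integrable_continuous_real F_cont) (use that y0 in auto)
    have eq: "I - (integral {y0..z} F - integral {y0..c} F) = T z" if z: "z > y0" for z
    proof (cases "z \<le> c")
      case True
      have "integral {y0..z} F + integral {z..c} F = integral {y0..c} F"
        by (rule Henstock_Kurzweil_Integration.integral_combine) (use z True int in auto)
      moreover have "integral {c..z} F = 0" using True by (cases "c = z") auto
      ultimately show ?thesis by (simp add: T_def)
    next
      case False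
      have "integral {y0..c} F + integral {c..z} F = integral {y0..z} F"
        by (rule Henstock_Kurzweil_Integration.integral_combine) (use y0 False int in auto)
      moreover have "integral {z..c} F = 0" using False by auto
      ultimately show ?thesis by (simp add: T_def)
    qed
    have "((\<lambda>z. integral {y0..z} F) has_real_derivative F y) (at y within {y0..y + 1})"
      by (rule integral_has_real_derivative) (use y0 in \<open>auto intro!: F_cont\<close>)
    then have "((\<lambda>z. integral {y0..z} F) has_real_derivative F y) (at y)"
      using y0 by (simp add: at_within_Icc_at)
    then have "((\<lambda>z. I - (integral {y0..z} F - integral {y0..c} F)) has_real_derivative - F y) (at y)"
      by (auto intro!: derivative_eq_intros)
    then show ?thesis
      by (rule has_field_derivative_transform_within_open[where S="{y0<..}"]) (use y0 eq in auto)
  qed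
  have T_dec: "T y2 < T y1" if "0 < y1" "y1 < y2" for y1 y2
  proof (rule DERIV_neg_imp_decreasing[OF that(2)])
    fix x assume "y1 \<le> x"
    then have "x > 0" using that by simp
    then show "\<exists>D. DERIV T x :> D \<and> D < 0" using T' F_pos by (intro exI[of _ "- F x"]) auto
  qed
  have T_lim: "(T \<longlongrightarrow> 0) at_top"
  proof -
    have "((\<lambda>y. I - (integral {c..y} F - 0)) \<longlongrightarrow> I - (I - 0)) at_top"
      by (intro tendsto_intros improper_integral_tendsto FI)
    moreover have "\<forall>\<^sub>F y in at_top. I - (integral {c..y} F - 0) = T y"
      using eventually_gt_at_top[of c] by eventually_elim (simp add: T_def)
    ultimately show ?thesis using Lim_transform_eventually by force
  qed
  have T_pos: "T y > 0" if y: "y > 0" for y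
  proof -
    have "\<forall>\<^sub>F z in at_top. T z \<le> T (y + 1)"
      using eventually_gt_at_top[of "y + 1"] by eventually_elim (use T_dec y in \<open>auto intro: less_imp_le\<close>)
    then have "0 \<le> T (y + 1)" by (intro tendsto_upperbound[OF T_lim]) auto
    then show ?thesis using T_dec[of y "y + 1"] y by simp
  qed
  have T_large: "\<exists>y>0. T y > t" for t
  proof -
    define K where "K = h c"
    have K: "K > 0" using h_pos c(1) by (simp add: K_def)
    \<comment> \<open>For \<open>s \<le> c\<close> monotonicity of \<open>h\<close> gives
      \<open>F s \<ge> 1/(K s)\<close>, so \<open>T y + ln y / K\<close> is nonincreasing on
      \<open>(0, c]\<close>. The exponent makes \<open>ln y\<close> so small that
      \<open>T y \<ge> t + 1\<close>.\<close>
    define y where "y = min c (exp (K * (T c + ln c / K - t - 1)))"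
    have y: "0 < y" "y \<le> c" using c(1) by (auto simp: y_def)
    have "T c + ln c / K \<le> T y + ln y / K"
    proof (rule DERIV_nonpos_imp_nonincreasing[OF y(2)])
      fix x assume x: "y \<le> x" "x \<le> c"
      then have x0: "x > 0" using y by simp
      have "((\<lambda>y. T y + ln y / K) has_real_derivative - F x + 1 / x / K) (at x)"
        using x0 by (intro DERIV_add T' DERIV_cdivide) (auto intro!: derivative_eq_intros)
      moreover have "- F x + 1 / x / K \<le> 0"
      proof -
        have "h x \<le> K" unfolding K_def using x0 x by (intro mono_onD[OF h_mono]) auto
        then have "1 / (x * K) \<le> F x" unfolding F_def using x0 h_pos[OF x0] by (intro divide_left_mono) auto
        then show ?thesis by simp
      qed
      ultimately show "\<exists>D. DERIV (\<lambda>y. T y + ln y / K) x :> D \<and> D \<le> 0" by blast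
    qed
    moreover have "ln y \<le> K * (T c + ln c / K - t - 1)"
    proof -
      have "ln y \<le> ln (exp (K * (T c + ln c / K - t - 1)))" using y by (subst ln_le_cancel_iff) (auto simp: y_def)
      then show ?thesis by simp
    qed
    then have "ln y / K \<le> T c + ln c / K - t - 1" using K by (simp add: pos_divide_le_eq mult.commute)
    ultimately show ?thesis using y by (intro exI[of _ y]) auto
  qed
  have T_cont: "isCont T y" if "y > 0" for y using DERIV_isCont[OF T'[OF that]] .
  have T_surj: "\<exists>y>0. T y = t" if t: "t > 0" for t
  proof -
    obtain y1 where y1: "y1 > 0" "T y1 > t" using T_large by blast
    obtain y2 where y2: "T y2 < t" "y2 > y1"
      using eventually_conj[OF order_tendstoD(2)[OF T_lim t] eventually_gt_at_top[of y1]]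
      by (auto simp: eventually_at_top_linorder)
    have "\<exists>y\<ge>y1. y \<le> y2 \<and> T y = t" using y1 y2 T_cont by (intro IVT2) auto
    then obtain y where "y1 \<le> y" "T y = t" by blast
    then show ?thesis using y1(1) by (intro exI[of _ y]) simp
  qed
  define \<phi> where "\<phi> = (\<lambda>t. SOME y. y > 0 \<and> T y = t)"
  have \<phi>: "\<phi> t > 0" "T (\<phi> t) = t" if "t > 0" for t
    using someI_ex[of "\<lambda>y. y > 0 \<and> T y = t"] T_surj[OF that] unfolding \<phi>_def by auto
  have \<phi>T: "\<phi> (T y) = y" if "y > 0" for y
    using \<phi>[OF T_pos[OF that]] T_dec[of y "\<phi> (T y)"] T_dec[of "\<phi> (T y)" y] that
    by (cases y "\<phi> (T y)" rule: linorder_cases) auto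
  have "(\<phi> has_real_derivative - (\<phi> t * h (\<phi> t))) (at t)" if t: "t > 0" for t
  proof -
    \<comment> \<open>The inverse is continuous because \<open>T\<close> is continuous and inverted
      by \<open>\<phi>\<close> on \<open>[\<phi> t/2, 2 \<phi> t]\<close>. Then
      \<open>\<phi>' = 1/T'(\<phi>) = - 1/F(\<phi>)\<close>, which is the differential
      equation.\<close>
    have "isCont \<phi> (T (\<phi> t))"
      by (rule isCont_inverse_function2[of "\<phi> t / 2" _ "\<phi> t * 2"]) (use \<phi>[OF t] \<phi>T T_cont in auto)
    then have "isCont \<phi> t" by (simp add: \<phi>[OF t])
    then have "(\<phi> has_real_derivative inverse (- F (\<phi> t))) (at t)"
      using F_pos[OF \<phi>(1)[OF t]] t \<phi> by (intro DERIV_inverse_function[OF T', of \<phi> t 0 "t + 1"]) auto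
    then show ?thesis by (simp add: F_def)
  qed
  moreover have "\<exists>t0>0. \<forall>t. 0 < t \<and> t < t0 \<longrightarrow> \<phi> t > M" for M
  proof (intro exI[of _ "T (max M 1)"] conjI allI impI)
    fix t assume t: "0 < t \<and> t < T (max M 1)"
    show "\<phi> t > M"
    proof (rule ccontr)
      assume "\<not> \<phi> t > M"
      then have "\<phi> t \<le> max M 1" by simp
      then have "T (max M 1) \<le> T (\<phi> t)" using T_dec[of "\<phi> t" "max M 1"] \<phi>(1)[of t] t
        by (cases "\<phi> t = max M 1") auto
      then show False using \<phi>(2)[of t] t by simp
    qed
  qed (auto intro: T_pos)
  ultimately show thesis using that \<phi>(1) by blast
qed

text \<open>Since \<open>f(0) = 0\<close>, convexity puts \<open>f(x)\<close> and
  \<open>f(y)\<close> below the chord from the origin to the point at \<open>x + y\<close>; the two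
  chord values add up to \<open>f(x + y)\<close>.\<close>

lemma convex_superadditive:
  fixes f :: "real \<Rightarrow> real"
  assumes "convex_on {0..} f" "f 0 = 0" "0 \<le> x" "0 \<le> y"
  shows "f x + f y \<le> f (x + y)"
proof (cases "x + y = 0")
  case True
  then have "x = 0" "y = 0" using assms by auto
  then show ?thesis using assms by auto
next
  case False
  then have s: "x + y > 0" using assms by auto
  have *: "f z \<le> z / (x + y) * f (x + y)" if "0 \<le> z" "z \<le> x + y" for z
    using convex_onD[OF assms(1), of "z / (x + y)" 0 "x + y"] that s assms by simp
  have "f x + f y \<le> x / (x + y) * f (x + y) + y / (x + y) * f (x + y)"
    using *[of x] *[of y] assms by (intro add_mono) auto
  also have "\<dots> = f (x + y)" using s by (simp add: add_divide_distrib[symmetric] distrib_right[symmetric])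
  finally show ?thesis .
qed

section \<open>Interior equicontinuity\<close>

lemma heat_smooth_paraboloid:
  fixes x0 :: "'a::euclidean_space"
  shows "heat_smooth \<Omega> (\<lambda>t x. A - C * ((x - x0) \<bullet> (x - x0)) - K * t) (\<lambda>t x. - K + 2 * real DIM('a) * C)"
proof (rule heat_smoothI[where vt="\<lambda>_ _. - K" and vb="\<lambda>b t x. - 2 * C * ((x - x0) \<bullet> b)" and vbb="\<lambda>b t x. - 2 * C"])
  show "continuous_on ({0<..} \<times> \<Omega>) (\<lambda>(t, x). A - C * ((x - x0) \<bullet> (x - x0)) - K * t)"
    unfolding case_prod_beta by (intro continuous_intros)
next
  fix t :: real and x :: 'a
  show "((\<lambda>s. A - C * ((x - x0) \<bullet> (x - x0)) - K * s) has_real_derivative - K) (at t)"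
    by (auto intro!: derivative_eq_intros)
next
  fix t :: real and x b :: 'a assume b: "b \<in> Basis"
  have "((\<lambda>s. (x + s *\<^sub>R b - x0) \<bullet> (x + s *\<^sub>R b - x0)) has_real_derivative 2 * ((x - x0) \<bullet> b)) (at 0)"
    unfolding has_field_derivative_def
    by (auto intro!: derivative_eq_intros simp: inner_commute algebra_simps)
  from DERIV_diff[OF DERIV_diff[OF DERIV_const DERIV_cmult[OF this, of C]] DERIV_const]
  show "((\<lambda>s. A - C * ((x + s *\<^sub>R b - x0) \<bullet> (x + s *\<^sub>R b - x0)) - K * t) has_real_derivative - 2 * C * ((x - x0) \<bullet> b)) (at 0)" by (simp add: mult_ac)
  have "((\<lambda>s. (x + s *\<^sub>R b - x0) \<bullet> b) has_real_derivative 1) (at 0)"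
    unfolding has_field_derivative_def using b by (auto intro!: derivative_eq_intros)
  from DERIV_cmult[OF this, of "- 2 * C"]
  show "((\<lambda>s. - 2 * C * ((x + s *\<^sub>R b - x0) \<bullet> b)) has_real_derivative - 2 * C) (at 0)" by simp
qed simp

text \<open>The difference quotient \<open>v(t, y + \<sigma>b) - v(t, y - \<sigma>b)\<close> is a function of the additional variable
  \<open>\<sigma> \<ge> 0\<close> whose second derivatives in \<open>\<sigma>\<close> and in direction \<open>b\<close> coincide. It therefore obeys an equation
  with \<open>\<partial>\<^sub>\<sigma>\<^sup>2\<close> in place of \<open>\<partial>\<^sub>b\<^sup>2\<close>, for which \<open>A (|y - x|\<^sup>2 + t - s) + B \<sigma> - C \<sigma>\<^sup>2\<close> is a supersolution.\<close>

lemma heat_smooth_symmetric_difference: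
  fixes v :: "real \<Rightarrow> 'a::euclidean_space \<Rightarrow> real"
  assumes v: "heat_smooth \<Omega> v \<kappa>" and \<Omega>: "open \<Omega>" and b: "b \<in> Basis"
    and R: "R > 0" and \<tau>: "\<tau> > 0" and M: "M > 0"
    and cyl: "{t - \<tau>..t} \<times> cball x (2 * R) \<subseteq> {0<..} \<times> \<Omega>"
    and bd: "\<And>s y. s \<in> {t - \<tau>..t} \<Longrightarrow> y \<in> cball x (2 * R) \<Longrightarrow> \<bar>v s y\<bar> \<le> M \<and> \<bar>\<kappa> s y\<bar> \<le> M"
    and \<sigma>: "0 \<le> \<sigma>" "\<sigma> \<le> R"
    and A: "A * R\<^sup>2 \<ge> 2 * M" "A * \<tau> \<ge> 2 * M"
    and C: "C = M + A * (real DIM('a) + 1)" and B: "B = C * R + 2 * M / R"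
  shows "v t (x + \<sigma> *\<^sub>R b) - v t (x - \<sigma> *\<^sub>R b) \<le> B * \<sigma>"
proof -
  have A0: "A > 0" using A(2) M \<tau> by (metis less_le_trans mult_pos_pos zero_less_mult_pos2 zero_less_numeral)
  have C0: "C > 0" using C M A0 by (simp add: add_pos_nonneg)
  have vcont: "continuous_on ({0<..} \<times> \<Omega>) (\<lambda>(t,x). v t x)" using v by (simp add: heat_smooth_def)
  obtain vt vb vbb where D: "heat_derivs \<Omega> v \<kappa> vt vb vbb" using v unfolding heat_smooth_def by blast
  note vt = heat_derivsD(1)[OF D \<Omega>] and vb = heat_derivsD(2)[OF D \<Omega>] and vbb = heat_derivsD(3)[OF D \<Omega>]
    and \<kappa> = heat_derivsD(4)[OF D \<Omega>]
  define \<Phi> where "\<Phi> = (\<lambda>s y r. v s (y + r *\<^sub>R b) - v s (y - r *\<^sub>R b)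
      - A * ((y - x) \<bullet> (y - x) + (t - s)) - B * r + C * r\<^sup>2)"
  \<comment> \<open>With \<open>y\<close> within \<open>R\<close> of \<open>x\<close> and
    \<open>r \<le> R\<close>, both points \<open>y + r b\<close> and \<open>y - r b\<close> remain
    in the ball of radius \<open>2 R\<close> where the bounds are given.\<close>
  define K where "K = {t - \<tau>..t} \<times> cball x R \<times> {0..R}"
  have nb: "norm b = 1" using b by simp
  have mem: "y + r *\<^sub>R b \<in> cball x (2 * R)" "y - r *\<^sub>R b \<in> cball x (2 * R)"
    if "y \<in> cball x R" "0 \<le> r" "r \<le> R" for y r
  proof -
    have "norm (x - y) \<le> R" "norm (r *\<^sub>R b) \<le> R" using that nb by (auto simp: dist_norm)
    then have "norm (x - y - r *\<^sub>R b) \<le> R + R" "norm (x - y + r *\<^sub>R b) \<le> R + R"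
      using norm_triangle_ineq4[of "x - y" "r *\<^sub>R b"] norm_triangle_ineq[of "x - y" "r *\<^sub>R b"] by linarith+
    then show "y + r *\<^sub>R b \<in> cball x (2 * R)" "y - r *\<^sub>R b \<in> cball x (2 * R)"
      by (auto simp: dist_norm algebra_simps)
  qed
  have dom: "s > 0 \<and> z \<in> \<Omega>" if "s \<in> {t - \<tau>..t}" "z \<in> cball x (2 * R)" for s z
    using subsetD[OF cyl, of "(s,z)"] that by simp
  have lin: "0 \<le> B * r - C * r\<^sup>2" if "0 \<le> r" "r \<le> R" for r
  proof -
    have "C * r\<^sup>2 \<le> C * R * r" using that C0 by (simp add: power2_eq_square mult_mono)
    moreover have "2 * M / R * r \<ge> 0" using M R that by simp
    ultimately show ?thesis by (simp add: B algebra_simps)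
  qed
  have "compact K" unfolding K_def by (intro compact_Times compact_Icc compact_cball)
  moreover have "K \<noteq> {}" using R \<tau> by (simp add: K_def)
  moreover have "continuous_on K (\<lambda>p. \<Phi> (fst p) (fst (snd p)) (snd (snd p)))"
  proof -
    have 1: "continuous_on K (\<lambda>p. v (fst p) (fst (snd p) + snd (snd p) *\<^sub>R b))"
      by (rule continuous_on_compose2[OF vcont, where f="\<lambda>p. (fst p, fst (snd p) + snd (snd p) *\<^sub>R b)", simplified])
         (auto simp: K_def intro!: continuous_intros dom[THEN conjunct1] dom[THEN conjunct2] mem simp del: mem_cball)
    have 2: "continuous_on K (\<lambda>p. v (fst p) (fst (snd p) - snd (snd p) *\<^sub>R b))"
      by (rule continuous_on_compose2[OF vcont, where f="\<lambda>p. (fst p, fst (snd p) - snd (snd p) *\<^sub>R b)", simplified])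
         (auto simp: K_def intro!: continuous_intros dom[THEN conjunct1] dom[THEN conjunct2] mem simp del: mem_cball)
    show ?thesis unfolding \<Phi>_def by (intro continuous_intros 1 2)
  qed
  ultimately obtain p where p: "p \<in> K" "\<And>q. q \<in> K \<Longrightarrow>
     \<Phi> (fst q) (fst (snd q)) (snd (snd q)) \<le> \<Phi> (fst p) (fst (snd p)) (snd (snd p))"
    using continuous_attains_sup by (metis (no_types, lifting))
  obtain s y r where syr: "p = (s,y,r)" by (cases p)
  have s: "t - \<tau> \<le> s" "s \<le> t" and y: "y \<in> cball x R" and r: "0 \<le> r" "r \<le> R"
    using p(1) by (auto simp: syr K_def)
  have max: "\<Phi> s' y' r' \<le> \<Phi> s y r" if "s' \<in> {t - \<tau>..t}" "y' \<in> cball x R" "r' \<in> {0..R}" for s' y' r'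
    using p(2)[of "(s',y',r')"] that by (simp add: syr K_def)
  have "\<Phi> s y r \<le> 0"
  proof (rule ccontr)
    assume pos: "\<not> \<Phi> s y r \<le> 0"
    let ?p = "y + r *\<^sub>R b" and ?q = "y - r *\<^sub>R b"
    have sI: "s \<in> {t - \<tau>..t}" using s by simp
    note pm = mem[OF y r]
    note dp = dom[OF sI pm(1)] and dq = dom[OF sI pm(2)]
    have vM: "v s ?p - v s ?q \<le> 2 * M" using bd[OF sI pm(1)] bd[OF sI pm(2)] by (simp add: abs_le_iff)
    have quad: "0 \<le> A * ((y - x) \<bullet> (y - x))" "0 \<le> A * (t - s)" using A0 s by auto
    \<comment> \<open>A positive maximum can lie on no face but the top \<open>s = t\<close>. At
      \<open>r = 0\<close> the difference vanishes; at \<open>r = R\<close> the choice of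
      \<open>B\<close> gives \<open>B R - C R^2 = 2 M\<close>; on the lateral and bottom faces the
      \<open>A\<close> terms reach \<open>2 M\<close>. The difference itself never exceeds
      \<open>2 M\<close>.\<close>
    have "r \<noteq> 0"
    proof
      assume "r = 0"
      then show False using pos quad by (simp add: \<Phi>_def distrib_left)
    qed
    moreover have "r \<noteq> R"
    proof
      assume "r = R"
      have "B * R - C * R\<^sup>2 = 2 * M" using R by (simp add: B power2_eq_square algebra_simps)
      then show False using pos quad vM by (simp add: \<Phi>_def distrib_left \<open>r = R\<close>)
    qed
    moreover have "norm (y - x) \<noteq> R"
    proof
      assume "norm (y - x) = R"
      then have "A * ((y - x) \<bullet> (y - x)) \<ge> 2 * M" using A(1) by (simp add: dot_square_norm)
      then show False using pos quad vM lin[OF r] by (simp add: \<Phi>_def distrib_left)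
    qed
    moreover have "s \<noteq> t - \<tau>"
    proof
      assume "s = t - \<tau>"
      then show False using pos quad vM lin[OF r] A(2) by (simp add: \<Phi>_def distrib_left)
    qed
    ultimately have int: "0 < r" "r < R" "norm (y - x) < R" "t - \<tau> < s"
      using r s y by (auto simp: dist_norm norm_minus_commute)
    have time: "vt s ?p - vt s ?q + A \<ge> 0"
    proof (rule left_max_imp_deriv_nonneg[where g="\<lambda>s. \<Phi> s y r" and t=s and d="s - (t - \<tau>)"])
      show "((\<lambda>s. \<Phi> s y r) has_real_derivative vt s ?p - vt s ?q + A) (at s)"
        unfolding \<Phi>_def using vt[of s ?p] vt[of s ?q] dp dq
        by (auto intro!: derivative_eq_intros)
    qed (use int s y r in \<open>auto intro!: max simp del: mem_cball\<close>)
    have space: "vbb b' s ?p - vbb b' s ?q \<le> 2 * A" if b': "b' \<in> Basis" for b'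
    proof -
      obtain d1 where d1: "d1 > 0" "\<And>h. \<bar>h\<bar> < d1 \<Longrightarrow>
        ((\<lambda>h. v s (?p + h *\<^sub>R b')) has_real_derivative vb b' s (?p + h *\<^sub>R b')) (at h)"
        using vb[of s ?p b'] dp b' by blast
      obtain d2 where d2: "d2 > 0" "\<And>h. \<bar>h\<bar> < d2 \<Longrightarrow>
        ((\<lambda>h. v s (?q + h *\<^sub>R b')) has_real_derivative vb b' s (?q + h *\<^sub>R b')) (at h)"
        using vb[of s ?q b'] dq b' by blast
      define d where "d = min (min d1 d2) (R - norm (y - x))"
      have d: "d > 0" "d \<le> d1" "d \<le> d2" "d \<le> R - norm (y - x)" using d1 d2 int by (auto simp: d_def)
      have dpoly: "((\<lambda>h. (y + h *\<^sub>R b' - x) \<bullet> (y + h *\<^sub>R b' - x)) has_real_derivative 2 * ((y - x) \<bullet> b' + h)) (at h)" for h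
        unfolding has_field_derivative_def using b'
        by (auto intro!: derivative_eq_intros simp: inner_commute algebra_simps)
      have "vbb b' s ?p - vbb b' s ?q - 2 * A \<le> 0"
      proof (rule local_max_imp_second_deriv_le_0[where d=d and
            g="\<lambda>h. v s (?p + h *\<^sub>R b') - v s (?q + h *\<^sub>R b') - A * ((y + h *\<^sub>R b' - x) \<bullet> (y + h *\<^sub>R b' - x))" and
            g'="\<lambda>h. vb b' s (?p + h *\<^sub>R b') - vb b' s (?q + h *\<^sub>R b') - A * (2 * ((y - x) \<bullet> b' + h))"])
        fix h assume h: "\<bar>h\<bar> < d"
        show "((\<lambda>h. v s (?p + h *\<^sub>R b') - v s (?q + h *\<^sub>R b') - A * ((y + h *\<^sub>R b' - x) \<bullet> (y + h *\<^sub>R b' - x)))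
          has_real_derivative vb b' s (?p + h *\<^sub>R b') - vb b' s (?q + h *\<^sub>R b') - A * (2 * ((y - x) \<bullet> b' + h))) (at h)"
          by (intro DERIV_diff DERIV_cmult d1(2) d2(2) dpoly) (use h d in auto)
        have "norm (y + h *\<^sub>R b' - x) \<le> norm (y - x) + \<bar>h\<bar>"
          using norm_triangle_ineq[of "y - x" "h *\<^sub>R b'"] b' by (simp add: algebra_simps)
        then have "y + h *\<^sub>R b' \<in> cball x R" using h d(4) by (simp add: dist_norm norm_minus_commute)
        from max[OF sI this, of r] r
        show "v s (?p + h *\<^sub>R b') - v s (?q + h *\<^sub>R b') - A * ((y + h *\<^sub>R b' - x) \<bullet> (y + h *\<^sub>R b' - x))
          \<le> v s (?p + 0 *\<^sub>R b') - v s (?q + 0 *\<^sub>R b') - A * ((y + 0 *\<^sub>R b' - x) \<bullet> (y + 0 *\<^sub>R b' - x))"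
          by (simp add: \<Phi>_def algebra_simps)
      next
        have "((\<lambda>h. A * (2 * ((y - x) \<bullet> b' + h))) has_real_derivative 2 * A) (at 0)"
          by (auto intro!: derivative_eq_intros)
        then show "((\<lambda>h. vb b' s (?p + h *\<^sub>R b') - vb b' s (?q + h *\<^sub>R b') - A * (2 * ((y - x) \<bullet> b' + h)))
           has_real_derivative vbb b' s ?p - vbb b' s ?q - 2 * A) (at 0)"
          by (intro DERIV_diff vbb) (use dp dq b' in auto)
      qed (use d in auto)
      then show ?thesis by simp
    qed
    \<comment> \<open>Changing \<open>r\<close> moves the two points in opposite directions along
      \<open>b\<close>, so the second derivative in \<open>r\<close> is again the difference of the
      two \<open>vbb b\<close>. The concave term \<open>- C r^2\<close> therefore improves the bound
      \<open>2 A\<close> to \<open>- 2 C\<close> in direction \<open>b\<close>.\<close>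
    have extra: "vbb b s ?p - vbb b s ?q \<le> - 2 * C"
    proof -
      obtain d1 where d1: "d1 > 0" "\<And>h. \<bar>h\<bar> < d1 \<Longrightarrow>
        ((\<lambda>h. v s (?p + h *\<^sub>R b)) has_real_derivative vb b s (?p + h *\<^sub>R b)) (at h)"
        using vb[of s ?p b] dp b by blast
      obtain d2 where d2: "d2 > 0" "\<And>h. \<bar>h\<bar> < d2 \<Longrightarrow>
        ((\<lambda>h. v s (?q + h *\<^sub>R b)) has_real_derivative vb b s (?q + h *\<^sub>R b)) (at h)"
        using vb[of s ?q b] dq b by blast
      have d2': "((\<lambda>h. v s (?q - h *\<^sub>R b)) has_real_derivative - vb b s (?q - h *\<^sub>R b)) (at h)" if "\<bar>h\<bar> < d2" for h
        using DERIV_chain2[OF d2(2)[of "- h"] DERIV_minus[OF DERIV_ident]] that by simp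
      have vbb2: "((\<lambda>h. vb b s (?q - h *\<^sub>R b)) has_real_derivative - vbb b s ?q) (at 0)"
        using DERIV_chain2[of "\<lambda>h. vb b s (?q + h *\<^sub>R b)" "vbb b s ?q" "\<lambda>h. - h" 0, OF _ DERIV_minus[OF DERIV_ident]]
          vbb[of s ?q b] dq b by simp
      define d where "d = min (min d1 d2) (min r (R - r))"
      have d: "d > 0" "d \<le> d1" "d \<le> d2" "d \<le> r" "d \<le> R - r" using d1 d2 int by (auto simp: d_def)
      have "vbb b s ?p - vbb b s ?q + 2 * C \<le> 0"
      proof (rule local_max_imp_second_deriv_le_0[where d=d and
            g="\<lambda>h. v s (?p + h *\<^sub>R b) - v s (?q - h *\<^sub>R b) - B * (r + h) + C * (r + h)\<^sup>2" and
            g'="\<lambda>h. vb b s (?p + h *\<^sub>R b) + vb b s (?q - h *\<^sub>R b) - B + C * (2 * (r + h))"])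
        fix h assume h: "\<bar>h\<bar> < d"
        have "((\<lambda>h. C * (r + h)\<^sup>2) has_real_derivative C * (2 * (r + h))) (at h)"
          "((\<lambda>h. B * (r + h)) has_real_derivative B) (at h)"
          by (auto intro!: derivative_eq_intros)
        from DERIV_add[OF DERIV_diff[OF DERIV_diff[OF d1(2) d2'] this(2)] this(1)] h d
        show "((\<lambda>h. v s (?p + h *\<^sub>R b) - v s (?q - h *\<^sub>R b) - B * (r + h) + C * (r + h)\<^sup>2)
          has_real_derivative vb b s (?p + h *\<^sub>R b) + vb b s (?q - h *\<^sub>R b) - B + C * (2 * (r + h))) (at h)" by simp
        have "r + h \<in> {0..R}" using h d by auto
        from max[OF sI y this]
        show "v s (?p + h *\<^sub>R b) - v s (?q - h *\<^sub>R b) - B * (r + h) + C * (r + h)\<^sup>2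
          \<le> v s (?p + 0 *\<^sub>R b) - v s (?q - 0 *\<^sub>R b) - B * (r + 0) + C * (r + 0)\<^sup>2"
          by (simp add: \<Phi>_def scaleR_add_left add.assoc diff_diff_eq)
      next
        have "((\<lambda>h. C * (2 * (r + h))) has_real_derivative 2 * C) (at 0)" by (auto intro!: derivative_eq_intros)
        from DERIV_add[OF DERIV_diff[OF DERIV_add[OF vbb[of s ?p b] vbb2] DERIV_const] this, of B] dp b
        show "((\<lambda>h. vb b s (?p + h *\<^sub>R b) + vb b s (?q - h *\<^sub>R b) - B + C * (2 * (r + h)))
           has_real_derivative vbb b s ?p - vbb b s ?q + 2 * C) (at 0)" by simp
      qed (use d in auto)
      then show ?thesis by simp
    qed
    have "(\<Sum>b'\<in>Basis - {b}. vbb b' s ?p - vbb b' s ?q) \<le> real (card (Basis - {b})) * (2 * A)"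
      by (rule sum_bounded_above) (use space in auto)
    also have "\<dots> \<le> real DIM('a) * (2 * A)"
      using A0 by (intro mult_right_mono) (auto intro: card_mono)
    finally have "(\<Sum>b'\<in>Basis. vbb b' s ?p - vbb b' s ?q) \<le> real DIM('a) * (2 * A) - 2 * C"
      using extra b by (subst sum.remove[OF finite_Basis b]) linarith
    then have "\<kappa> s ?p - \<kappa> s ?q \<ge> - A - real DIM('a) * (2 * A) + 2 * C"
      using \<kappa>[of s ?p] \<kappa>[of s ?q] dp dq time by (simp add: sum_subtractf)
    \<comment> \<open>\<open>C\<close> is chosen so that the left side equals
      \<open>2 M + A\<close>, while two values of \<open>\<kappa>\<close> differ by at most
      \<open>2 M\<close>.\<close>
    moreover have "- A - real DIM('a) * (2 * A) + 2 * C > 2 * M" using A0 by (simp add: C algebra_simps)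
    ultimately have "\<kappa> s ?p - \<kappa> s ?q > 2 * M" by linarith
    then show False using bd[OF sI pm(1)] bd[OF sI pm(2)] by (simp add: abs_le_iff)
  qed
  \<comment> \<open>At the top time and at the centre of the cylinder the \<open>A\<close> penalty
    vanishes.\<close>
  moreover have "\<Phi> t x \<sigma> \<le> \<Phi> s y r" by (rule max) (use \<tau> R \<sigma> in auto)
  ultimately have "v t (x + \<sigma> *\<^sub>R b) - v t (x - \<sigma> *\<^sub>R b) \<le> B * \<sigma> - C * \<sigma>\<^sup>2" by (simp add: \<Phi>_def)
  also have "\<dots> \<le> B * \<sigma>" using C0 by simp
  finally show ?thesis .
qed

text \<open>The data on which interior estimates are allowed to depend.\<close>

definition cyl_bound :: "'a::euclidean_space set \<Rightarrow> (real \<Rightarrow> 'a \<Rightarrow> real) \<Rightarrow> (real \<Rightarrow> 'a \<Rightarrow> real) \<Rightarrow> real set \<Rightarrow> 'a set \<Rightarrow> real \<Rightarrow> bool" where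
  "cyl_bound \<Omega> w k I B M \<longleftrightarrow> heat_approx \<Omega> w k \<and> open \<Omega> \<and> I \<times> B \<subseteq> {0<..} \<times> \<Omega> \<and>
     (\<forall>s\<in>I. \<forall>y\<in>B. \<bar>w s y\<bar> \<le> M \<and> \<bar>k s y\<bar> \<le> M)"

lemma cyl_bound_mono: "cyl_bound \<Omega> w k I B M \<Longrightarrow> I' \<subseteq> I \<Longrightarrow> B' \<subseteq> B \<Longrightarrow> cyl_bound \<Omega> w k I' B' M"
  unfolding cyl_bound_def by blast

lemma cyl_bound_uminus: "cyl_bound \<Omega> w k I B M \<Longrightarrow> cyl_bound \<Omega> (\<lambda>t x. - w t x) (\<lambda>t x. - k t x) I B M"
  unfolding cyl_bound_def by (simp add: heat_approx_uminus)

lemma cyl_boundD: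
  assumes "cyl_bound \<Omega> w k I B M"
  shows "heat_approx \<Omega> w k" "open \<Omega>" "I \<times> B \<subseteq> {0<..} \<times> \<Omega>"
    "\<And>s y. s \<in> I \<Longrightarrow> y \<in> B \<Longrightarrow> \<bar>w s y\<bar> \<le> M \<and> \<bar>k s y\<bar> \<le> M"
  using assms unfolding cyl_bound_def by blast+

text \<open>The constants are formed with \<open>M + 1\<close>, so they serve every approximant
  within distance 1 of \<open>w\<close> and \<open>B\<close> stays fixed while the accuracy is
  refined.\<close>

lemma heat_approx_lipschitz_aux:
  fixes w :: "real \<Rightarrow> 'a::euclidean_space \<Rightarrow> real"
  assumes w: "cyl_bound \<Omega> w k {t - \<tau>..t} (cball x (2 * R)) M" and b: "b \<in> Basis"
    and R: "R > 0" and \<tau>: "\<tau> > 0" and M: "M \<ge> 0"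
    and \<sigma>: "0 \<le> \<sigma>" "\<sigma> \<le> R"
    and A: "A * R\<^sup>2 \<ge> 2 * (M + 1)" "A * \<tau> \<ge> 2 * (M + 1)"
    and C: "C = (M + 1) + A * (real DIM('a) + 1)" and B: "B = C * R + 2 * (M + 1) / R"
  shows "w t (x + \<sigma> *\<^sub>R b) - w t (x - \<sigma> *\<^sub>R b) \<le> B * \<sigma>"
proof (rule field_le_epsilon)
  fix e :: real assume e: "e > 0"
  define e' where "e' = min 1 (e / 2)"
  have e': "e' > 0" "e' \<le> 1" "2 * e' \<le> e" using e by (auto simp: e'_def)
  have "compact ({t - \<tau>..t} \<times> cball x (2 * R))" by (intro compact_Times compact_Icc compact_cball)
  then obtain v \<kappa> where v: "heat_smooth \<Omega> v \<kappa>"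
    and ap: "\<And>s y. (s,y) \<in> {t - \<tau>..t} \<times> cball x (2 * R) \<Longrightarrow> \<bar>v s y - w s y\<bar> \<le> e' \<and> \<bar>\<kappa> s y - k s y\<bar> \<le> e'"
    using cyl_boundD(1,3)[OF w] e'(1) unfolding heat_approx_def by meson
  have ap: "\<bar>v s y - w s y\<bar> \<le> e'" "\<bar>\<kappa> s y - k s y\<bar> \<le> e'" if "s \<in> {t - \<tau>..t}" "y \<in> cball x (2 * R)" for s y
    using ap[of s y] that by auto
  have "v t (x + \<sigma> *\<^sub>R b) - v t (x - \<sigma> *\<^sub>R b) \<le> B * \<sigma>"
  proof (rule heat_smooth_symmetric_difference[OF v cyl_boundD(2)[OF w] b R \<tau> _ cyl_boundD(3)[OF w] _ \<sigma> A C B])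
    fix s y assume sy: "s \<in> {t - \<tau>..t}" "y \<in> cball x (2 * R)"
    show "\<bar>v s y\<bar> \<le> M + 1 \<and> \<bar>\<kappa> s y\<bar> \<le> M + 1" using ap[OF sy] cyl_boundD(4)[OF w sy] e' by linarith
  qed (use M in auto)
  moreover have "x + \<sigma> *\<^sub>R b \<in> cball x (2 * R)" "x - \<sigma> *\<^sub>R b \<in> cball x (2 * R)"
    using \<sigma> R b by (auto simp: dist_norm)
  note ap(1)[OF _ this(1), of t] ap(1)[OF _ this(2), of t]
  ultimately show "w t (x + \<sigma> *\<^sub>R b) - w t (x - \<sigma> *\<^sub>R b) \<le> B * \<sigma> + e" using e' \<tau> by auto
qed

text \<open>\<open>B\<close> is chosen before the domain, the solution, the direction and the
  centre, so one constant serves all balls. \<open>A\<close> is the least number meeting its two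
  requirements; \<open>- w\<close> supplies the opposite inequality.\<close>

lemma heat_approx_spatial_lipschitz:
  assumes R: "R > 0" and \<tau>: "\<tau> > 0" and M: "M \<ge> 0"
  obtains B where "B \<ge> 0"
    and "\<And>\<Omega> w k b t x \<sigma>. cyl_bound (\<Omega> :: 'a::euclidean_space set) w k {t - \<tau>..t} (cball x (2 * R)) M \<Longrightarrow> b \<in> Basis \<Longrightarrow>
      \<bar>\<sigma>\<bar> \<le> R \<Longrightarrow> \<bar>w t (x + \<sigma> *\<^sub>R b) - w t (x - \<sigma> *\<^sub>R b)\<bar> \<le> B * \<bar>\<sigma>\<bar>"
proof -
  define A where "A = max (2 * (M + 1) / R\<^sup>2) (2 * (M + 1) / \<tau>)"
  define C where "C = (M + 1) + A * (real DIM('a) + 1)"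
  define B where "B = C * R + 2 * (M + 1) / R"
  have "2 * (M + 1) / R\<^sup>2 \<le> A" "2 * (M + 1) / \<tau> \<le> A" by (auto simp: A_def)
  then have A: "A * R\<^sup>2 \<ge> 2 * (M + 1)" "A * \<tau> \<ge> 2 * (M + 1)"
    using R \<tau> by (simp_all add: pos_divide_le_eq)
  have "2 * (M + 1) / \<tau> \<ge> 0" using M \<tau> by simp
  then have "A \<ge> 0" unfolding A_def by linarith
  then have "C \<ge> 0" using M by (simp add: C_def)
  then have B0: "B \<ge> 0" using R M by (simp add: B_def)
  show thesis
  proof (rule that[OF B0])
    fix \<Omega> :: "'a set" and w k and b x :: 'a and t \<sigma>
    assume w: "cyl_bound \<Omega> w k {t - \<tau>..t} (cball x (2 * R)) M" and b: "b \<in> Basis" and \<sigma>: "\<bar>\<sigma>\<bar> \<le> R"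
    note aux = heat_approx_lipschitz_aux[OF _ b R \<tau> M abs_ge_zero \<sigma> A C_def B_def]
    have "\<bar>w t (x + \<bar>\<sigma>\<bar> *\<^sub>R b) - w t (x - \<bar>\<sigma>\<bar> *\<^sub>R b)\<bar> \<le> B * \<bar>\<sigma>\<bar>"
      using aux[OF w] aux[OF cyl_bound_uminus[OF w]] by linarith
    then show "\<bar>w t (x + \<sigma> *\<^sub>R b) - w t (x - \<sigma> *\<^sub>R b)\<bar> \<le> B * \<bar>\<sigma>\<bar>"
      by (cases "\<sigma> \<ge> 0") (simp_all add: abs_minus_commute)
  qed
qed

text \<open>Walk from \<open>x\<close> to \<open>y\<close> along one coordinate direction at a time.
  Every intermediate point is within \<open>N |y - x| < r\<close> of \<open>x\<close>, and each of
  the \<open>N\<close> steps costs at most \<open>L |y - x|\<close>.\<close>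

lemma coordinatewise_lipschitz:
  fixes W :: "'a::euclidean_space \<Rightarrow> real"
  assumes W: "\<And>p b \<sigma>. b \<in> Basis \<Longrightarrow> p \<in> ball x r \<Longrightarrow> p + \<sigma> *\<^sub>R b \<in> ball x r \<Longrightarrow> \<bar>W (p + \<sigma> *\<^sub>R b) - W p\<bar> \<le> L * \<bar>\<sigma>\<bar>"
    and L: "L \<ge> 0" and y: "real DIM('a) * norm (y - x) < r"
  shows "\<bar>W y - W x\<bar> \<le> L * real DIM('a) * norm (y - x)"
proof -
  define z where "z = (\<lambda>S. x + (\<Sum>b\<in>S. ((y - x) \<bullet> b) *\<^sub>R b))"
  have inball: "z S \<in> ball x r" if "S \<subseteq> Basis" for S
  proof -
    have "norm (\<Sum>b\<in>S. ((y - x) \<bullet> b) *\<^sub>R b) \<le> (\<Sum>b\<in>S. norm (y - x))"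
      by (rule sum_norm_le) (use that Basis_le_norm in \<open>auto simp: subset_iff\<close>)
    also have "\<dots> \<le> (\<Sum>b\<in>(Basis :: 'a set). norm (y - x))"
      by (rule sum_mono2) (use that in auto)
    also have "\<dots> < r" using y by simp
    finally show ?thesis by (simp add: z_def dist_norm)
  qed
  have "\<bar>W (z S) - W x\<bar> \<le> L * real (card S) * norm (y - x)" if "finite S" "S \<subseteq> Basis" for S
    using that
  proof (induction S rule: finite_induct)
    case empty
    then show ?case by (simp add: z_def)
  next
    case (insert b S)
    have zz: "z (insert b S) = z S + ((y - x) \<bullet> b) *\<^sub>R b" using insert by (simp add: z_def algebra_simps)
    have "\<bar>W (z (insert b S)) - W (z S)\<bar> \<le> L * \<bar>(y - x) \<bullet> b\<bar>"
      unfolding zz by (rule W) (use insert.prems inball[of S] inball[of "insert b S"] zz in auto)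
    also have "\<dots> \<le> L * norm (y - x)"
      by (intro mult_left_mono L Basis_le_norm) (use insert.prems in auto)
    finally show ?case using insert by (simp add: algebra_simps)
  qed
  from this[of Basis] have "\<bar>W (z Basis) - W x\<bar> \<le> L * real DIM('a) * norm (y - x)" by simp
  moreover have "z Basis = y" by (simp add: z_def euclidean_representation)
  ultimately show ?thesis by simp
qed

text \<open>The paraboloid \<open>w(s,x) + \<delta> + C |y - x|^2 + (2 N C + M) (r - s)\<close> is a
  supersolution. It starts above \<open>w\<close> by \<open>start\<close>, and
  \<open>C R^2 \<ge> 2 M\<close> keeps it above on the lateral boundary. A spatial modulus at one
  time thus bounds the later growth at the centre.\<close>

lemma heat_approx_time_growth:
  fixes w :: "real \<Rightarrow> 'a::euclidean_space \<Rightarrow> real"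
  assumes cb: "cyl_bound \<Omega> w k {s..t} (cball x R) M" and R: "R > 0" and st: "s \<le> t" and C: "C \<ge> 0"
    and start: "\<And>y. y \<in> cball x R \<Longrightarrow> w s y \<le> w s x + \<delta> + C * ((y - x) \<bullet> (y - x))"
    and CR: "C * R\<^sup>2 \<ge> 2 * M" and \<delta>: "\<delta> \<ge> 0"
  shows "w t x \<le> w s x + \<delta> + (2 * real DIM('a) * C + M) * (t - s)"
proof (rule field_le_epsilon)
  note w = cyl_boundD(1)[OF cb] and \<Omega> = cyl_boundD(2)[OF cb] and cyl = cyl_boundD(3)[OF cb] and bd = cyl_boundD(4)[OF cb]
  fix e0 :: real assume e0: "e0 > 0"
  define D where "D = 1 + (t - s)"
  \<comment> \<open>The approximation error enters twice at fixed size and twice per unit of time,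
    in total \<open>2 e + 2 e (t - s) = e0\<close>.\<close>
  define e where "e = e0 / (2 * D)"
  have D: "D > 0" using st by (simp add: D_def)
  then have "2 * e * D = e0" by (simp add: e_def)
  then have e: "2 * e + 2 * e * (t - s) = e0" by (simp add: D_def algebra_simps)
  have e_pos: "e > 0" using D e0 by (simp add: e_def)
  define N where "N = real DIM('a)"
  \<comment> \<open>Of the extra \<open>2 e\<close>, one \<open>e\<close> absorbs the error in
    \<open>\<kappa>\<close> and the other makes the inequality at an interior maximum
    strict.\<close>
  define K where "K = 2 * N * C + M + 2 * e"
  have "compact ({s..t} \<times> cball x R)" by (intro compact_Times compact_Icc compact_cball)
  then obtain v \<kappa> where v: "heat_smooth \<Omega> v \<kappa>"
    and ap: "\<And>r y. (r,y) \<in> {s..t} \<times> cball x R \<Longrightarrow> \<bar>v r y - w r y\<bar> \<le> e \<and> \<bar>\<kappa> r y - k r y\<bar> \<le> e"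
    using w cyl e_pos unfolding heat_approx_def by meson
  have ap: "\<bar>v r y - w r y\<bar> \<le> e" "\<bar>\<kappa> r y - k r y\<bar> \<le> e" if "r \<in> {s..t}" "y \<in> cball x R" for r y
    using ap[of r y] that by auto
  define \<Phi> where "\<Phi> = (\<lambda>r y. v r y + (0 - C * ((y - x) \<bullet> (y - x)) - K * r))"
  have sm: "heat_smooth \<Omega> \<Phi> (\<lambda>r y. \<kappa> r y + (- K + 2 * N * C))"
    unfolding \<Phi>_def N_def by (intro heat_smooth_add v heat_smooth_paraboloid)
  have "continuous_on ({s..t} \<times> cball x R) (\<lambda>(r,y). \<Phi> r y)"
    using sm cyl continuous_on_subset unfolding heat_smooth_def by blast
  moreover have "(t,x) \<in> {s..t} \<times> cball x R" using st R by auto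
  ultimately obtain p where p: "p \<in> {s..t} \<times> cball x R"
    "\<And>q. q \<in> {s..t} \<times> cball x R \<Longrightarrow> (case q of (r,y) \<Rightarrow> \<Phi> r y) \<le> (case p of (r,y) \<Rightarrow> \<Phi> r y)"
    using continuous_attains_sup[OF \<open>compact ({s..t} \<times> cball x R)\<close>] by blast
  obtain r y where ry: "p = (r,y)" by (cases p)
  have r: "r \<in> {s..t}" and y: "y \<in> cball x R" using p(1) by (auto simp: ry)
  have max: "\<Phi> r' y' \<le> \<Phi> r y" if "r' \<in> {s..t}" "y' \<in> cball x R" for r' y'
    using p(2)[of "(r',y')"] that by (simp add: ry)
  have "2 * N * C \<ge> 0" using C by (simp add: N_def)
  then have K0: "K \<ge> 0" using e_pos bd[OF r y] unfolding K_def by linarith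
  have x: "x \<in> cball x R" and sI: "s \<in> {s..t}" using R st by auto
  have "\<Phi> r y \<le> w s x + \<delta> + e - K * s"
  proof (cases "r = s \<or> norm (y - x) = R")
    case True
    then show ?thesis
    proof
      assume "r = s"
      then show ?thesis using start[OF y] ap(1)[OF r y] by (simp add: \<Phi>_def abs_le_iff)
    next
      assume nR: "norm (y - x) = R"
      have "C * ((y - x) \<bullet> (y - x)) \<ge> 2 * M" using CR nR by (simp add: dot_square_norm)
      moreover have "K * s \<le> K * r" using K0 r by (simp add: mult_left_mono)
      ultimately show ?thesis using ap(1)[OF r y] bd[OF r y] bd[OF sI x] \<delta> unfolding \<Phi>_def by linarith
    qed
  next
    case False
    then have int: "s < r" "norm (y - x) < R" using r y by (auto simp: dist_norm norm_minus_commute)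
    define d where "d = min (r - s) (R - norm (y - x))"
    have d: "d > 0" "d \<le> r - s" "d \<le> R - norm (y - x)" using int by (auto simp: d_def)
    have dom: "r > 0" "y \<in> \<Omega>" using subsetD[OF cyl, of "(r,y)"] r y by auto
    have "\<kappa> r y + (- K + 2 * N * C) \<ge> 0"
    proof (rule heat_smooth_max_nonneg[OF sm \<Omega> dom d(1)])
      fix r' assume "r - d < r'" "r' < r"
      then show "\<Phi> r' y \<le> \<Phi> r y + 0 * (r' - r)" using max[of r' y] r y d by auto
    next
      fix y' assume "dist y' y < d"
      then have "y' \<in> cball x R"
        using d(3) norm_triangle_ineq[of "y' - y" "y - x"] by (simp add: dist_norm norm_minus_commute)
      then show "\<Phi> r y' \<le> \<Phi> r y" by (rule max[OF r])
    qed
    then show ?thesis using ap(2)[OF r y] bd[OF r y] e_pos unfolding K_def by linarith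
  qed
  moreover have "\<Phi> t x \<le> \<Phi> r y" by (rule max) (use st x in auto)
  moreover have "\<Phi> t x = v t x - K * t" by (simp add: \<Phi>_def)
  moreover have "\<bar>v t x - w t x\<bar> \<le> e" by (rule ap) (use st x in auto)
  ultimately have "w t x \<le> w s x + \<delta> + 2 * e + K * (t - s)" by (simp add: abs_le_iff right_diff_distrib)
  also have "\<dots> = w s x + \<delta> + (2 * N * C + M) * (t - s) + e0"
    using e by (simp add: K_def algebra_simps)
  finally show "w t x \<le> w s x + \<delta> + (2 * real DIM('a) * C + M) * (t - s) + e0" by (simp add: N_def)
qed

text \<open>Space is handled by the Lipschitz bound, valid at all times within
  \<open>\<tau>/2\<close> of \<open>t0\<close>; time by the growth bound started from such a
  Lipschitz profile, for \<open>w\<close> and for \<open>- w\<close>. Since \<open>d\<close> is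
  chosen before the solution, this is equicontinuity of all solutions with common bounds.\<close>

lemma heat_approx_equicontinuous:
  fixes x0 :: "'a::euclidean_space"
  assumes R: "R > 0" and \<tau>: "\<tau> > 0" and M: "M \<ge> 0" and e: "e > 0"
  obtains d where "d > 0" "\<And>\<Omega> w k t x. cyl_bound \<Omega> w k {t0 - \<tau>..t0 + \<tau>} (cball x0 (3 * R)) M \<Longrightarrow>
      \<bar>t - t0\<bar> < d \<Longrightarrow> norm (x - x0) < d \<Longrightarrow> \<bar>w t x - w t0 x0\<bar> \<le> e"
proof -
  obtain B where B: "B \<ge> 0"
    "\<And>\<Omega> w k b t x \<sigma>. cyl_bound (\<Omega> :: 'a set) w k {t - \<tau>/2..t} (cball x (2 * R)) M \<Longrightarrow> b \<in> Basis \<Longrightarrow>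
      \<bar>\<sigma>\<bar> \<le> R \<Longrightarrow> \<bar>w t (x + \<sigma> *\<^sub>R b) - w t (x - \<sigma> *\<^sub>R b)\<bar> \<le> B * \<bar>\<sigma>\<bar>"
    using heat_approx_spatial_lipschitz[of R "\<tau>/2" M] R \<tau> M by (metis half_gt_zero)
  define N where "N = real DIM('a)"
  have N: "N \<ge> 1" using DIM_positive[where 'a='a] by (simp add: N_def Suc_le_eq)
  define \<Lambda> where "\<Lambda> = B * N"
  have \<Lambda>: "\<Lambda> \<ge> 0" using B(1) N by (simp add: \<Lambda>_def)
  define \<rho> where "\<rho> = R / (2 * N)"
  have \<rho>: "\<rho> > 0" "N * \<rho> < R" "\<rho> \<le> 3 * R" using R N by (auto simp: \<rho>_def field_simps)
  \<comment> \<open>The budget: going from \<open>t0\<close> to \<open>t\<close> costs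
    \<open>\<delta> + K d \<le> 2 \<delta>\<close>, going from \<open>x0\<close> to \<open>x\<close>
    costs \<open>\<Lambda> d \<le> \<delta>\<close>.\<close>
  define \<delta> where "\<delta> = e / 3"
  have \<delta>: "\<delta> > 0" using e by (simp add: \<delta>_def)
  \<comment> \<open>The first entry lets Young's inequality turn the cone
    \<open>\<Lambda> |z|\<close> into the paraboloid \<open>\<delta> + C |z|^2\<close> that the
    growth bound requires; the second gives its lateral condition on the ball of radius
    \<open>\<rho>\<close>.\<close>
  define C where "C = max (\<Lambda>\<^sup>2 / (4 * \<delta>)) (2 * M / \<rho>\<^sup>2)"
  have "2 * M / \<rho>\<^sup>2 \<le> C" by (simp add: C_def)
  then have C: "C * \<rho>\<^sup>2 \<ge> 2 * M" using \<rho>(1) by (simp add: pos_divide_le_eq)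
  have C1: "\<Lambda>\<^sup>2 / (4 * \<delta>) \<le> C" by (simp add: C_def)
  have C0: "C \<ge> 0" using C1 \<delta> by (smt (verit) divide_nonneg_pos zero_le_power2)
  have young: "\<Lambda> * z \<le> \<delta> + C * z\<^sup>2" for z
  proof -
    have "0 \<le> (2 * \<delta> - \<Lambda> * z)\<^sup>2 / (4 * \<delta>)" using \<delta> by simp
    also have "\<dots> = \<delta> - \<Lambda> * z + \<Lambda>\<^sup>2 / (4 * \<delta>) * z\<^sup>2" using \<delta> by (simp add: power2_eq_square field_simps)
    also have "\<dots> \<le> \<delta> - \<Lambda> * z + C * z\<^sup>2" using C1 by (intro add_left_mono mult_right_mono) auto
    finally show ?thesis by simp
  qed
  define K where "K = 2 * N * C + M"
  have K: "K \<ge> 0" using N C0 M by (simp add: K_def)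
  define d where "d = min (min (\<tau> / 2) \<rho>) (min (\<delta> / (\<Lambda> + 1)) (\<delta> / (K + 1)))"
  have "d \<le> min (\<tau> / 2) \<rho>" "d \<le> min (\<delta> / (\<Lambda> + 1)) (\<delta> / (K + 1))"
    unfolding d_def by (rule min.cobounded1, rule min.cobounded2)
  then have d: "d \<le> \<tau> / 2" "d \<le> \<rho>" "d \<le> \<delta> / (\<Lambda> + 1)" "d \<le> \<delta> / (K + 1)"
    unfolding min.bounded_iff by blast+
  have d0: "d > 0" using \<tau> \<rho> \<delta> \<Lambda> K by (simp add: d_def)
  have d\<Lambda>: "\<Lambda> * d \<le> \<delta>" and dK: "K * d \<le> \<delta>"
    using d0 d(3,4) \<Lambda> K by (simp_all add: pos_le_divide_eq algebra_simps)
  show thesis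
  proof (rule that[OF d0])
    fix \<Omega> :: "'a set" and w k t and x :: 'a
    assume w: "cyl_bound \<Omega> w k {t0 - \<tau>..t0 + \<tau>} (cball x0 (3 * R)) M"
      and t: "\<bar>t - t0\<bar> < d" and x: "norm (x - x0) < d"
    have space: "\<bar>w s y - w s x0\<bar> \<le> \<Lambda> * norm (y - x0)"
      if s: "\<bar>s - t0\<bar> \<le> \<tau> / 2" and y: "norm (y - x0) \<le> \<rho>" for s y
      unfolding \<Lambda>_def N_def
    proof (rule coordinatewise_lipschitz[where r=R])
      fix p b \<sigma> assume b: "b \<in> (Basis :: 'a set)" and p: "p \<in> ball x0 R" "p + \<sigma> *\<^sub>R b \<in> ball x0 R"
      \<comment> \<open>The midpoint, because the spatial bound compares two points symmetric about
        a centre.\<close>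
      define q where "q = p + (\<sigma> / 2) *\<^sub>R b"
      have q: "q \<in> ball x0 R"
      proof -
        have "q = (1 / 2) *\<^sub>R p + (1 / 2) *\<^sub>R (p + \<sigma> *\<^sub>R b)"
          by (simp add: q_def scaleR_add_right flip: scaleR_add_left)
        then show ?thesis using convexD[OF convex_ball p, of "1/2" "1/2"] by simp
      qed
      have pq: "p = q - (\<sigma> / 2) *\<^sub>R b" "p + \<sigma> *\<^sub>R b = q + (\<sigma> / 2) *\<^sub>R b"
        by (simp_all add: q_def flip: scaleR_add_left)
      have "\<bar>\<sigma>\<bar> = norm ((p + \<sigma> *\<^sub>R b - x0) - (p - x0))" using b by simp
      also have "\<dots> \<le> norm (p + \<sigma> *\<^sub>R b - x0) + norm (p - x0)" by (rule norm_triangle_ineq4)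
      also have "\<dots> \<le> R + R" using p by (intro add_mono) (auto simp: dist_norm norm_minus_commute)
      finally have \<sigma>: "\<bar>\<sigma> / 2\<bar> \<le> R" by simp
      have sub: "cball q (2 * R) \<subseteq> cball x0 (3 * R)"
      proof
        fix z assume "z \<in> cball q (2 * R)"
        then show "z \<in> cball x0 (3 * R)" using q dist_triangle[of x0 z q] by simp
      qed
      have subt: "{s - \<tau> / 2..s} \<subseteq> {t0 - \<tau>..t0 + \<tau>}" using s \<tau> unfolding abs_le_iff by auto
      have "\<bar>w s (q + (\<sigma> / 2) *\<^sub>R b) - w s (q - (\<sigma> / 2) *\<^sub>R b)\<bar> \<le> B * \<bar>\<sigma> / 2\<bar>"
        by (rule B(2)[OF cyl_bound_mono[OF w subt sub] b \<sigma>])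
      also have "\<dots> \<le> B * \<bar>\<sigma>\<bar>" using B(1) by (intro mult_left_mono) auto
      finally show "\<bar>w s (p + \<sigma> *\<^sub>R b) - w s p\<bar> \<le> B * \<bar>\<sigma>\<bar>" by (simp only: pq[symmetric])
    next
      have "N * norm (y - x0) \<le> N * \<rho>" using y N by (intro mult_left_mono) auto
      then show "real DIM('a) * norm (y - x0) < R" using \<rho>(2) unfolding N_def by linarith
    qed (rule B(1))
    have subx: "cball x0 \<rho> \<subseteq> cball x0 (3 * R)" using \<rho>(3) by auto
    \<comment> \<open>Stated for every \<open>w'\<close> whose spatial increments agree with those
      of \<open>w\<close> in absolute value, so that it serves both \<open>w\<close> and
      \<open>- w\<close>.\<close>
    have grow: "w' t2 x0 \<le> w' t1 x0 + \<delta> + K * (t2 - t1)"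
      if w': "cyl_bound \<Omega> w' k' {t0 - \<tau>..t0 + \<tau>} (cball x0 (3 * R)) M"
        "\<And>s y z. \<bar>w' s y - w' s z\<bar> = \<bar>w s y - w s z\<bar>"
        and ts: "t1 \<le> t2" "\<bar>t1 - t0\<bar> \<le> \<tau> / 2" "\<bar>t2 - t0\<bar> \<le> \<tau> / 2" for w' k' t1 t2
    proof -
      have subt: "{t1..t2} \<subseteq> {t0 - \<tau>..t0 + \<tau>}" using ts \<tau> unfolding abs_le_iff by auto
      show ?thesis unfolding K_def N_def
      proof (rule heat_approx_time_growth[OF cyl_bound_mono[OF w'(1) subt subx] \<rho>(1) ts(1) C0 _ C])
        fix y assume "y \<in> cball x0 \<rho>"
        then have "\<bar>w' t1 y - w' t1 x0\<bar> \<le> \<Lambda> * norm (y - x0)"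
          unfolding w'(2) using space[OF ts(2), of y] by (simp add: dist_norm norm_minus_commute)
        then show "w' t1 y \<le> w' t1 x0 + \<delta> + C * ((y - x0) \<bullet> (y - x0))"
          using young[of "norm (y - x0)"] by (simp add: dot_square_norm)
      qed (use \<delta> in simp)
    qed
    have both: "\<bar>w t2 x0 - w t1 x0\<bar> \<le> \<delta> + K * (t2 - t1)"
      if ts: "t1 \<le> t2" "\<bar>t1 - t0\<bar> \<le> \<tau> / 2" "\<bar>t2 - t0\<bar> \<le> \<tau> / 2" for t1 t2

    proof -
      have "- w t2 x0 \<le> - w t1 x0 + \<delta> + K * (t2 - t1)"
        by (rule grow[OF cyl_bound_uminus[OF w] _ ts]) (simp_all add: abs_minus_commute)
      with grow[OF w refl ts] show ?thesis by linarith
    qed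
    have td: "\<bar>t - t0\<bar> \<le> \<tau> / 2" using t d by simp
    have "\<bar>w t x0 - w t0 x0\<bar> \<le> \<delta> + K * \<bar>t - t0\<bar>"
      using both[of t0 t] both[of t t0] td \<tau> by (cases "t0 \<le> t") (auto simp: abs_minus_commute)
    also have "K * \<bar>t - t0\<bar> \<le> K * d" using K t by (intro mult_left_mono) auto
    finally have "\<bar>w t x0 - w t0 x0\<bar> \<le> 2 * \<delta>" using dK by simp
    moreover have "\<bar>w t x - w t x0\<bar> \<le> \<Lambda> * norm (x - x0)" using space[OF td] x d by simp
    moreover have "\<Lambda> * norm (x - x0) \<le> \<Lambda> * d" using x \<Lambda> by (intro mult_left_mono) auto
    ultimately show "\<bar>w t x - w t0 x0\<bar> \<le> e" using d\<Lambda> unfolding \<delta>_def by linarith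
  qed
qed

section \<open>Initial trace and passage to the limit\<close>

text \<open>The barrier is \<open>A - C |x - x0|^2 - K t\<close> with
  \<open>C = (P + 1)/\<rho>^2\<close>. It becomes negative before the sphere of radius
  \<open>\<rho>\<close> is reached, where \<open>u \<ge> 0\<close> suffices. \<open>K\<close> makes
  its heat operator \<open>- F\<close>, which is at most \<open>- f(u)\<close> wherever the barrier
  exceeds \<open>u\<close>. The resulting rate depends only on \<open>P\<close>,
  \<open>\<rho>\<close>, \<open>F\<close> and the dimension.\<close>

lemma initial_lower_barrier:
  fixes u :: "real \<Rightarrow> 'a::euclidean_space \<Rightarrow> real"
  assumes u: "heat_approx (ball x0 \<rho>) u (\<lambda>t x. - f (u t x))" and \<rho>: "\<rho> > 0"
    and nonneg: "\<And>t x. t > 0 \<Longrightarrow> x \<in> ball x0 \<rho> \<Longrightarrow> 0 \<le> u t x"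
    and init: "\<And>e. e > 0 \<Longrightarrow> \<forall>\<^sub>F t in at_right 0. \<forall>x\<in>ball x0 \<rho>. \<psi> x - u t x < e"
    and A: "\<And>x. x \<in> ball x0 \<rho> \<Longrightarrow> A \<le> \<psi> x" "A \<le> P" and P: "P \<ge> 0"
    and f: "\<And>s. 0 \<le> s \<Longrightarrow> s \<le> P \<Longrightarrow> f s \<le> F" and F: "F \<ge> 0" and t: "t > 0"
  shows "u t x0 \<ge> A - (2 * real DIM('a) * ((P + 1) / \<rho>\<^sup>2) + F) * t"
proof -
  define C where "C = (P + 1) / \<rho>\<^sup>2"
  define K where "K = 2 * real DIM('a) * C + F"
  have C: "C > 0" using P \<rho> by (simp add: C_def)
  have K: "K \<ge> 0" using C F by (simp add: K_def)
  define z where "z = (\<lambda>t x. A - C * ((x - x0) \<bullet> (x - x0)) - K * t)"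
  define w where "w = (\<lambda>t x. z t x - u t x)"
  have z_le: "z s y \<le> A - C * ((y - x0) \<bullet> (y - x0))" "z s y \<le> A" if "s > 0" for s y
  proof -
    have "K * s \<ge> 0" "C * ((y - x0) \<bullet> (y - x0)) \<ge> 0" using K C that by auto
    then show "z s y \<le> A - C * ((y - x0) \<bullet> (y - x0))" "z s y \<le> A" unfolding z_def by linarith+
  qed
  have w: "heat_approx (ball x0 \<rho>) w (\<lambda>t x. (- K + 2 * real DIM('a) * C) - - f (u t x))"
    unfolding w_def z_def by (intro heat_approx_diff u heat_smooth_imp_approx heat_smooth_paraboloid)
  have "w t x0 \<le> 0"
  proof (rule heat_approx_maximum_principle[OF w open_ball _ _ t order_refl])
    show "x0 \<in> ball x0 \<rho>" using \<rho> by simp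
  next
    fix s y assume s: "0 < s" "y \<in> ball x0 \<rho>" "0 < w s y"
    then have "u s y \<le> P" using z_le(2)[OF s(1), of y] A(2) by (simp add: w_def)
    then have "f (u s y) \<le> F" using nonneg[OF s(1,2)] by (intro f)
    then show "- K + 2 * real DIM('a) * C - - f (u s y) \<le> 0" by (simp add: K_def)
  next
    fix \<theta> :: real assume \<theta>: "\<theta> > 0"
    obtain t1' where t1': "t1' > 0" "\<And>s y. 0 < s \<Longrightarrow> s < t1' \<Longrightarrow> y \<in> ball x0 \<rho> \<Longrightarrow> \<psi> y - u s y < \<theta>"
      using init[OF \<theta>] unfolding eventually_at_right_field by blast
    define t1 where "t1 = t1' / 2"
    have t1: "t1 > 0" "t1 < t1'" using t1'(1) by (auto simp: t1_def)
    \<comment> \<open>The radius at which \<open>C |x - x0|^2 = P\<close>; beyond it the barrier is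
      nonpositive.\<close>
    define \<rho>' where "\<rho>' = \<rho> * sqrt (P / (P + 1))"
    have \<rho>': "0 \<le> \<rho>'" "\<rho>' < \<rho>"
    proof -
      have "sqrt (P / (P + 1)) < sqrt 1" using P by (subst real_sqrt_less_iff) simp
      then show "0 \<le> \<rho>'" "\<rho>' < \<rho>" using \<rho> P by (auto simp: \<rho>'_def)
    qed
    show "compact {(s,y). 0 < s \<and> s \<le> t \<and> y \<in> ball x0 \<rho> \<and> w s y \<ge> \<theta>}"
    proof (rule compact_superlevel[where lo=t1 and B="cball x0 \<rho>'"])
      have "{t1..t} \<times> cball x0 \<rho>' \<subseteq> {0<..} \<times> ball x0 \<rho>" using t1 \<rho>' by auto
      moreover have "continuous_on ({0<..} \<times> ball x0 \<rho>) (\<lambda>(t, x). w t x)"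
        using w unfolding heat_approx_def by (rule conjunct1)
      ultimately show "continuous_on ({t1..t} \<times> cball x0 \<rho>') (\<lambda>(t, x). w t x)"
        by (rule continuous_on_subset[rotated])
    next
      fix s y
      show "(0 < s \<and> s \<le> t \<and> y \<in> ball x0 \<rho> \<and> w s y \<ge> \<theta>) = (t1 \<le> s \<and> s \<le> t \<and> y \<in> cball x0 \<rho>' \<and> w s y \<ge> \<theta>)"
      proof (intro iffI conjI; elim conjE)
        assume s: "0 < s" "y \<in> ball x0 \<rho>" "w s y \<ge> \<theta>"
        show "t1 \<le> s"
        proof (rule ccontr)
          assume "\<not> t1 \<le> s"
          then have "\<psi> y - u s y < \<theta>" using t1'(2)[OF s(1) _ s(2)] t1 by simp
          then show False using s(3) z_le(2)[OF s(1), of y] A(1)[OF s(2)] unfolding w_def by linarith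
        qed
        have "0 < z s y" using s(3) nonneg[OF s(1,2)] \<theta> by (simp add: w_def)
        then have "C * ((y - x0) \<bullet> (y - x0)) \<le> P" using z_le(1)[OF s(1), of y] A(2) by linarith
        then have "(norm (y - x0))\<^sup>2 \<le> \<rho>\<^sup>2 * (P / (P + 1))"
          using P \<rho> by (simp add: C_def dot_square_norm field_simps)
        also have "\<dots> = \<rho>'\<^sup>2" using P by (simp add: \<rho>'_def power_mult_distrib)
        finally have "norm (y - x0) \<le> \<rho>'" using \<rho>'(1) by (rule power2_le_imp_le)
        then show "y \<in> cball x0 \<rho>'" by (simp add: dist_norm norm_minus_commute)
      next
        assume "t1 \<le> s" "y \<in> cball x0 \<rho>'"
        then show "0 < s" "y \<in> ball x0 \<rho>" using t1 \<rho>' by auto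
      qed
    qed (rule compact_cball)
  qed
  then show ?thesis by (simp add: w_def z_def K_def C_def)
qed

section \<open>Passage to the limit in the weak formulation\<close>

lemma weak_sol_test_integrand_continuous:
  fixes u :: "real \<Rightarrow> 'a::euclidean_space \<Rightarrow> real"
  assumes u: "continuous_on ({0<..} \<times> \<Omega>) (\<lambda>(t,x). u t x)" and \<Omega>: "open \<Omega>"
    and nonneg: "\<And>t x. t > 0 \<Longrightarrow> x \<in> \<Omega> \<Longrightarrow> 0 \<le> u t x" and h: "continuous_on {0..} h"
    and K: "compact K" "K \<subseteq> {0<..} \<times> \<Omega>" "\<And>p. p \<notin> K \<Longrightarrow> a p = 0 \<and> c p = 0"
    and ac: "continuous_on UNIV a" "continuous_on UNIV c"
  shows "continuous_on UNIV (\<lambda>p. if p \<in> {0<..} \<times> \<Omega> then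
            - u (fst p) (snd p) * a p + u (fst p) (snd p) * h (u (fst p) (snd p)) * c p else 0)" (is "continuous_on UNIV ?G")
proof -
  let ?S = "{0::real<..} \<times> \<Omega>"
  have S: "open ?S" using \<Omega> by (intro open_Times) auto
  have cu: "continuous_on ?S (\<lambda>p. u (fst p) (snd p))" using u by (simp add: case_prod_beta)
  have "continuous_on ?S (\<lambda>p. - u (fst p) (snd p) * a p + u (fst p) (snd p) * h (u (fst p) (snd p)) * c p)"
    by (intro continuous_intros cu continuous_on_subset[OF ac(1)] continuous_on_subset[OF ac(2)]
        continuous_on_compose2[OF h cu]) (auto simp: nonneg)
  then have "continuous_on ?S ?G" by (rule continuous_on_eq) auto
  moreover have "continuous_on (- K) ?G"
    by (rule continuous_on_eq[OF continuous_on_const[of _ 0]]) (use K(3) in auto)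
  moreover have "open (- K)" using K(1) compact_imp_closed by blast
  ultimately have "continuous_on (?S \<union> - K) ?G" using S by (intro continuous_on_open_Un)
  moreover have "?S \<union> - K = UNIV" using K(2) by blast
  ultimately show ?thesis by simp
qed

text \<open>Passes from the Frechet data in \<open>test_fun\<close> to the directional derivatives
  in \<open>weak_sol\<close>. They vanish off \<open>K\<close> because its complement is open and
  \<open>\<phi>\<close> is locally zero there.\<close>

lemma test_fun_derivs:
  fixes \<phi> :: "real \<times> 'a::euclidean_space \<Rightarrow> real"
  assumes "test_fun \<Omega> \<phi>"
  obtains K where "compact K" "K \<subseteq> {0<..} \<times> \<Omega>"
    "\<And>p. p \<notin> K \<Longrightarrow> \<phi> p = 0" "\<And>p v. p \<notin> K \<Longrightarrow> dirderiv \<phi> p v = 0" "\<And>p v. p \<notin> K \<Longrightarrow> dirderiv2 \<phi> p v = 0"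
    "continuous_on UNIV \<phi>" "\<And>v. continuous_on UNIV (\<lambda>p. dirderiv \<phi> p v)" "\<And>v. continuous_on UNIV (\<lambda>p. dirderiv2 \<phi> p v)"
proof -
  obtain K D D2 where K: "compact K" "K \<subseteq> {0<..} \<times> \<Omega>" "\<And>p. p \<notin> K \<Longrightarrow> \<phi> p = 0"
    and D: "\<And>p. (\<phi> has_derivative blinfun_apply (D p)) (at p)"
    and D2: "\<And>p. (D has_derivative blinfun_apply (D2 p)) (at p)" and cD2: "continuous_on UNIV D2"
    using assms unfolding test_fun_def by blast
  have line: "((\<lambda>s. p + s *\<^sub>R v) has_derivative (\<lambda>s. s *\<^sub>R v)) (at 0)" for p v :: "real \<times> 'a"
    by (auto intro!: derivative_eq_intros)
  have d1: "dirderiv \<phi> p v = blinfun_apply (D p) v" for p v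
  proof -
    have "((\<lambda>s. \<phi> (p + s *\<^sub>R v)) has_derivative (\<lambda>s. blinfun_apply (D p) (s *\<^sub>R v))) (at 0)"
      using has_derivative_compose[OF line, of \<phi> "blinfun_apply (D p)" p v] D[of p] by simp
    then have "((\<lambda>s. \<phi> (p + s *\<^sub>R v)) has_real_derivative blinfun_apply (D p) v) (at 0)"
      unfolding has_field_derivative_def by (simp add: blinfun.scaleR_right mult.commute[of _ "blinfun_apply (D p) v"] fun_eq_iff)
    then show ?thesis unfolding dirderiv_def by (rule DERIV_imp_deriv)
  qed
  have d2: "dirderiv2 \<phi> p v = blinfun_apply (blinfun_apply (D2 p) v) v" for p v
  proof -
    have "((\<lambda>s. D (p + s *\<^sub>R v)) has_derivative (\<lambda>s. blinfun_apply (D2 p) (s *\<^sub>R v))) (at 0)"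
      using has_derivative_compose[OF line, of D "blinfun_apply (D2 p)" p v] D2[of p] by simp
    then have "((\<lambda>s. blinfun_apply (D (p + s *\<^sub>R v)) v) has_derivative (\<lambda>s. blinfun_apply (blinfun_apply (D2 p) (s *\<^sub>R v)) v)) (at 0)"
      by (rule bounded_linear.has_derivative[OF blinfun.bounded_linear_left])
    then have "((\<lambda>s. blinfun_apply (D (p + s *\<^sub>R v)) v) has_real_derivative blinfun_apply (blinfun_apply (D2 p) v) v) (at 0)"
      unfolding has_field_derivative_def
      by (simp add: blinfun.scaleR_right blinfun.scaleR_left mult.commute[of _ "blinfun_apply (blinfun_apply (D2 p) v) v"] fun_eq_iff)
    then show ?thesis unfolding dirderiv2_def d1 by (rule DERIV_imp_deriv)
  qed
  have opn: "open (- K)" using K(1) compact_imp_closed by blast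
  have D0: "D p = 0" if "p \<notin> K" for p
  proof -
    have "(\<phi> has_derivative (\<lambda>_. 0)) (at p)"
      by (rule has_derivative_transform_within_open[OF has_derivative_const opn]) (use that K(3) in auto)
    from fun_cong[OF has_derivative_unique[OF D this]] show ?thesis by (intro blinfun_eqI) simp
  qed
  have D20: "D2 p = 0" if "p \<notin> K" for p
  proof -
    have "(D has_derivative (\<lambda>_. 0)) (at p)"
      by (rule has_derivative_transform_within_open[OF has_derivative_const opn]) (use that D0 in auto)
    from fun_cong[OF has_derivative_unique[OF D2 this]] show ?thesis by (intro blinfun_eqI) simp
  qed
  have "continuous_on UNIV \<phi>" by (intro continuous_at_imp_continuous_on ballI has_derivative_continuous[OF D])
  moreover have cD: "continuous_on UNIV D" by (intro continuous_at_imp_continuous_on ballI has_derivative_continuous[OF D2])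
  moreover have "continuous_on UNIV (\<lambda>p. dirderiv \<phi> p v)" for v unfolding d1 by (intro continuous_intros cD)
  moreover have "continuous_on UNIV (\<lambda>p. dirderiv2 \<phi> p v)" for v unfolding d2 by (intro continuous_intros cD2)
  ultimately show thesis using that[OF K] by (simp add: d1 d2 D0 D20)
qed

text \<open>All derivatives fall on the test function, so pointwise convergence with domination is
  enough. The support \<open>K\<close> lies in the \<open>n\<close>-th ball for all large
  \<open>n\<close>, and \<open>0 \<le> u \<le> \<beta>\<close> with monotone \<open>h\<close> gives
  a continuous dominating function on a box around \<open>K\<close>.\<close>

lemma weak_sol_limit:
  fixes u :: "nat \<Rightarrow> real \<Rightarrow> 'a::euclidean_space \<Rightarrow> real"
  assumes u: "\<And>n. n \<ge> 1 \<Longrightarrow> weak_sol h (ball 0 (real n)) (u n)"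
    and nonneg: "\<And>n t x. n \<ge> 1 \<Longrightarrow> t > 0 \<Longrightarrow> x \<in> ball 0 (real n) \<Longrightarrow> 0 \<le> u n t x"
    and bound: "\<And>n t x. n \<ge> 1 \<Longrightarrow> t > 0 \<Longrightarrow> x \<in> ball 0 (real n) \<Longrightarrow> u n t x \<le> \<beta> x"
    and \<beta>: "continuous_on UNIV \<beta>"
    and lim: "\<And>t x. t > 0 \<Longrightarrow> (\<lambda>n. u n t x) \<longlonglongrightarrow> U t x"
    and h: "continuous_on {0..} h" "mono_on {0..} h" "\<And>s. s \<ge> 0 \<Longrightarrow> h s \<ge> 0"
    and U: "continuous_on ({0<..} \<times> UNIV) (\<lambda>(t,x). U t x)"
  shows "weak_sol h UNIV U"
  unfolding weak_sol_def
proof (intro conjI allI impI)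
  show "continuous_on ({0<..} \<times> UNIV) (\<lambda>(t,x). U t x)" by (rule U)
  fix \<phi> :: "real \<times> 'a \<Rightarrow> real" assume \<phi>: "test_fun UNIV \<phi>"
  obtain K where K: "compact K" "K \<subseteq> {0<..} \<times> UNIV"
    "\<And>p. p \<notin> K \<Longrightarrow> \<phi> p = 0" "\<And>p v. p \<notin> K \<Longrightarrow> dirderiv \<phi> p v = 0" "\<And>p v. p \<notin> K \<Longrightarrow> dirderiv2 \<phi> p v = 0"
    and c\<phi>: "continuous_on UNIV \<phi>" "\<And>v. continuous_on UNIV (\<lambda>p. dirderiv \<phi> p v)" "\<And>v. continuous_on UNIV (\<lambda>p. dirderiv2 \<phi> p v)"
    using test_fun_derivs[OF \<phi>] by blast
  define a where "a = (\<lambda>p. dirderiv \<phi> p (1, 0) + (\<Sum>b\<in>Basis. dirderiv2 \<phi> p (0, b)))"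
  have ca: "continuous_on UNIV a" unfolding a_def by (intro continuous_intros c\<phi>)
  have a0: "p \<notin> K \<Longrightarrow> a p = 0" for p by (simp add: a_def K)
  define G where "G = (\<lambda>\<Omega> u p. if p \<in> {0<..} \<times> \<Omega> then
     - u (fst p) (snd p) * a p + u (fst p) (snd p) * h (u (fst p) (snd p)) * \<phi> p else (0::real))"
  have cont\<beta>: "continuous_on A \<beta>" for A using \<beta> continuous_on_subset by blast
  obtain r where r: "r > 0" "\<And>p. p \<in> K \<Longrightarrow> norm p \<le> r"
    using compact_imp_bounded[OF K(1)] bounded_pos by blast
  obtain n0 where n0: "real n0 > r" using reals_Archimedean2 by blast
  have n0': "n0 \<ge> 1" using n0 r(1) by (cases n0) auto
  have KB: "K \<subseteq> {0<..} \<times> ball 0 (real n)" if "n \<ge> n0" for n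
  proof
    fix p assume p: "p \<in> K"
    have "norm (snd p) \<le> r" using r(2)[OF p] norm_snd_le[of "snd p" "fst p"] by simp
    also have "r < real n" using n0 that by linarith
    finally have "snd p \<in> ball 0 (real n)" by simp
    then show "p \<in> {0<..} \<times> ball 0 (real n)" using K(2) p by (auto simp: mem_Times_iff)
  qed
  have weak: "integral UNIV (G (ball 0 (real n)) (u n)) = 0" if n: "n \<ge> n0" for n
  proof -
    obtain D D2 where "\<forall>p. (\<phi> has_derivative blinfun_apply (D p)) (at p)" "\<forall>p. (D has_derivative blinfun_apply (D2 p)) (at p)" "continuous_on UNIV D2"
      using \<phi> unfolding test_fun_def by blast
    then have "test_fun (ball 0 (real n)) \<phi>"
      unfolding test_fun_def using K(1,3) KB[OF n] by blast
    then show ?thesis using u[of n] n n0' unfolding weak_sol_def G_def a_def by auto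
  qed
  have Gcont: "continuous_on UNIV (G (ball 0 (real n)) (u n))" if n: "n \<ge> n0" for n
    unfolding G_def
    by (rule weak_sol_test_integrand_continuous[OF _ open_ball _ h(1) K(1) KB[OF n] _ ca c\<phi>(1)])
       (use u[of n] nonneg[of n] n n0' a0 K(3) in \<open>auto simp: weak_sol_def\<close>)
  obtain Q where Q: "K \<subseteq> cbox (- Q) Q"
    using bounded_subset_cbox_symmetric[OF compact_imp_bounded[OF K(1)]] by blast
  let ?Q = "cbox (- Q) Q"
  have G0: "G \<Omega> u p = 0" if "p \<notin> K" for \<Omega> u p using that a0 K(3) by (simp add: G_def)
  have intQ: "integral UNIV (G \<Omega> u) = integral ?Q (G \<Omega> u)" for \<Omega> u
  proof -
    have "G \<Omega> u p = (if p \<in> ?Q then G \<Omega> u p else 0)" for p using G0[of p] Q by auto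
    then have "G \<Omega> u = (\<lambda>p. if p \<in> ?Q then G \<Omega> u p else 0)" by (rule ext)
    then show ?thesis by (metis integral_restrict_UNIV)
  qed
  \<comment> \<open>The absolute value keeps the argument of \<open>h\<close> nonnegative, where
    \<open>h\<close> is continuous and monotone.\<close>
  define H where "H = (\<lambda>p::real \<times> 'a. \<bar>\<beta> (snd p)\<bar> * \<bar>a p\<bar> + \<bar>\<beta> (snd p)\<bar> * h \<bar>\<beta> (snd p)\<bar> * \<bar>\<phi> p\<bar>)"
  have cH: "continuous_on UNIV H" unfolding H_def
    by (intro continuous_intros ca c\<phi>(1) continuous_on_compose2[OF \<beta>] continuous_on_compose2[OF h(1)]) auto
  have "(\<lambda>n. integral ?Q (G (ball 0 (real (n + n0))) (u (n + n0)))) \<longlonglongrightarrow> integral ?Q (G UNIV U)"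
  proof (rule dominated_convergence(2)[where h=H])
    show "G (ball 0 (real (n + n0))) (u (n + n0)) integrable_on ?Q" for n
      by (rule integrable_continuous) (use Gcont[of "n + n0"] continuous_on_subset in auto)
    show "H integrable_on ?Q" by (rule integrable_continuous) (use cH continuous_on_subset in auto)
  next
    fix n p
    show "norm (G (ball 0 (real (n + n0))) (u (n + n0)) p) \<le> H p"
    proof (cases "p \<in> {0<..} \<times> ball 0 (real (n + n0))")
      case True
      define y where "y = u (n + n0) (fst p) (snd p)"
      have y: "0 \<le> y" "y \<le> \<bar>\<beta> (snd p)\<bar>"
        using nonneg[of "n + n0" "fst p" "snd p"] bound[of "n + n0" "fst p" "snd p"] True n0'
        by (auto simp: y_def mem_Times_iff)
      have hy: "h y \<le> h \<bar>\<beta> (snd p)\<bar>" using y by (intro mono_onD[OF h(2)]) auto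
      have "norm (G (ball 0 (real (n + n0))) (u (n + n0)) p) = \<bar>- y * a p + y * h y * \<phi> p\<bar>"
        using True by (simp add: G_def y_def)
      also have "\<dots> \<le> y * \<bar>a p\<bar> + y * h y * \<bar>\<phi> p\<bar>"
        using abs_triangle_ineq[of "- y * a p" "y * h y * \<phi> p"] y h(3)[of y] by (simp add: abs_mult)
      also have "\<dots> \<le> H p" unfolding H_def using y hy h(3)[of y]
        by (intro add_mono mult_mono) auto
      finally show ?thesis .
    next
      case False
      then show ?thesis using h(3)[of "\<bar>\<beta> (snd p)\<bar>"] by (simp add: G_def H_def)
    qed
  next
    fix p :: "real \<times> 'a"
    show "(\<lambda>n. G (ball 0 (real (n + n0))) (u (n + n0)) p) \<longlonglongrightarrow> G UNIV U p"
    proof (cases "p \<in> K")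
      case False
      then show ?thesis by (simp add: G0)
    next
      case True
      have p: "fst p > 0" "\<And>n. p \<in> {0<..} \<times> ball 0 (real (n + n0))"
        using subsetD[OF K(2) True] subsetD[OF KB[of "_ + n0"] True] by (auto simp only: mem_Times_iff le_add2 greaterThan_iff)
      have l: "(\<lambda>n. u (n + n0) (fst p) (snd p)) \<longlonglongrightarrow> U (fst p) (snd p)"
        using LIMSEQ_ignore_initial_segment[OF lim[OF p(1)]] .
      have nn: "\<forall>n. u (n + n0) (fst p) (snd p) \<in> {0..}"
        using nonneg[of "_ + n0" "fst p" "snd p"] p n0' by (auto simp: mem_Times_iff)
      have U0: "U (fst p) (snd p) \<in> {0..}"
        using LIMSEQ_le_const[OF l, of 0] nn by auto
      have "(\<lambda>n. h (u (n + n0) (fst p) (snd p))) \<longlonglongrightarrow> h (U (fst p) (snd p))"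
        using continuous_on_tendsto_compose[OF h(1) l U0] nn by simp
      then have "(\<lambda>n. - u (n + n0) (fst p) (snd p) * a p + u (n + n0) (fst p) (snd p) * h (u (n + n0) (fst p) (snd p)) * \<phi> p)
          \<longlonglongrightarrow> - U (fst p) (snd p) * a p + U (fst p) (snd p) * h (U (fst p) (snd p)) * \<phi> p"
        by (intro tendsto_intros l)
      moreover have "p \<in> {0<..} \<times> UNIV" using p(1) by (simp add: mem_Times_iff)
      ultimately show ?thesis using p(2) by (simp only: G_def if_True)
    qed
  qed
  moreover have "integral ?Q (G (ball 0 (real (n + n0))) (u (n + n0))) = 0" for n
    using weak[of "n + n0"] intQ by simp
  ultimately have "integral ?Q (G UNIV U) = 0" by (simp only: LIMSEQ_const_iff)
  then show "integral UNIV (\<lambda>p. if p \<in> {0<..} \<times> UNIV then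
            - U (fst p) (snd p) * (dirderiv \<phi> p (1, 0) + (\<Sum>b\<in>Basis. dirderiv2 \<phi> p (0, b)))
            + U (fst p) (snd p) * h (U (fst p) (snd p)) * \<phi> p
          else 0) = 0" using intQ[of UNIV U] unfolding G_def a_def by simp
qed

section \<open>Monotone approximation, the limit solution, and its blow-up\<close>

theorem theoremB:
  fixes h :: "real \<Rightarrow> real" and g :: "'a::euclidean_space \<Rightarrow> real"
    and V :: "real \<Rightarrow> real \<Rightarrow> real"
    and u :: "real \<Rightarrow> nat \<Rightarrow> real \<Rightarrow> 'a \<Rightarrow> real"
  assumes h_cont: "continuous_on {0..} h"
    and h_mono: "mono_on {0..} h"
    and h_nonneg: "\<forall>s\<ge>0. 0 \<le> h s"
    and h_zero: "\<forall>s\<ge>0. h s = 0 \<longleftrightarrow> s = 0"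
    and h_convex: "convex_on {0..} (\<lambda>r. r * h r)"
    and h_int: "\<exists>c>0. (\<lambda>s. 1 / (s * h s)) integrable_on {c..}"
    and KO: "\<forall>a>0. \<not> ((\<lambda>s. 1 / sqrt (integral {0..s} (\<lambda>t. t * h t))) integrable_on {a..})"
    and V_sol: "\<forall>a>0. radial_sol h DIM('a) a (V a)"
    and g_cont: "continuous_on UNIV g"
    and g_nonneg: "\<forall>x. 0 \<le> g x"
    and g_growth: "\<forall>a>0. filterlim (\<lambda>x. g x / V a (norm x)) at_top at_infinity"
    and u_sol: "\<forall>a>0. \<forall>n::nat. n \<ge> 1 \<longrightarrow>
                  dirichlet_sol h (real n) (V a (real n)) (\<lambda>x. min (V a (norm x)) (g x)) (u a n)"
  shows "\<exists>U :: real \<Rightarrow> real \<Rightarrow> 'a \<Rightarrow> real.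
           (\<forall>a>0.
              (\<forall>m::nat. \<forall>n1 n2. m < n1 \<and> n1 \<le> n2 \<longrightarrow>
                  (\<forall>t>0. \<forall>x\<in>ball 0 (real m). u a n2 t x \<le> u a n1 t x)) \<and>
              (\<forall>m::nat. \<forall>t>0. \<forall>x\<in>ball 0 (real m). (\<lambda>n. u a n t x) \<longlonglongrightarrow> U a t x) \<and>
              sol_init h UNIV (\<lambda>x. min (V a (norm x)) (g x)) (U a)) \<and>
           (\<forall>t>0. \<forall>x. filterlim (\<lambda>a. U a t x) at_top at_top)"
proof -
  obtain m where m: "DIM('a) = Suc m" using DIM_positive[where 'a='a] by (cases "DIM('a)") auto
  define f where "f = (\<lambda>s. s * h s)"
  have h0: "0 \<le> h s" if "s \<ge> 0" for s using h_nonneg that by blast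
  have h_pos: "h s > 0" if "s > 0" for s using h0[of s] h_zero that by (auto simp: le_less)
  have f_mono: "f r \<le> f s" if "0 \<le> r" "r \<le> s" for r s
    unfolding f_def using that h0 by (intro mult_mono mono_onD[OF h_mono]) auto
  have f_nonneg: "0 \<le> f s" if "0 \<le> s" for s using that h0 by (simp add: f_def)
  have f_super: "f r + f s \<le> f (r + s)" if "0 \<le> r" "0 \<le> s" for r s
    unfolding f_def using that by (intro convex_superadditive[OF h_convex]) auto
  have rad: "radial h m a (V a)" if "a > 0" for a
    using that V_sol h_cont h0 m by (intro radial.intro) auto
  note V_ge = radial.V_ge[OF rad] and V_mono = radial.V_mono[OF rad]
  have V_pos: "V a r > 0" if "a > 0" "r \<ge> 0" for a r using V_ge[OF that] that by simp
  have V_cont: "continuous_on UNIV (\<lambda>x::'a. V a (norm x))" if "a > 0" for a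
    by (rule continuous_on_compose2[OF radial.V_cont[OF rad[OF that]]]) (auto intro!: continuous_intros)
  have V_smooth: "heat_smooth \<Omega> (\<lambda>t x. V a (norm x)) (\<lambda>t x. - f (V a (norm x)))" if "a > 0" for a and \<Omega> :: "'a set"
    unfolding f_def by (rule radial.heat_smooth_radial[OF rad[OF that] m])
  define \<psi> where "\<psi> = (\<lambda>a x. min (V a (norm x)) (g x))"
  have sol: "dirichlet_sol h (real n) (V a (real n)) (\<psi> a) (u a n)" if "a > 0" "n \<ge> 1" for a n
    using u_sol that unfolding \<psi>_def by blast
  have u_weak: "weak_sol h (ball 0 (real n)) (u a n)" if "a > 0" "n \<ge> 1" for a n
    using sol[OF that] by (simp add: dirichlet_sol_def sol_init_def)
  have u_nonneg: "0 \<le> u a n t x" if "a > 0" "n \<ge> 1" "t > 0" "x \<in> ball 0 (real n)" for a n t x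
    using sol[OF that(1,2)] that(3,4) by (auto simp: dirichlet_sol_def sol_init_def)
  have u_init: "\<forall>\<^sub>F t in at_right 0. \<forall>x\<in>K. \<bar>u a n t x - \<psi> a x\<bar> < e"
    if "a > 0" "n \<ge> 1" "compact K" "K \<subseteq> ball 0 (real n)" "e > 0" for a n K e
    using sol[OF that(1,2)] that(3-5) by (auto simp: dirichlet_sol_def sol_init_def)
  have u_cont: "continuous_on ({0<..} \<times> cball 0 (real n)) (\<lambda>(t,x). u a n t x)" if "a > 0" "n \<ge> 1" for a n
    using sol[OF that] by (simp add: dirichlet_sol_def)
  have u_bd: "u a n t x = V a (real n)" if "a > 0" "n \<ge> 1" "t > 0" "norm x = real n" for a n t x
    using sol[OF that(1,2)] that(3,4) by (simp add: dirichlet_sol_def)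
  have u_approx: "heat_approx (ball 0 (real n)) (u a n) (\<lambda>t x. - f (u a n t x))" if "a > 0" "n \<ge> 1" for a n
    unfolding f_def using u_nonneg[OF that] by (intro weak_sol_heat_approx[OF u_weak[OF that] open_ball _ h_cont]) auto
  have u_bounded: "\<exists>M. \<forall>t>0. \<forall>x\<in>ball 0 (real n). u a n t x \<le> M" if an: "a > 0" "n \<ge> 1" for a n
  proof -
    have "bounded ((\<lambda>(t,x). u a n t x) ` ({0<..} \<times> ball 0 (real n)))"
      using sol[OF an] by (simp add: dirichlet_sol_def)
    then obtain M where M: "\<And>z. z \<in> (\<lambda>(t,x). u a n t x) ` ({0<..} \<times> ball 0 (real n)) \<Longrightarrow> norm z \<le> M"
      unfolding bounded_iff by blast
    have "u a n t x \<le> M" if "t > 0" "x \<in> ball 0 (real n)" for t x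
      using M[of "u a n t x"] that by force
    then show ?thesis by blast
  qed
  have u_le_V: "u a n t x \<le> V a (norm x)" if an: "a > 0" "n \<ge> 1" and t: "t > 0" and x: "x \<in> ball 0 (real n)" for a n t x
  proof -
    obtain M where M: "\<And>t x. t > 0 \<Longrightarrow> x \<in> ball 0 (real n) \<Longrightarrow> u a n t x \<le> M" using u_bounded[OF an] by blast
    have "u a n t x - V a (norm x) \<le> 0"
    proof (rule ball_comparison[OF heat_approx_diff[OF u_approx[OF an] heat_smooth_imp_approx[OF V_smooth[OF an(1)]]], where M=M])
      show "continuous_on ({0<..} \<times> cball 0 (real n)) (\<lambda>(t, x). u a n t x - V a (norm x))"
        using u_cont[OF an] unfolding case_prod_beta
        by (intro continuous_intros continuous_on_compose2[OF V_cont[OF an(1)]]) auto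
    next
      fix t :: real and x :: 'a assume "t > 0" "x \<in> ball 0 (real n)"
      then show "u a n t x - V a (norm x) \<le> M" using M[of t x] V_pos[OF an(1), of "norm x"] by simp
    next
      fix K :: "'a set" and e assume K: "compact K" "K \<subseteq> ball 0 (real n)" "(e::real) > 0"
      show "\<forall>\<^sub>F t in at_right 0. \<forall>x\<in>K. u a n t x - V a (norm x) < e"
        using u_init[OF an K] by eventually_elim (force simp: \<psi>_def)
    next
      fix t :: real and x :: 'a assume "t > 0" "x \<in> ball 0 (real n)" "0 < u a n t x - V a (norm x)"
      then show "- f (u a n t x) - - f (V a (norm x)) \<le> 0"
        using f_mono[of "V a (norm x)" "u a n t x"] V_pos[OF an(1), of "norm x"] by simp
    qed (use an t x u_bd[OF an] in auto)
    then show ?thesis by simp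
  qed
  have u_mono: "u a n2 t x \<le> u a n1 t x" if a: "a > 0" and n: "1 \<le> n1" "n1 \<le> n2" and t: "t > 0" and x: "x \<in> ball 0 (real n1)" for a n1 n2 t x
  proof -
    have n2: "1 \<le> n2" using n by simp
    have sub: "ball 0 (real n1) \<subseteq> ball (0::'a) (real n2)" "cball 0 (real n1) \<subseteq> cball (0::'a) (real n2)" using n by auto
    obtain M where M: "\<And>t x. t > 0 \<Longrightarrow> x \<in> ball 0 (real n2) \<Longrightarrow> u a n2 t x \<le> M" using u_bounded[OF a n2] by blast
    have "u a n2 t x - u a n1 t x \<le> 0"
    proof (rule ball_comparison[OF heat_approx_diff[OF heat_approx_mono[OF u_approx[OF a n2] sub(1)] u_approx[OF a n(1)]], where M=M])
      have "{0<..} \<times> cball 0 (real n1) \<subseteq> {0::real<..} \<times> cball (0::'a) (real n2)" using sub by blast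
      from continuous_on_subset[OF u_cont[OF a n2] this] u_cont[OF a n(1)]
      show "continuous_on ({0<..} \<times> cball 0 (real n1)) (\<lambda>(t, x). u a n2 t x - u a n1 t x)"
        unfolding case_prod_beta by (intro continuous_intros)
    next
      fix t :: real and x :: 'a assume tx: "t > 0" "norm x = real n1"
      \<comment> \<open>The bound by \<open>V a\<close> was proved on the open ball only, so for
        \<open>n1 = n2\<close> the boundary value is used directly.\<close>
      have "u a n2 t x \<le> V a (norm x)"
      proof (cases "n1 = n2")
        case True
        then show ?thesis using u_bd[OF a n2 tx(1)] tx(2) by simp
      next
        case False
        then show ?thesis using u_le_V[OF a n2 tx(1), of x] tx(2) n by simp
      qed
      then show "u a n2 t x - u a n1 t x \<le> 0" using u_bd[OF a n(1) tx] tx(2) by simp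
    next
      fix t :: real and x :: 'a assume tx: "t > 0" "x \<in> ball 0 (real n1)"
      have "x \<in> ball 0 (real n2)" using tx(2) sub(1) by blast
      then show "u a n2 t x - u a n1 t x \<le> M" using M[OF tx(1)] u_nonneg[OF a n(1) tx] by force
    next
      fix K :: "'a set" and e assume K: "compact K" "K \<subseteq> ball 0 (real n1)" "(e::real) > 0"
      have K2: "K \<subseteq> ball 0 (real n2)" "e / 2 > 0" using K sub(1) by auto
      show "\<forall>\<^sub>F t in at_right 0. \<forall>x\<in>K. u a n2 t x - u a n1 t x < e"
        using u_init[OF a n2 K(1) K2] u_init[OF a n(1) K(1,2) K2(2)]
      proof eventually_elim
        case (elim t)
        show ?case
        proof
          fix x assume "x \<in> K"
          with elim have "\<bar>u a n2 t x - \<psi> a x\<bar> < e / 2" "\<bar>u a n1 t x - \<psi> a x\<bar> < e / 2" by auto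
          then show "u a n2 t x - u a n1 t x < e" unfolding abs_less_iff by linarith
        qed
      qed
    next
      fix t :: real and x :: 'a assume tx: "t > 0" "x \<in> ball 0 (real n1)" "0 < u a n2 t x - u a n1 t x"
      then show "- f (u a n2 t x) - - f (u a n1 t x) \<le> 0"
        using f_mono[of "u a n1 t x" "u a n2 t x"] u_nonneg[OF a n(1) tx(1,2)] by simp
    qed (use n t x in auto)
    then show ?thesis by simp
  qed
  obtain \<phi> where \<phi>_pos: "\<And>t. t > 0 \<Longrightarrow> \<phi> t > 0"
    and \<phi>_ode: "\<And>t. t > 0 \<Longrightarrow> (\<phi> has_real_derivative - (\<phi> t * h (\<phi> t))) (at t)"
    and \<phi>_inf: "\<And>M. \<exists>t0>0. \<forall>t. 0 < t \<and> t < t0 \<longrightarrow> \<phi> t > M"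
    using flat_solution_infinite_initial_value[OF h_cont h_mono h_pos h_int] by blast
  have \<phi>_cont: "continuous_on {0<..} \<phi>"
    using \<phi>_ode by (intro continuous_at_imp_continuous_on) (auto intro: DERIV_isCont)
  have \<phi>_smooth: "heat_smooth \<Omega> (\<lambda>t x. \<phi> t) (\<lambda>t x. - f (\<phi> t))" for \<Omega> :: "'a set"
    by (rule heat_smoothI[where vt="\<lambda>t x. - f (\<phi> t)" and vb="\<lambda>b t x. 0" and vbb="\<lambda>b t x. 0"])
       (auto simp: case_prod_beta f_def \<phi>_ode intro!: continuous_on_compose2[OF \<phi>_cont] continuous_intros)
  have u_lower: "V a (norm x) - \<phi> t \<le> u a n t x" if an: "a > 0" "n \<ge> 1" and t: "t > 0" and x: "x \<in> ball 0 (real n)" for a n t x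
  proof -
    define w where "w = (\<lambda>t x. V a (norm x) - u a n t x - \<phi> t)"
    have w: "heat_approx (ball 0 (real n)) w (\<lambda>t x. - f (V a (norm x)) - - f (u a n t x) - - f (\<phi> t))"
      unfolding w_def by (intro heat_approx_diff u_approx an heat_smooth_imp_approx V_smooth \<phi>_smooth)
    have "w t x \<le> 0"
    proof (rule heat_approx_maximum_principle[OF w open_ball _ _ t order_refl x])
      fix s y assume s: "0 < s" "y \<in> ball 0 (real n)" "0 < w s y"
      have "f (u a n s y) + f (\<phi> s) \<le> f (u a n s y + \<phi> s)"
        using u_nonneg[OF an s(1,2)] \<phi>_pos[OF s(1)] by (intro f_super) auto
      also have "\<dots> \<le> f (V a (norm y))"
        using s(3) u_nonneg[OF an s(1,2)] \<phi>_pos[OF s(1)] by (intro f_mono) (auto simp: w_def)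
      finally show "- f (V a (norm y)) - - f (u a n s y) - - f (\<phi> s) \<le> 0" by simp
    next
      fix \<theta> :: real assume \<theta>: "\<theta> > 0"
      \<comment> \<open>Before \<open>t0\<close> the flat solution exceeds \<open>V a n\<close>,
        which bounds \<open>V a\<close> on the ball, so \<open>w < 0\<close> there, also towards the
        corner. On the sphere \<open>w = - \<phi> < 0\<close>. The maximum principle therefore
        applies directly.\<close>
      obtain t0 where t0: "t0 > 0" "\<And>s. 0 < s \<Longrightarrow> s < t0 \<Longrightarrow> \<phi> s > V a (real n)" using \<phi>_inf by blast
      show "compact {(s,y). 0 < s \<and> s \<le> t \<and> y \<in> ball 0 (real n) \<and> w s y \<ge> \<theta>}"
      proof (rule compact_superlevel[where lo=t0 and B="cball 0 (real n)"])
        have sub: "{t0..t} \<times> cball 0 (real n) \<subseteq> {0<..} \<times> cball (0::'a) (real n)" using t0(1) by auto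
        show "continuous_on ({t0..t} \<times> cball 0 (real n)) (\<lambda>(t, x). w t x)"
          using continuous_on_subset[OF u_cont[OF an] sub] t0(1) unfolding w_def case_prod_beta
          by (intro continuous_intros continuous_on_compose2[OF V_cont[OF an(1)]] continuous_on_compose2[OF \<phi>_cont]) auto
      next
        fix s y
        show "(0 < s \<and> s \<le> t \<and> y \<in> ball 0 (real n) \<and> w s y \<ge> \<theta>) = (t0 \<le> s \<and> s \<le> t \<and> y \<in> cball 0 (real n) \<and> w s y \<ge> \<theta>)"
        proof (intro iffI conjI; elim conjE)
          assume s: "0 < s" "y \<in> ball 0 (real n)" "w s y \<ge> \<theta>"
          show "t0 \<le> s"
          proof (rule ccontr)
            assume "\<not> t0 \<le> s"
            then have "\<phi> s > V a (real n)" using t0(2) s(1) by simp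
            moreover have "V a (norm y) \<le> V a (real n)" using s(2) by (intro V_mono an) auto
            ultimately show False using u_nonneg[OF an s(1,2)] s(3) \<theta> by (simp add: w_def)
          qed
        next
          assume s: "t0 \<le> s" "y \<in> cball 0 (real n)" "w s y \<ge> \<theta>"
          show "0 < s" using s t0 by simp
          have "norm y \<noteq> real n"
          proof
            assume "norm y = real n"
            then show False using u_bd[OF an \<open>0 < s\<close>, of y] \<phi>_pos[OF \<open>0 < s\<close>] s(3) \<theta> by (simp add: w_def)
          qed
          then show "y \<in> ball 0 (real n)" using s(2) by simp
        qed auto
      qed (rule compact_cball)
    qed
    then show ?thesis by (simp add: w_def)
  qed
  define U where "U = (\<lambda>a t x. lim (\<lambda>n. u a n t x))"
  have conv: "(\<lambda>n. u a n t x) \<longlonglongrightarrow> U a t x" if a: "a > 0" and t: "t > 0" for a t x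
  proof -
    obtain n0 where n0: "real n0 > norm x" using reals_Archimedean2 by blast
    have n0': "n0 \<ge> 1" using n0 norm_ge_zero[of x] by (cases n0) auto
    have x: "x \<in> ball 0 (real (k + n0))" for k using n0 by simp
    \<comment> \<open>\<open>u a n t x\<close> is meaningful only once \<open>norm x < n\<close>, so
      the sequence is started at \<open>n0\<close>.\<close>
    have "decseq (\<lambda>k. u a (k + n0) t x)"
      unfolding decseq_def using u_mono[OF a _ _ t x] n0' by auto
    moreover have "0 \<le> u a (k + n0) t x" for k using n0' by (intro u_nonneg a t x) auto
    ultimately obtain L where "(\<lambda>k. u a (k + n0) t x) \<longlonglongrightarrow> L" using decseq_convergent[of _ 0] by blast
    then have "(\<lambda>n. u a n t x) \<longlonglongrightarrow> L" by (rule LIMSEQ_offset)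
    then show ?thesis unfolding U_def by (simp add: limI)
  qed
  have ev_ball: "\<forall>\<^sub>F n in sequentially. n \<ge> 1 \<and> x \<in> ball 0 (real n)" for x :: 'a
  proof -
    obtain n0 where n0: "real n0 > norm x" using reals_Archimedean2 by blast
    have "n \<ge> 1 \<and> x \<in> ball 0 (real n)" if "n \<ge> n0" for n
      using n0 that norm_ge_zero[of x] by (cases n) auto
    then show ?thesis unfolding eventually_sequentially by blast
  qed
  have U_ge: "c \<le> U a t x" if a: "a > 0" and t: "t > 0"
    and c: "\<And>n. n \<ge> 1 \<Longrightarrow> x \<in> ball 0 (real n) \<Longrightarrow> c \<le> u a n t x" for a t x c
    by (rule tendsto_lowerbound[OF conv[OF a t]]) (use ev_ball[of x] c in \<open>auto elim: eventually_mono\<close>)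
  have U_nonneg: "0 \<le> U a t x" if "a > 0" "t > 0" for a t x
    by (rule U_ge[OF that]) (use u_nonneg that in auto)
  have U_lower: "V a (norm x) - \<phi> t \<le> U a t x" if "a > 0" "t > 0" for a t x
    by (rule U_ge[OF that]) (use u_lower that in auto)
  have U_le: "U a t x \<le> u a n t x" if a: "a > 0" and n: "n \<ge> 1" and t: "t > 0" and x: "x \<in> ball 0 (real n)" for a n t x
  proof (rule tendsto_upperbound[OF conv[OF a t]])
    show "\<forall>\<^sub>F k in sequentially. u a k t x \<le> u a n t x"
      using eventually_ge_at_top[of n] by eventually_elim (use u_mono[OF a n _ t x] in auto)
  qed simp
  have U_cont: "continuous_on ({0<..} \<times> UNIV) (\<lambda>(t,x). U a t x)" if a: "a > 0" for a
    unfolding continuous_on_iff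
  proof (intro ballI allI impI)
    fix p0 :: "real \<times> 'a" and e :: real assume "p0 \<in> {0<..} \<times> UNIV" and e: "e > 0"
    then obtain t0 x0 where p0: "p0 = (t0,x0)" and t0: "t0 > 0" by (cases p0) auto
    \<comment> \<open>\<open>W\<close> bounds \<open>u a n\<close> on the ball of radius 3 about
      \<open>x0\<close> because \<open>V a\<close> is increasing, and \<open>f W\<close> bounds the
      right-hand side because \<open>f\<close> is monotone. Neither depends on
      \<open>n\<close>.\<close>
    define W where "W = V a (norm x0 + 3)"
    have W: "W > 0" unfolding W_def by (intro V_pos a) simp
    define M where "M = max W (f W)"
    have M: "M \<ge> 0" "t0 / 2 > 0" "e / 2 > 0" using W t0 e by (auto simp: M_def)
    obtain d where d: "d > 0" "\<And>\<Omega> w k t x. cyl_bound \<Omega> w k {t0 - t0/2..t0 + t0/2} (cball x0 (3 * 1)) M \<Longrightarrow>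
      \<bar>t - t0\<bar> < d \<Longrightarrow> norm (x - x0) < d \<Longrightarrow> \<bar>w t x - w t0 x0\<bar> \<le> e / 2"
      using heat_approx_equicontinuous[OF zero_less_one M(2,1,3), of t0 x0] by blast
    obtain n0 where n0: "real n0 > norm x0 + 3" using reals_Archimedean2 by blast
    have close: "\<bar>u a n t x - u a n t0 x0\<bar> \<le> e / 2" if n: "n \<ge> n0" and tx: "\<bar>t - t0\<bar> < d" "norm (x - x0) < d" for n t x
    proof -
      have n1: "n \<ge> 1" using n n0 norm_ge_zero[of x0] by (cases n) auto
      have near: "norm y \<le> norm x0 + 3" if "y \<in> cball x0 (3 * 1)" for y
        using that norm_triangle_ineq2[of y x0] by (simp add: dist_norm norm_minus_commute)
      have inb: "y \<in> ball 0 (real n)" if "y \<in> cball x0 (3 * 1)" for y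
        using near[OF that] n0 n by simp
      show ?thesis
      proof (rule d(2)[OF _ tx], unfold cyl_bound_def, intro conjI ballI)
        show "{t0 - t0/2..t0 + t0/2} \<times> cball x0 (3 * 1) \<subseteq> {0<..} \<times> ball 0 (real n)"
          using inb t0 by auto
        fix s y assume s: "s \<in> {t0 - t0/2..t0 + t0/2}" and y: "y \<in> cball x0 (3 * 1)"
        have s0: "s > 0" using s t0 by auto
        have "u a n s y \<le> V a (norm y)" by (rule u_le_V[OF a n1 s0 inb[OF y]])
        also have "\<dots> \<le> W" unfolding W_def by (intro V_mono a near y) simp
        finally have uW: "u a n s y \<le> W" .
        have u0: "0 \<le> u a n s y" by (rule u_nonneg[OF a n1 s0 inb[OF y]])
        have "f (u a n s y) \<le> f W" by (rule f_mono[OF u0 uW])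
        then show "\<bar>u a n s y\<bar> \<le> M" "\<bar>- f (u a n s y)\<bar> \<le> M"
          using u0 uW f_nonneg[OF u0] unfolding M_def abs_minus_cancel by auto
      qed (rule u_approx[OF a n1] open_ball)+
    qed
    show "\<exists>d>0. \<forall>p\<in>{0<..} \<times> UNIV. dist p p0 < d \<longrightarrow> dist (case p of (t,x) \<Rightarrow> U a t x) (case p0 of (t,x) \<Rightarrow> U a t x) < e"
    proof (intro exI[of _ d] conjI d(1) ballI impI)
      fix p :: "real \<times> 'a" assume p: "p \<in> {0<..} \<times> UNIV" "dist p p0 < d"
      obtain t x where tx: "p = (t,x)" by (cases p)
      have t: "t > 0" using p(1) tx by simp
      have "\<bar>t - t0\<bar> < d" "norm (x - x0) < d"
        using p(2) dist_fst_le[of p p0] dist_snd_le[of p p0] by (auto simp: tx p0 dist_real_def dist_norm)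
      note cl = close[OF _ this]
      have "(\<lambda>n. \<bar>u a n t x - u a n t0 x0\<bar>) \<longlonglongrightarrow> \<bar>U a t x - U a t0 x0\<bar>"
        by (intro tendsto_intros conv a t t0)
      then have "\<bar>U a t x - U a t0 x0\<bar> \<le> e / 2"
        by (rule LIMSEQ_le_const2) (use cl in blast)
      then show "dist (case p of (t,x) \<Rightarrow> U a t x) (case p0 of (t,x) \<Rightarrow> U a t x) < e"
        using e by (simp add: tx p0 dist_real_def)
    qed
  qed
  have \<psi>_cont: "continuous_on UNIV (\<psi> a)" if "a > 0" for a
    unfolding \<psi>_def by (intro continuous_intros V_cont that g_cont)
  have U_init: "\<forall>\<^sub>F t in at_right 0. \<forall>x\<in>K. \<bar>U a t x - \<psi> a x\<bar> < e"
    if a: "a > 0" and K: "compact K" and e: "e > 0" for a K and e :: real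
  proof -
    obtain r where r: "r > 0" "\<And>x. x \<in> K \<Longrightarrow> norm x \<le> r"
      using compact_imp_bounded[OF K] bounded_pos by blast
    obtain n0 where n0: "real n0 > r + 1" using reals_Archimedean2 by blast
    have n0': "n0 \<ge> 1" using n0 r(1) by (cases n0) auto
    have KB: "K \<subseteq> ball 0 (real n0)" using r(2) n0 by force
    have "uniformly_continuous_on (cball 0 (r + 1)) (\<psi> a)"
      by (rule compact_uniformly_continuous) (auto intro: continuous_on_subset[OF \<psi>_cont[OF a]])
    then obtain d where d: "d > 0" "\<And>x y. x \<in> cball 0 (r + 1) \<Longrightarrow> y \<in> cball 0 (r + 1) \<Longrightarrow> dist y x < d \<Longrightarrow> dist (\<psi> a y) (\<psi> a x) < e / 3"
      using e unfolding uniformly_continuous_on_def by (metis zero_less_divide_iff zero_less_numeral)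
    \<comment> \<open>The cap 1 keeps balls about points of \<open>K\<close> inside radius
      \<open>r + 1\<close>, where \<open>\<psi> a\<close> is uniformly continuous.\<close>
    define \<rho> where "\<rho> = min d 1"
    have \<rho>: "\<rho> > 0" "\<rho> \<le> d" "\<rho> \<le> 1" using d(1) by (auto simp: \<rho>_def)
    define P where "P = V a (r + 1)"
    have P: "P \<ge> 0" using V_pos[OF a, of "r + 1"] r(1) by (simp add: P_def)
    define L where "L = 2 * real DIM('a) * ((P + 1) / \<rho>\<^sup>2) + f P"
    have L: "L \<ge> 0" using P f_nonneg[OF P] by (simp add: L_def)
    \<comment> \<open>The time interval in \<open>u_init\<close> depends on \<open>n\<close>, so the
      lower bound cannot be taken from it in the limit; the barrier supplies a rate \<open>L\<close>
      independent of \<open>n\<close> and of the point of \<open>K\<close>. From above a single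
      index is enough, since \<open>U a \<le> u a n0\<close>.\<close>
    have lower: "\<psi> a x - e / 3 - L * t \<le> U a t x" if x: "x \<in> K" and t: "t > 0" for x t
    proof -
      have nx: "norm x \<le> r" by (rule r(2)[OF x])
      have inr: "y \<in> cball 0 (r + 1)" if "y \<in> cball x \<rho>" for y
        using that nx \<rho>(3) norm_triangle_ineq2[of y x] by (simp add: dist_norm norm_minus_commute)
      have lown: "\<psi> a x - e / 3 - L * t \<le> u a n t x" if n: "n \<ge> n0" for n
      proof -
        have n1: "n \<ge> 1" using n n0' by simp
        have sub: "cball x \<rho> \<subseteq> ball 0 (real n)" using inr n n0 by force
        have sub': "ball x \<rho> \<subseteq> ball 0 (real n)" using sub ball_subset_cball by blast
        show ?thesis unfolding L_def
        proof (rule initial_lower_barrier[where \<psi>="\<psi> a" and A="\<psi> a x - e / 3"])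
          show "heat_approx (ball x \<rho>) (u a n) (\<lambda>t x. - f (u a n t x))"
            by (rule heat_approx_mono[OF u_approx[OF a n1] sub'])
        next
          fix e' :: real assume e': "e' > 0"
          show "\<forall>\<^sub>F t in at_right 0. \<forall>x\<in>ball x \<rho>. \<psi> a x - u a n t x < e'"
            using u_init[OF a n1 compact_cball sub e']
            by eventually_elim (force simp: abs_less_iff)
        next
          fix y assume "y \<in> ball x \<rho>"
          then have "dist y x < d" "y \<in> cball 0 (r + 1)" "x \<in> cball 0 (r + 1)"
            using inr[of y] inr[of x] \<rho> by (auto simp: dist_commute)
          from d(2)[OF this(3,2,1)] show "\<psi> a x - e / 3 \<le> \<psi> a y" unfolding dist_real_def by linarith
        next
          have "\<psi> a x \<le> V a (norm x)" by (simp add: \<psi>_def)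
          also have "\<dots> \<le> P" unfolding P_def using nx by (intro V_mono a) auto
          finally show "\<psi> a x - e / 3 \<le> P" using e by simp
        next
          fix t :: real and y :: 'a assume "t > 0" "y \<in> ball x \<rho>"
          then show "0 \<le> u a n t y" using u_nonneg[OF a n1] sub' by blast
        qed (use \<rho> P t f_mono f_nonneg[OF P] in auto)
      qed
      show ?thesis by (rule LIMSEQ_le_const[OF conv[OF a t]]) (use lown in blast)
    qed
    \<comment> \<open>Up to \<open>t1\<close> the drift \<open>L t\<close> costs at most
      \<open>e/3\<close>; with the \<open>e/3\<close> lost to the oscillation of
      \<open>\<psi> a\<close> the total stays below \<open>e\<close>. The \<open>+ 1\<close> avoids
      dividing by zero.\<close>
    define t1 where "t1 = e / 3 / (L + 1)"
    have t1: "t1 > 0" using e L by (simp add: t1_def)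
    have cancel: "(L + 1) * (c / (L + 1)) = c" for c using L by simp
    have "\<forall>\<^sub>F t in at_right 0. 0 < t \<and> t < t1"
      unfolding eventually_at_right_field using t1 by blast
    then show ?thesis using u_init[OF a n0' K KB e]
    proof eventually_elim
      case (elim t)
      show ?case
      proof
        fix x assume x: "x \<in> K"
        have "L * t \<le> (L + 1) * t1" using elim(1) L by (intro mult_mono) auto
        also have "(L + 1) * t1 = e / 3"
          unfolding t1_def by (rule cancel)
        finally have "L * t \<le> e / 3" .
        then have "\<psi> a x - e < U a t x" using lower[OF x, of t] elim(1) e by linarith
        moreover have "U a t x \<le> u a n0 t x" using elim(1) x KB by (intro U_le a n0') auto
        moreover have "u a n0 t x < \<psi> a x + e" using elim(2) x by (auto simp: abs_less_iff)
        ultimately show "\<bar>U a t x - \<psi> a x\<bar> < e" by (simp add: abs_less_iff)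
      qed
    qed
  qed
  have U_sol: "sol_init h UNIV (\<psi> a) (U a)" if a: "a > 0" for a
    unfolding sol_init_def
  proof (intro conjI)
    show "weak_sol h UNIV (U a)"
      by (rule weak_sol_limit[where u="u a" and \<beta>="\<lambda>x. V a (norm x)"])
         (use u_weak u_nonneg u_le_V V_cont conv U_cont h_cont h_mono h0 a in auto)
  qed (use U_nonneg U_init a in auto)
  have "filterlim (\<lambda>a. U a t x) at_top at_top" if t: "t > 0" for t x
  proof (rule filterlim_at_top_mono)
    have "filterlim (\<lambda>a. - \<phi> t + a) at_top at_top"
      by (rule filterlim_tendsto_add_at_top[OF tendsto_const filterlim_ident])
    then show "filterlim (\<lambda>a. a - \<phi> t) at_top at_top" by simp
    show "\<forall>\<^sub>F a in at_top. a - \<phi> t \<le> U a t x"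
      using eventually_gt_at_top[of 0]
    proof eventually_elim
      case (elim a)
      then show ?case using U_lower[OF elim t, of x] V_ge[OF elim, of "norm x"] by simp
    qed
  qed
  moreover have "u a n2 t x \<le> u a n1 t x" if "a > 0" "m' < n1" "n1 \<le> n2" "t > 0" "x \<in> ball 0 (real m')" for a m' n1 n2 t x
    using that by (intro u_mono) auto
  ultimately show ?thesis
    using conv U_sol unfolding \<psi>_def by (intro exI[of _ U]) auto
qed

end
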